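(* Let $\mathcal{A}$ be a finite set and let $x\in\mathcal{A}^{\mathbb{N}}$ be Weyl rationally almost periodic (WRAP). Then for all $f\in C(X_x)$ and all $z\in X_x$ we have $$\lim_{N\to\infty}\frac1N\sum_{n=1}^N f(S^nz)\,\boldsymbol{\mu}(n)=0,$$ where $\boldsymbol{\mu}$ is the Möbius function.
   Context: $\mathbb{N}=\{1,2,3,\dots\}$; $\mathcal{A}^{\mathbb{Z}}$ carries the product topology and $S$ is the left shift, $(Sy)(n)=y(n+1)$. For $x\in\mathcal{A}^{\mathbb{N}}$, $X_x=\{y\in\mathcal{A}^{\mathbb{Z}}:\text{each finite word appearing in }y\text{ appears in }x\}$, where a word appearing in $y$ is a block $(y(n),\dots,y(m))$; $X_x$ is closed and $S$-invariant. Weyl pseudo-metric on $\mathcal{A}^{\mathbb{N}}$: $d_W(x,y)=\limsup_{N\to\infty}\sup_{\ell\ge1}\frac1N|\{\ell\le n\le\ell+N:x(n)\ne y(n)\}|$. A sequence $x\in\mathcal{A}^{\mathbb{N}}$ is Weyl rationally almost periodic (WRAP) if it is a $d_W$-limit of periodic sequences in $\mathcal{A}^{\mathbb{N}}$, i.e. for every $\varepsilon>0$ there is a periodic $y\in\mathcal{A}^{\mathbb{N}}$ with $d_W(x,y)<\varepsilon$. *)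

theory Defs
  imports
    "HOL-Analysis.Analysis"
    "HOL-Computational_Algebra.Squarefree"
begin

text \<open>
  One-sided sequences are indexed by the positive integers and are represented by functions on
  \<open>nat\<close> whose value at \<open>0\<close> is irrelevant: no definition below depends on it.
\<close>

definition one_sided :: "'a set \<Rightarrow> (nat \<Rightarrow> 'a) set" where
  "one_sided A = {1..} \<rightarrow> A"

definition two_sided :: "'a set \<Rightarrow> (int \<Rightarrow> 'a) set" where
  "two_sided A = UNIV \<rightarrow> A"

definition two_sided_topology :: "'a set \<Rightarrow> (int \<Rightarrow> 'a) topology" where
  "two_sided_topology A = product_topology (\<lambda>_. discrete_topology A) UNIV"

definition shift :: "(int \<Rightarrow> 'a) \<Rightarrow> int \<Rightarrow> 'a" where
  "shift y = (\<lambda>n. y (n + 1))"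

definition one_sided_words :: "(nat \<Rightarrow> 'a) \<Rightarrow> 'a list set" where
  "one_sided_words x = {map x [k..<Suc l] | k l. 1 \<le> k \<and> k \<le> l}"

definition two_sided_words :: "(int \<Rightarrow> 'a) \<Rightarrow> 'a list set" where
  "two_sided_words y = {map y [n..m] | n m. n \<le> m}"

definition subshift :: "'a set \<Rightarrow> (nat \<Rightarrow> 'a) \<Rightarrow> (int \<Rightarrow> 'a) set" where
  "subshift A x = {y \<in> two_sided A. two_sided_words y \<subseteq> one_sided_words x}"

text \<open>
  The window \<open>{l..l + N}\<close> has \<open>N + 1\<close> elements while the normalisation is \<open>1 / N\<close>; the term
  for \<open>N = 0\<close> is a junk value that the limes superior ignores. The values are extended reals, so
  that the supremum and the limes superior need no boundedness side conditions.
\<close>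

definition weyl_dist :: "(nat \<Rightarrow> 'a) \<Rightarrow> (nat \<Rightarrow> 'a) \<Rightarrow> ereal" where
  "weyl_dist x y =
     limsup (\<lambda>N. SUP l\<in>{1..}. ereal (1 / real N * real (card {n \<in> {l..l + N}. x n \<noteq> y n})))"

definition periodic_seq :: "(nat \<Rightarrow> 'a) \<Rightarrow> bool" where
  "periodic_seq y \<longleftrightarrow> (\<exists>p\<ge>1. \<forall>n\<ge>1. y (n + p) = y n)"

definition WRAP :: "'a set \<Rightarrow> (nat \<Rightarrow> 'a) \<Rightarrow> bool" where
  "WRAP A x \<longleftrightarrow> x \<in> one_sided A \<and>
     (\<forall>\<epsilon>>0. \<exists>y\<in>one_sided A. periodic_seq y \<and> weyl_dist x y < ereal \<epsilon>)"

definition moebius_mu :: "nat \<Rightarrow> int" where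
  "moebius_mu n = (if squarefree n then (- 1) ^ card (prime_factors n) else 0)"

end

theory Submission
  imports
    Defs
    "HOL-Number_Theory.Number_Theory"
    "HOL-Complex_Analysis.Complex_Analysis"
    "HOL-Probability.Sinc_Integral"
    "HOL-Real_Asymp.Real_Asymp"
begin

text \<open>
By compactness of the subshift, a continuous function is uniformly close to a function of the
coordinates \<open>-m..m\<close> (\<open>continuous_on_subshift_local\<close>). Every block of a point \<open>z\<close> of the subshift
occurs in \<open>x\<close>, and the supremum over the starting position in the Weyl distance makes the
approximation of \<open>x\<close> by a periodic \<open>y\<close> equally good on every block. So \<open>z\<close> restricted to \<open>1..N\<close>
agrees, up to a small proportion of places, with one of the finitely many translates of \<open>y\<close>
(\<open>subshift_window_close\<close>); which translate may depend on \<open>N\<close>, but finitely many null sequences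
tend to 0 uniformly. What remains is the arithmetic heart of the matter: the Moebius function
averages to 0 against every periodic sequence (\<open>moebius_periodic_mean\<close>), which is a form of the
prime number theorem in arithmetic progressions.

Splitting a periodic sequence according to the greatest common divisor with the period reduces it
to sequences supported on the reduced residues, and these are linear combinations of Dirichlet
characters (\<open>coprime_periodic_induct\<close>). For a character \<open>\<psi>\<close> the series of \<open>\<mu>(n) \<psi>(n) n\<^sup>-\<^sup>s\<close> is
\<open>1 / L(s, \<psi>)\<close>, and a Tauberian theorem (\<open>tauberian_mean\<close>) shows that bounded coefficients have
mean 0 as soon as their Dirichlet series extends continuously to the line \<open>Re s = 1\<close>. Its proof
convolves with the Fejer kernel: the compact support of the Fourier transform of this kernel makes
the values on a bounded segment of the line suffice, and the Riemann-Lebesgue lemma finishes.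

The extension of \<open>1 / L(s, \<psi>)\<close> requires that \<open>(s - 1) L(s, \<psi>)\<close>, which is holomorphic for
\<open>Re s > 0\<close>, has no zero on the line, except for a simple one at \<open>s = 1\<close> when \<open>L\<close> has no pole there.
The inequality \<open>3 + 4 cos \<theta> + cos 2\<theta> \<ge> 0\<close> proves this in all cases but that of a real character at
\<open>s = 1\<close> (\<open>cleared_series_char_line\<close>). There, \<open>\<zeta>(s) L(s, \<psi>)\<close> has non-negative coefficients that are
at least 1 at the squares; a further zero would make it holomorphic for \<open>Re s > 0\<close>, so that by
Landau's argument its series would converge at \<open>1/2\<close>, where it dominates the harmonic series
(\<open>real_char_deriv_nonzero\<close>).
\<close>

section \<open>Divisor sums and the Moebius function\<close>

text \<open>
Removing the full power of one prime from \<open>n\<close> leaves a coprime cofactor, so statements about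
multiplicative functions need to be checked on one prime power at a time.
\<close>

lemma prime_power_coprime_induct [consumes 1, case_names one step]:
  fixes n :: nat
  assumes "n > 0" and one: "P 1"
    and step: "\<And>p k m. prime p \<Longrightarrow> k > 0 \<Longrightarrow> coprime p m \<Longrightarrow> m > 0 \<Longrightarrow> P m \<Longrightarrow> P (p ^ k * m)"
  shows "P n"
  using \<open>n > 0\<close>
proof (induction n rule: less_induct)
  case (less n)
  show ?case
  proof (cases "n = 1")
    case False
    then obtain p where p: "prime p" "p dvd n" using prime_factor_nat by blast
    define k where "k = multiplicity p n"
    obtain m where m: "n = p ^ k * m" "\<not> p dvd m"
      using multiplicity_decompose'[of n p] less.prems p unfolding k_def by (metis not_prime_unit less_irrefl)
    have k: "k > 0" using m p by (cases k) auto
    have m0: "m > 0" using m less.prems by (cases m) auto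
    have "p ^ k > 1" using p k by (metis one_less_power prime_gt_1_nat)
    then have "m < n" using m m0 by simp
    moreover have "coprime p m" using p m by (simp add: prime_imp_coprime)
    ultimately have "P (p ^ k * m)" using p k m0 less.IH by (intro step) auto
    then show ?thesis using m(1) by simp
  qed (use one in simp)
qed

text \<open>
A divisor of a product of coprime numbers is in exactly one way a product of divisors of the factors.
\<close>

lemma divisor_sum_coprime_mult:
  fixes f :: "nat \<Rightarrow> 'a :: comm_semiring_1"
  assumes f: "\<And>a b. coprime a b \<Longrightarrow> f (a * b) = f a * f b"
    and mn: "coprime m n" "m > 0" "n > 0"
  shows "(\<Sum>d | d dvd m * n. f d) = (\<Sum>d | d dvd m. f d) * (\<Sum>d | d dvd n. f d)"
proof -
  let ?D = "{d. d dvd m} \<times> {d. d dvd n}"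
  have inj: "inj_on (\<lambda>(a, b). a * b) ?D"
  proof (rule inj_onI)
    fix x y assume xy: "x \<in> ?D" "y \<in> ?D" "(case x of (a, b) \<Rightarrow> a * b) = (case y of (a, b) \<Rightarrow> a * b)"
    obtain a b c d where xy_eq: "x = (a, b)" "y = (c, d)" by fastforce
    have *: "a dvd m" "b dvd n" "c dvd m" "d dvd n" "a * b = c * d" using xy by (auto simp: xy_eq)
    have cop: "coprime a d" "coprime c b"
      using coprime_divisors[OF *(1,4) mn(1)] coprime_divisors[OF *(3,2) mn(1)] by auto
    have "a dvd c * d" "c dvd a * b" using *(5) by (metis dvd_triv_left)+
    then have "a dvd c" "c dvd a" using cop by (auto simp: coprime_dvd_mult_left_iff)
    then have "a = c" by (simp add: dvd_antisym)
    moreover have "a > 0" using *(1) mn(2) dvd_pos_nat by blast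
    ultimately show "x = y" using *(5) by (simp add: xy_eq)
  qed
  have img: "(\<lambda>(a, b). a * b) ` ?D = {d. d dvd m * n}"
  proof (intro equalityI subsetI)
    fix d assume "d \<in> {d. d dvd m * n}"
    then obtain a b where "d = a * b" "a dvd m" "b dvd n" using division_decomp by blast
    then show "d \<in> (\<lambda>(a, b). a * b) ` ?D" by (intro image_eqI[of _ _ "(a, b)"]) simp_all
  qed (auto simp: mult_dvd_mono)
  have "(\<Sum>d | d dvd m * n. f d) = (\<Sum>(a, b)\<in>?D. f (a * b))"
    unfolding img[symmetric] by (subst sum.reindex[OF inj]) (simp add: case_prod_unfold o_def)
  also have "\<dots> = (\<Sum>(a, b)\<in>?D. f a * f b)"
    using f coprime_divisors[OF _ _ mn(1)] by (intro sum.cong refl) fastforce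
  finally show ?thesis by (simp add: sum_product sum.cartesian_product)
qed

lemma divisor_sum_prime_power:
  fixes f :: "nat \<Rightarrow> 'a :: comm_monoid_add"
  assumes "prime p"
  shows "(\<Sum>d | d dvd p ^ k. f d) = (\<Sum>i\<le>k. f (p ^ i))"
proof -
  have "{d. d dvd p ^ k} = (\<lambda>i. p ^ i) ` {..k}"
    using assms by (auto simp: divides_primepow_nat)
  moreover have "inj_on (\<lambda>i. p ^ i) {..k}"
    using assms by (intro inj_onI) (auto dest: prime_gt_1_nat)
  ultimately show ?thesis by (simp add: sum.reindex)
qed

lemma moebius_mu_1 [simp]: "moebius_mu 1 = 1" "moebius_mu (Suc 0) = 1"
  by (auto simp: moebius_mu_def)

lemma abs_moebius_mu_le: "\<bar>moebius_mu n\<bar> \<le> 1"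
  by (auto simp: moebius_mu_def power_abs)

lemma moebius_mu_coprime_mult:
  assumes "coprime a b"
  shows "moebius_mu (a * b) = moebius_mu a * moebius_mu b"
proof (cases "squarefree a \<and> squarefree b")
  case True
  then have nz: "a \<noteq> 0" "b \<noteq> 0" by (metis not_squarefree_0)+
  have "prime_factors a \<inter> prime_factors b = {}"
    using assms by (auto simp: in_prime_factors_iff dest: coprime_common_divisor_nat)
  then have "card (prime_factors (a * b)) = card (prime_factors a) + card (prime_factors b)"
    using nz by (simp add: prime_factors_product card_Un_disjoint)
  then show ?thesis using True assms squarefree_mult_coprime[OF assms]
    by (simp add: moebius_mu_def power_add)
qed (auto simp: moebius_mu_def dest: squarefree_multD)

text \<open>
Among the divisors of a prime power only \<open>1\<close> and \<open>p\<close> contribute, and their contributions cancel.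
\<close>

lemma divisor_sum_moebius_mu:
  assumes "n > 0"
  shows "(\<Sum>d | d dvd n. moebius_mu d) = (if n = 1 then 1 else 0)"
  using assms
proof (induction n rule: prime_power_coprime_induct)
  case (step p k m)
  have "(\<Sum>d | d dvd p ^ k. moebius_mu d) = (\<Sum>i\<le>k. moebius_mu (p ^ i))"
    by (rule divisor_sum_prime_power) fact
  also have "\<dots> = (\<Sum>i\<in>{0, 1}. moebius_mu (p ^ i))"
    using step(1,2) by (intro sum.mono_neutral_right) (auto simp: moebius_mu_def squarefree_power_iff)
  also have "\<dots> = 0"
    using step(1) by (simp add: moebius_mu_def prime_factorization_prime squarefree_prime)
  finally have "(\<Sum>d | d dvd p ^ k * m. moebius_mu d) = 0"
    using step by (subst divisor_sum_coprime_mult) (auto simp: moebius_mu_coprime_mult dest: prime_gt_0_nat)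
  moreover have "p ^ k * m \<noteq> 1" using step by auto
  ultimately show ?case by simp
qed simp

text \<open>
These sums are the coefficients of \<open>\<zeta>(s) L(s, f)\<close> for a real character \<open>f\<close>. At a prime power they
are partial sums of \<open>1 + f(p) + f(p)\<^sup>2 + \<dots>\<close>, which are non-negative for \<open>f(p) \<in> {-1, 0, 1}\<close>, and
positive if the exponent is even.
\<close>

lemma divisor_sum_pm1_nonneg:
  fixes f :: "nat \<Rightarrow> real"
  assumes f: "\<And>a b. f (a * b) = f a * f b" "f 1 = 1" "\<And>n. f n \<in> {-1, 0, 1}" and n: "n > 0"
  shows "(\<Sum>d | d dvd n. f d) \<ge> 0"
    and "(\<Sum>d | d dvd n\<^sup>2. f d) \<ge> 1"
proof -
  have pow: "f (p ^ i) = f p ^ i" for p i 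
  proof (induction i)
    case (Suc i)
    then show ?case using f(1)[of p "p ^ i"] by simp
  qed (use f(2) in simp)
  have S: "(\<Sum>d | d dvd p ^ k. f d) \<ge> (if even k then 1 else 0)" if "prime p" for p k
  proof -
    have "(\<Sum>i\<le>k. (- 1 :: real) ^ i) = (if even k then 1 else 0)" by (induction k) auto
    moreover have "(\<Sum>i\<le>k. (0 :: real) ^ i) = 1" by (induction k) auto
    ultimately show ?thesis
      using f(3)[of p] unfolding divisor_sum_prime_power[OF that] pow by (elim insertE emptyE) auto
  qed
  show "(\<Sum>d | d dvd n. f d) \<ge> 0" using n
  proof (induction n rule: prime_power_coprime_induct)
    case (step p k m)
    have "(\<Sum>d | d dvd p ^ k. f d) \<ge> 0" using S[OF step(1), of k] by (auto split: if_splits)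
    then have "(\<Sum>d | d dvd p ^ k. f d) * (\<Sum>d | d dvd m. f d) \<ge> 0" using step(5) by simp
    also have "(\<Sum>d | d dvd p ^ k. f d) * (\<Sum>d | d dvd m. f d) = (\<Sum>d | d dvd p ^ k * m. f d)"
      using step(1-4) f(1) by (intro divisor_sum_coprime_mult[symmetric]) (auto dest: prime_gt_0_nat)
    finally show ?case .
  qed (use f(2) in simp)
  show "(\<Sum>d | d dvd n\<^sup>2. f d) \<ge> 1" using n
  proof (induction n rule: prime_power_coprime_induct)
    case (step p k m)
    have "(1::real) * 1 \<le> (\<Sum>d | d dvd p ^ (2 * k). f d) * (\<Sum>d | d dvd m\<^sup>2. f d)"
      using step(5) S[OF step(1), of "2 * k"] by (intro mult_mono) auto
    also have "\<dots> = (\<Sum>d | d dvd p ^ (2 * k) * m\<^sup>2. f d)"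
      using step(1-4) f(1) by (intro divisor_sum_coprime_mult[symmetric]) (auto dest: prime_gt_0_nat)
    finally show ?case by (simp add: power_mult_distrib power_mult[symmetric] mult.commute)
  qed (use f(2) in simp)
qed

section \<open>Dirichlet characters\<close>

text \<open>
Characters of the group of units modulo \<open>q\<close>, extended by 0 and regarded as periodic functions on the
natural numbers, which lets them serve directly as coefficients of Dirichlet series.
\<close>

definition dirichlet_char :: "nat \<Rightarrow> (nat \<Rightarrow> complex) \<Rightarrow> bool" where
  "dirichlet_char q \<psi> \<longleftrightarrow> q > 0 \<and> (\<forall>m n. \<psi> (m * n) = \<psi> m * \<psi> n) \<and> (\<forall>n. \<psi> (n + q) = \<psi> n) \<and>
     (\<forall>n. \<psi> n \<noteq> 0 \<longleftrightarrow> coprime n q)"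

lemma periodic_mult:
  fixes f :: "nat \<Rightarrow> 'b"
  assumes "\<And>n. f (n + q) = f n"
  shows "f (n + k * q) = f n"
proof (induction k)
  case (Suc k)
  have "f (n + Suc k * q) = f ((n + k * q) + q)" by (simp add: algebra_simps)
  also have "\<dots> = f (n + k * q)" by (rule assms)
  finally show ?case using Suc by simp
qed simp

lemma periodic_mod:
  fixes f :: "nat \<Rightarrow> 'b"
  assumes "\<And>n. f (n + q) = f n"
  shows "f (n mod q) = f n"
  using periodic_mult[of f q "n mod q" "n div q", OF assms] by simp

lemma periodic_cong:
  fixes f :: "nat \<Rightarrow> 'b"
  assumes "\<And>n. f (n + q) = f n" "[m = n] (mod q)"
  shows "f m = f n"
  using periodic_mod[of f q m, OF assms(1)] periodic_mod[of f q n, OF assms(1)] assms(2) by (simp add: cong_def)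

lemma
  assumes "dirichlet_char q \<psi>"
  shows dirichlet_char_pos: "q > 0"
    and dirichlet_char_mult: "\<psi> (m * n) = \<psi> m * \<psi> n"
    and dirichlet_char_add: "\<psi> (n + q) = \<psi> n"
    and dirichlet_char_eq_0_iff: "\<psi> n = 0 \<longleftrightarrow> \<not> coprime n q"
  using assms by (auto simp: dirichlet_char_def)

lemma dirichlet_char_1: "dirichlet_char q \<psi> \<Longrightarrow> \<psi> 1 = 1"
  using dirichlet_char_mult[of q \<psi> 1 1] dirichlet_char_eq_0_iff[of q \<psi> 1] by simp

lemma dirichlet_char_power: "dirichlet_char q \<psi> \<Longrightarrow> \<psi> (n ^ k) = \<psi> n ^ k"
  by (induction k) (auto simp: dirichlet_char_mult dirichlet_char_1[unfolded One_nat_def])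

text \<open>
By Euler's theorem the values at numbers coprime to \<open>q\<close> are roots of unity.
\<close>

lemma norm_dirichlet_char:
  assumes "dirichlet_char q \<psi>"
  shows "norm (\<psi> n) = (if coprime n q then 1 else 0)"
proof (cases "coprime n q")
  case True
  have "\<psi> n ^ totient q = \<psi> (n ^ totient q)" by (simp add: dirichlet_char_power[OF assms])
  also have "\<dots> = \<psi> 1"
    by (rule periodic_cong[where f = \<psi> and q = q, OF dirichlet_char_add[OF assms]]) (rule euler_theorem[OF True])
  finally have "norm (\<psi> n) ^ totient q = 1"
    by (metis dirichlet_char_1[OF assms] norm_one norm_power)
  moreover have "totient q > 0" using dirichlet_char_pos[OF assms] by simp
  ultimately have "norm (\<psi> n) = 1"
    by (metis norm_ge_zero power_eq_1_iff power_eq_imp_eq_base power_one zero_le_one)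
  then show ?thesis using True by simp
qed (use dirichlet_char_eq_0_iff[OF assms] in auto)

lemma norm_dirichlet_char_le: "dirichlet_char q \<psi> \<Longrightarrow> norm (\<psi> n) \<le> 1"
  by (simp add: norm_dirichlet_char)

lemma dirichlet_char_square:
  assumes "dirichlet_char q \<psi>"
  shows "dirichlet_char q (\<lambda>n. (\<psi> n)\<^sup>2)"
  using assms by (auto simp: dirichlet_char_def power_mult_distrib)

lemma dirichlet_char_norm:
  assumes "dirichlet_char q \<psi>"
  shows "dirichlet_char q (\<lambda>n. of_real (norm (\<psi> n)))"
  using assms by (auto simp: dirichlet_char_def norm_mult)

lemma dirichlet_char_trivial: "dirichlet_char 1 (\<lambda>_. 1)"
  by (simp add: dirichlet_char_def)

text \<open>
Multiplication by \<open>b\<close> permutes the residues, so it multiplies the sum by \<open>\<psi> b\<close> without changing it.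
\<close>

lemma dirichlet_char_sum_eq_0:
  assumes \<psi>: "dirichlet_char q \<psi>" and b: "coprime b q" "\<psi> b \<noteq> 1"
  shows "(\<Sum>a<q. \<psi> a) = 0"
proof -
  have q: "q > 0" using dirichlet_char_pos[OF \<psi>] .
  have inj: "inj_on (\<lambda>a. b * a mod q) {..<q}"
  proof (rule inj_onI)
    fix x y assume xy: "x \<in> {..<q}" "y \<in> {..<q}" "b * x mod q = b * y mod q"
    then have "[b * x = b * y] (mod q)" by (simp add: cong_def)
    then have "[x = y] (mod q)" using b by (simp add: cong_mult_lcancel_nat)
    then show "x = y" using xy by (simp add: cong_def)
  qed
  have "(\<lambda>a. b * a mod q) ` {..<q} \<subseteq> {..<q}" using q by auto
  with inj have "(\<lambda>a. b * a mod q) ` {..<q} = {..<q}" by (intro endo_inj_surj) auto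
  then have "(\<Sum>a<q. \<psi> a) = (\<Sum>a\<in>(\<lambda>a. b * a mod q) ` {..<q}. \<psi> a)" by simp
  also have "\<dots> = (\<Sum>a<q. \<psi> (b * a mod q))" by (simp add: sum.reindex[OF inj])
  also have "\<dots> = (\<Sum>a<q. \<psi> b * \<psi> a)"
    using periodic_mod[of \<psi> q, OF dirichlet_char_add[OF \<psi>]] by (simp add: dirichlet_char_mult[OF \<psi>])
  also have "\<dots> = \<psi> b * (\<Sum>a<q. \<psi> a)" by (simp add: sum_distrib_left)
  finally have "(1 - \<psi> b) * (\<Sum>a<q. \<psi> a) = 0" by (simp add: left_diff_distrib)
  then show ?thesis using b by simp
qed

lemma sum_roots_of_unity_power:
  assumes "k < e"
  shows "(\<Sum>j<e. cis (2 * pi * real j / real e) ^ k) = (if k = 0 then of_nat e else 0)"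
proof (cases "k = 0")
  case False
  define z where "z = cis (2 * pi * real k / real e)"
  have e: "e > 0" using assms by simp
  have "z \<noteq> 1"
  proof
    assume "z = 1"
    then have "cis (2 * pi * real k / real e) = cis (2 * pi * real 0 / real e)" by (simp add: z_def)
    moreover have "inj_on (\<lambda>k. cis (2 * pi * real k / real e)) {..<e}"
      using Complex.bij_betw_roots_unity[OF e] by (simp add: bij_betw_def)
    ultimately have "k = 0" using assms e by (elim inj_onD) auto
    then show False using False by simp
  qed
  have "(\<Sum>j<e. cis (2 * pi * real j / real e) ^ k) = (\<Sum>j<e. z ^ j)"
    unfolding z_def by (intro sum.cong refl) (simp add: Complex.DeMoivre mult_ac)
  also have "\<dots> = (z ^ e - 1) / (z - 1)" using \<open>z \<noteq> 1\<close> by (simp add: geometric_sum)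
  also have "z ^ e = cis (2 * pi * real k)" using e by (simp add: z_def Complex.DeMoivre)
  also have "\<dots> = 1" by (metis cis_multiple_2pi Ints_of_nat)
  finally show ?thesis using False by simp
qed simp

text \<open>
The characters span the periodic functions that are supported on the numbers coprime to \<open>q\<close>. The
dilations \<open>f \<mapsto> (\<lambda>n. f (g * n))\<close> by units \<open>g\<close> commute and have finite order, so a function can be
split into eigenfunctions of one dilation after the other by averaging against roots of unity. A
common eigenfunction \<open>f\<close> of all dilations satisfies \<open>f (m * n) * f 1 = f m * f n\<close>, so it is 0 or a
multiple of a character. The statement has the form of an induction rule so that a property that is
closed under sums can be transferred without naming the decomposition.
\<close>

lemma coprime_periodic_induct:
  fixes f :: "nat \<Rightarrow> complex"
  assumes q: "q > 0" and per: "\<And>n. f (n + q) = f n" and supp: "\<And>n. \<not> coprime n q \<Longrightarrow> f n = 0"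
    and char: "\<And>\<psi> c. dirichlet_char q \<psi> \<Longrightarrow> good (\<lambda>n. c * \<psi> n)"
    and zero: "good (\<lambda>_. 0)" and add: "\<And>f g. good f \<Longrightarrow> good g \<Longrightarrow> good (\<lambda>n. f n + g n)"
  shows "good f"
proof -
  define U where "U = {g. g < q \<and> coprime g q}"
  have fin: "finite C" if "C \<subseteq> U" for C by (rule finite_subset[OF that]) (auto simp: U_def)
  have sums: "good (\<lambda>n. \<Sum>j<k. F j n)" if "\<And>j. good (F j)" for k :: nat and F :: "nat \<Rightarrow> nat \<Rightarrow> complex"
    by (induction k) (use that zero add in auto)
  have "good f"
    if "C \<subseteq> U" "\<And>n. f (n + q) = f n" "\<And>n. \<not> coprime n q \<Longrightarrow> f n = 0"
      "\<And>g. g \<in> U - C \<Longrightarrow> \<exists>w. \<forall>n. f (g * n) = w * f n" for C f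
    using fin[OF that(1)] that
  proof (induction C arbitrary: f rule: finite_induct)
    case empty
    have eig: "\<exists>w. \<forall>n. f (g * n) = w * f n" if g: "coprime g q" for g
    proof -
      have "g mod q \<in> U" using q g by (auto simp: U_def coprime_commute)
      then obtain w where w: "\<And>n. f ((g mod q) * n) = w * f n" using empty.prems(4) by blast
      have "f (g * n) = f ((g mod q) * n)" for n
        by (rule periodic_cong[where f = f and q = q, OF empty.prems(2)]) (simp add: cong_def mod_mult_left_eq)
      then show ?thesis using w by auto
    qed
    have fm: "f (g * n) * f 1 = f g * f n" for g n
    proof (cases "coprime g q")
      case True
      then obtain w where w: "\<And>n. f (g * n) = w * f n" using eig by blast
      from w[of 1] w[of n] show ?thesis by simp
    qed (use empty.prems(3) in auto)
    show ?case
    proof (cases "f 1 = 0")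
      case True
      have "f g = 0" for g
      proof (cases "coprime g q")
        case True': True
        then obtain w where w: "\<And>n. f (g * n) = w * f n" using eig by blast
        from w[of 1] True show ?thesis by simp
      qed (use empty.prems(3) in auto)
      then have "f = (\<lambda>_. 0)" by auto
      then show ?thesis using zero by simp
    next
      case False
      define \<psi> where "\<psi> = (\<lambda>n. f n / f 1)"
      have "f n \<noteq> 0" if n: "coprime n q" for n
      proof -
        from n obtain m where m: "[n * m = 1] (mod q)" using cong_solve_coprime_nat by auto
        have "f (n * m) = f 1" by (rule periodic_cong[where f = f and q = q, OF empty.prems(2) m])
        then show ?thesis using fm[of n m] False by auto
      qed
      then have "dirichlet_char q \<psi>"
        using q empty.prems(2,3) False fm by (auto simp: dirichlet_char_def \<psi>_def field_simps)
      from char[OF this, of "f 1"] show ?thesis using False by (simp add: \<psi>_def)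
    qed
  next
    case (insert g C)
    define e where "e = totient q"
    have e: "e > 0" using q by (simp add: e_def)
    have g: "coprime g q" using insert.prems by (auto simp: U_def)
    define w where "w j = cis (2 * pi * real j / real e)" for j
    \<comment> \<open>The dilation by \<open>g\<close> has order dividing \<open>e\<close>, so its eigenvalues are \<open>e\<close>-th roots of unity.\<close>
    have we: "w j ^ e = 1" for j
      using e by (simp add: w_def Complex.DeMoivre)
    \<comment> \<open>The projection of \<open>f\<close> to the eigenspace of the eigenvalue \<open>inverse (w j)\<close>.\<close>
    define F where "F j n = (\<Sum>k<e. w j ^ k * f (g ^ k * n)) / of_nat e" for j n
    have "f n = (\<Sum>j<e. F j n)" for n
    proof -
      have "(\<Sum>j<e. F j n) = (\<Sum>j<e. \<Sum>k<e. w j ^ k * f (g ^ k * n)) / of_nat e"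
        by (simp add: F_def sum_divide_distrib)
      also have "(\<Sum>j<e. \<Sum>k<e. w j ^ k * f (g ^ k * n)) = (\<Sum>k<e. (\<Sum>j<e. w j ^ k) * f (g ^ k * n))"
        by (subst sum.swap) (simp add: sum_distrib_right)
      also have "\<dots> = (\<Sum>k<e. if k = 0 then of_nat e * f n else 0)"
        by (intro sum.cong refl) (simp add: w_def sum_roots_of_unity_power)
      also have "\<dots> = of_nat e * f n" using e by (simp add: sum.delta)
      finally show ?thesis using e by simp
    qed
    moreover have "good (F j)" for j
    proof (rule insert.IH)
      show "C \<subseteq> U" using insert.prems by auto
      show "F j (n + q) = F j n" for n
      proof -
        have "f (g ^ k * (n + q)) = f (g ^ k * n)" for k
          by (rule periodic_cong[where f = f and q = q, OF insert.prems(2)]) (simp add: cong_def algebra_simps)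
        then show ?thesis by (simp add: F_def)
      qed
      show "F j n = 0" if "\<not> coprime n q" for n
        using that insert.prems(3) by (simp add: F_def)
      show "\<exists>v. \<forall>n. F j (h * n) = v * F j n" if h: "h \<in> U - C" for h
      proof (cases "h = g")
        case True
        have "w j * F j (g * n) = F j n" for n
        proof -
          let ?t = "\<lambda>k. w j ^ k * f (g ^ k * n)"
          have ge: "[g ^ e * n = 1 * n] (mod q)" using euler_theorem[OF g] unfolding e_def cong_def by (metis mod_mult_left_eq)
          have "f (g ^ e * n) = f (1 * n)" by (rule periodic_cong[where f = f and q = q, OF insert.prems(2) ge])
          then have te: "?t e = ?t 0" using we by simp
          have "w j * F j (g * n) = (\<Sum>k<e. ?t (Suc k)) / of_nat e"
            by (simp add: F_def sum_distrib_left mult_ac)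
          also have "(\<Sum>k<e. ?t (Suc k)) = (\<Sum>k<Suc e. ?t k) - ?t 0" by (subst sum.lessThan_Suc_shift) simp
          also have "\<dots> = (\<Sum>k<e. ?t k)" using te by simp
          finally show ?thesis by (simp add: F_def)
        qed
        moreover have "w j \<noteq> 0" by (simp add: w_def)
        ultimately have "\<forall>n. F j (g * n) = inverse (w j) * F j n" by (simp add: field_simps)
        then show ?thesis using True by blast
      next
        case False
        then obtain v where v: "\<And>n. f (h * n) = v * f n" using insert.prems(4)[of h] h by auto
        have "F j (h * n) = v * F j n" for n
        proof -
          have "f (g ^ k * (h * n)) = v * f (g ^ k * n)" for k
            using v[of "g ^ k * n"] by (simp add: mult_ac)
          then show ?thesis by (simp add: F_def sum_distrib_left sum_divide_distrib mult_ac)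
        qed
        then show ?thesis by blast
      qed
    qed
    ultimately show ?case using sums[of F e] by (simp add: fun_eq_iff[symmetric])
  qed
  from this[of U f] show ?thesis using per supp by auto
qed

section \<open>Dirichlet series\<close>

text \<open>
The summand at \<open>n = 0\<close> vanishes because \<open>0 powr s = 0\<close>.
\<close>

definition dseries :: "(nat \<Rightarrow> complex) \<Rightarrow> complex \<Rightarrow> complex" where
  "dseries a s = (\<Sum>n. a n * of_nat n powr (- s))"

definition dsummable :: "(nat \<Rightarrow> complex) \<Rightarrow> bool" where
  "dsummable a \<longleftrightarrow> (\<forall>\<sigma>>1. summable (\<lambda>n. norm (a n) * real n powr (- \<sigma>)))"

definition dirichlet_prod :: "(nat \<Rightarrow> complex) \<Rightarrow> (nat \<Rightarrow> complex) \<Rightarrow> nat \<Rightarrow> complex" where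
  "dirichlet_prod a b n = (\<Sum>d | d dvd n. a d * b (n div d))"

lemma dsummable_bounded:
  assumes "\<And>n. norm (a n) \<le> C"
  shows "dsummable a"
  unfolding dsummable_def
proof (intro allI impI)
  fix \<sigma> :: real assume "\<sigma> > 1"
  then have "summable (\<lambda>n. C * real n powr (- \<sigma>))"
    by (intro summable_mult) (simp add: summable_real_powr_iff)
  then show "summable (\<lambda>n. norm (a n) * real n powr (- \<sigma>))"
    by (rule summable_comparison_test'[of _ 0]) (use assms in \<open>auto intro!: mult_right_mono\<close>)
qed

lemma dsummable_mono:
  assumes "dsummable b" "\<And>n. norm (a n) \<le> norm (b n)"
  shows "dsummable a"
  unfolding dsummable_def
proof (intro allI impI)
  fix \<sigma> :: real assume "\<sigma> > 1"
  with assms(1) have "summable (\<lambda>n. norm (b n) * real n powr (- \<sigma>))" by (simp add: dsummable_def)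
  then show "summable (\<lambda>n. norm (a n) * real n powr (- \<sigma>))"
    by (rule summable_comparison_test'[of _ 0]) (use assms(2) in \<open>auto intro!: mult_right_mono\<close>)
qed

text \<open>
The logarithm grows more slowly than every positive power, so the coefficients of the termwise
derivative are again summable in the same half-plane.
\<close>

lemma dsummable_ln:
  assumes "dsummable a"
  shows "dsummable (\<lambda>n. - of_real (ln (real n)) * a n)"
  unfolding dsummable_def
proof (intro allI impI)
  fix \<sigma> :: real assume s: "\<sigma> > 1"
  define e where "e = (\<sigma> - 1) / 2"
  have e: "e > 0" "\<sigma> - e > 1" using s by (auto simp: e_def field_simps)
  have "summable (\<lambda>n. norm (a n) * real n powr (- (\<sigma> - e)))" using assms e unfolding dsummable_def by blast
  then have "summable (\<lambda>n. (1 / e) * (norm (a n) * real n powr (- (\<sigma> - e))))" by (rule summable_mult)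
  then show "summable (\<lambda>n. norm (- of_real (ln (real n)) * a n) * real n powr (- \<sigma>))"
  proof (rule summable_comparison_test'[of _ 0])
    fix n :: nat
    show "norm (norm (- of_real (ln (real n)) * a n) * real n powr (- \<sigma>)) \<le> (1 / e) * (norm (a n) * real n powr (- (\<sigma> - e)))"
    proof (cases "n = 0")
      case False
      have "\<bar>ln (real n)\<bar> \<le> real n powr e / e" using False e(1) ln_powr_bound[of "real n" e] by simp
      then have "\<bar>ln (real n)\<bar> * norm (a n) \<le> real n powr e / e * norm (a n)" by (intro mult_right_mono) auto
      then have "norm (- of_real (ln (real n)) * a n) * real n powr (- \<sigma>) \<le> (real n powr e / e) * norm (a n) * real n powr (- \<sigma>)"
        by (intro mult_right_mono) (auto simp: norm_mult)
      also have "\<dots> = (1 / e) * (norm (a n) * (real n powr e * real n powr (- \<sigma>)))" by simp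
      also have "real n powr e * real n powr (- \<sigma>) = real n powr (- (\<sigma> - e))"
        using False by (simp add: powr_add[symmetric])
      finally show ?thesis by simp
    qed simp
  qed
qed

lemma norm_dseries_term: "norm (a n * of_nat n powr (- s)) = norm (a n) * real n powr (- Re s)"
  by (cases "n = 0") (auto simp: norm_mult norm_powr_real_powr)

lemma
  assumes "dsummable a" "Re s > 1"
  shows summable_norm_dseries: "summable (\<lambda>n. norm (a n * of_nat n powr (- s)))"
    and dseries_sums: "(\<lambda>n. a n * of_nat n powr (- s)) sums dseries a s"
proof -
  show *: "summable (\<lambda>n. norm (a n * of_nat n powr (- s)))"
    unfolding norm_dseries_term using assms by (simp add: dsummable_def)
  show "(\<lambda>n. a n * of_nat n powr (- s)) sums dseries a s"
    unfolding dseries_def by (intro summable_sums summable_norm_cancel[OF *])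
qed

lemma has_field_derivative_dseries:
  assumes a: "dsummable a" and s: "Re s > 1"
  shows "(dseries a has_field_derivative dseries (\<lambda>n. - of_real (ln (real n)) * a n) s) (at s)"
proof -
  let ?S = "{s. Re s > 1}"
  let ?f = "\<lambda>n s. a n * of_nat n powr (- s)"
  let ?f' = "\<lambda>n s. - of_real (ln (real n)) * a n * of_nat n powr (- s)"
  have op: "open ?S" by (simp add: open_halfspace_Re_gt)
  have "\<exists>g g'. \<forall>x\<in>?S. ((\<lambda>n. ?f n x) sums g x) \<and> ((\<lambda>n. ?f' n x) sums g' x) \<and> (g has_field_derivative g' x) (at x)"
  proof (rule series_and_derivative_comparison_local[OF op])
    show "(?f n has_field_derivative ?f' n x) (at x)" if "x \<in> ?S" for n x
    proof (cases "n = 0")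
      case False
      have "((\<lambda>s. a n * exp (- s * of_real (ln (real n)))) has_field_derivative - of_real (ln (real n)) * a n * exp (- x * of_real (ln (real n)))) (at x)"
        by (auto intro!: derivative_eq_intros simp: mult_ac)
      then show ?thesis using False by (simp add: powr_def Ln_of_nat)
    qed simp
  next
    fix x assume x: "x \<in> ?S"
    define d where "d = (Re x - 1) / 2"
    have d: "d > 0" "Re x - d > 1" using x by (auto simp: d_def field_simps)
    show "\<exists>d h. 0 < d \<and> summable h \<and> (\<forall>\<^sub>F n in sequentially. \<forall>y\<in>ball x d \<inter> ?S. norm (?f n y) \<le> h n)"
    proof (intro exI conjI)
      show "summable (\<lambda>n. norm (a n) * real n powr (- (Re x - d)))" using a d unfolding dsummable_def by blast
      show "\<forall>\<^sub>F n in sequentially. \<forall>y\<in>ball x d \<inter> ?S. norm (?f n y) \<le> norm (a n) * real n powr (- (Re x - d))"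
        using eventually_ge_at_top[of 1]
      proof eventually_elim
        case (elim n)
        show ?case
        proof
          fix y assume "y \<in> ball x d \<inter> ?S"
          then have "\<bar>Re (x - y)\<bar> < d" using abs_Re_le_cmod[of "x - y"] by (auto simp: dist_norm)
          then have "- Re y \<le> - (Re x - d)" by auto
          then have "real n powr (- Re y) \<le> real n powr (- (Re x - d))" using elim by (intro powr_mono) auto
          then show "norm (?f n y) \<le> norm (a n) * real n powr (- (Re x - d))"
            unfolding norm_dseries_term by (rule mult_left_mono) simp
        qed
      qed
    qed (use d in auto)
  qed
  then obtain g g' where g: "\<And>x. x \<in> ?S \<Longrightarrow> (\<lambda>n. ?f n x) sums g x" "\<And>x. x \<in> ?S \<Longrightarrow> (\<lambda>n. ?f' n x) sums g' x"
     "\<And>x. x \<in> ?S \<Longrightarrow> (g has_field_derivative g' x) (at x)" by blast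
  have "(dseries a has_field_derivative g' s) (at s)"
  proof (rule has_field_derivative_transform_within_open[OF g(3) op])
    show "g x = dseries a x" if "x \<in> ?S" for x using g(1)[OF that] by (simp add: dseries_def sums_iff)
  qed (use s in auto)
  moreover have "g' s = dseries (\<lambda>n. - of_real (ln (real n)) * a n) s"
    using g(2)[of s] s by (simp add: dseries_def sums_iff)
  ultimately show ?thesis by simp
qed

lemma has_sum_from_1_iff:
  fixes f :: "nat \<Rightarrow> 'a :: {comm_monoid_add, topological_space}"
  assumes "f 0 = 0"
  shows "(f has_sum S) {1..} \<longleftrightarrow> (f has_sum S) UNIV"
  by (rule has_sum_cong_neutral) (use assms in \<open>auto simp: Suc_le_eq\<close>)

lemma divisor_pairs_bij:
  "bij_betw (\<lambda>(n, d). (d, n div d)) (SIGMA n:{1..}. {d. d dvd n}) ({1..} \<times> {1..} :: (nat \<times> nat) set)"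
  by (rule bij_betw_byWitness[where f' = "\<lambda>(d, e). (d * e, d)"])
     (auto elim!: dvdE)

text \<open>
The absolutely convergent double sum over all pairs of positive numbers is rearranged along the
hyperbolas \<open>d * e = n\<close>.
\<close>

lemma divisor_convolution_has_sum:
  fixes f g :: "nat \<Rightarrow> complex"
  assumes f: "summable (\<lambda>n. norm (f n))" "f sums A" "f 0 = 0"
    and g: "summable (\<lambda>n. norm (g n))" "g sums B" "g 0 = 0"
  shows "(\<lambda>n. \<Sum>d | d dvd n. f d * g (n div d)) sums (A * B)"
    and "summable (\<lambda>n. norm (\<Sum>d | d dvd n. f d * g (n div d)))"
proof -
  let ?pair = "\<lambda>(n, d). (d, n div d)"
  define h where "h n = (\<Sum>d | d dvd n. f d * g (n div d))" for n
  define hn where "hn n = (\<Sum>d | d dvd n. norm (f d) * norm (g (n div d)))" for n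
  let ?N = "{1..} :: nat set"
  have 1: "((\<lambda>n. norm (f n)) has_sum (\<Sum>n. norm (f n))) ?N" "((\<lambda>n. norm (g n)) has_sum (\<Sum>n. norm (g n))) ?N"
    using f g by (subst has_sum_from_1_iff; auto intro!: norm_summable_imp_has_sum summable_sums)+
  have 2: "(f has_sum A) ?N" "(g has_sum B) ?N"
    using f g by (subst has_sum_from_1_iff; auto intro!: norm_summable_imp_has_sum)+
  have "(\<lambda>(d, e). norm (f d) * norm (g e)) summable_on (?N \<times> ?N)"
  proof (rule summable_on_SigmaI)
    show "((\<lambda>e. case (d, e) of (d, e) \<Rightarrow> norm (f d) * norm (g e)) has_sum norm (f d) * (\<Sum>n. norm (g n))) ?N" for d
      using has_sum_cmult_right[OF 1(2)] by simp
    show "(\<lambda>d. norm (f d) * (\<Sum>n. norm (g n))) summable_on ?N"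
      using 1(1) by (intro summable_on_cmult_left) (auto simp: summable_on_def)
  qed auto
  then have abs: "(\<lambda>x. norm (case x of (d, e) \<Rightarrow> f d * g e)) summable_on (?N \<times> ?N)"
    by (simp add: case_prod_unfold norm_mult)
  have fin: "finite {d. d dvd n}" if "n \<in> ?N" for n using that by (auto intro!: finite_divisors_nat)
  have hs: "((\<lambda>(d, e). f d * g e) has_sum A * B) (?N \<times> ?N)"
  proof (rule has_sum_SigmaI)
    show "((\<lambda>e. case (d, e) of (d, e) \<Rightarrow> f d * g e) has_sum f d * B) ?N" for d
      using has_sum_cmult_right[OF 2(2)] by simp
    show "((\<lambda>d. f d * B) has_sum A * B) ?N" by (rule has_sum_cmult_left[OF 2(1)])
    show "(\<lambda>(d, e). f d * g e) summable_on ?N \<times> ?N" using abs by (rule abs_summable_summable)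
  qed
  then have "((\<lambda>x. case (?pair x) of (d, e) \<Rightarrow> f d * g e) has_sum A * B) (SIGMA n:?N. {d. d dvd n})"
    by (subst has_sum_reindex_bij_betw[OF divisor_pairs_bij])
  then have "(h has_sum A * B) ?N"
    by (rule has_sum_SigmaD) (use fin in \<open>auto simp: h_def intro!: has_sum_finiteI\<close>)
  then show "(\<lambda>n. \<Sum>d | d dvd n. f d * g (n div d)) sums (A * B)"
    unfolding h_def using f(3) g(3) by (subst (asm) has_sum_from_1_iff) (auto intro: has_sum_imp_sums)
  from abs have "(\<lambda>(d, e). norm (f d) * norm (g e)) summable_on (?N \<times> ?N)"
    by (simp add: case_prod_unfold norm_mult)
  then have "(\<lambda>x. case (?pair x) of (d, e) \<Rightarrow> norm (f d) * norm (g e)) summable_on (SIGMA n:?N. {d. d dvd n})"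
    by (subst summable_on_reindex_bij_betw[OF divisor_pairs_bij])
  then obtain T where "((\<lambda>x. case (?pair x) of (d, e) \<Rightarrow> norm (f d) * norm (g e)) has_sum T) (SIGMA n:?N. {d. d dvd n})"
    unfolding summable_on_def by blast
  then have "(hn has_sum T) ?N"
    by (rule has_sum_SigmaD) (use fin in \<open>auto simp: hn_def intro!: has_sum_finiteI\<close>)
  then have "summable hn"
    using f(3) g(3) by (subst (asm) has_sum_from_1_iff) (auto simp: hn_def summable_def intro: has_sum_imp_sums)
  then show "summable (\<lambda>n. norm (\<Sum>d | d dvd n. f d * g (n div d)))"
    by (rule summable_comparison_test'[of _ 0]) (auto simp: hn_def norm_mult intro!: sum_norm_le)
qed

lemma dirichlet_prod_term:
  "(\<Sum>d | d dvd n. (a d * of_nat d powr (- s)) * (b (n div d) * of_nat (n div d) powr (- s))) =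
     dirichlet_prod a b n * of_nat n powr (- s)"
proof (cases "n = 0")
  case False
  have "(\<Sum>d | d dvd n. (a d * of_nat d powr (- s)) * (b (n div d) * of_nat (n div d) powr (- s))) =
        (\<Sum>d | d dvd n. a d * b (n div d) * of_nat n powr (- s))"
  proof (intro sum.cong refl)
    fix d assume "d \<in> {d. d dvd n}"
    then obtain e where n: "n = d * e" by auto
    with False have de: "d > 0" "e > 0" by auto
    have "of_nat (d * e) powr (- s) = of_nat d powr (- s) * of_nat e powr (- s)"
      using de by (simp add: powr_times_real)
    then show "(a d * of_nat d powr (- s)) * (b (n div d) * of_nat (n div d) powr (- s)) = a d * b (n div d) * of_nat n powr (- s)"
      using de by (simp add: n)
  qed
  then show ?thesis by (simp add: dirichlet_prod_def sum_distrib_right)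
qed (simp add: dirichlet_prod_def)

lemma dseries_dirichlet_prod:
  assumes a: "dsummable a" and b: "dsummable b" and s: "Re s > 1"
  shows "dseries (dirichlet_prod a b) s = dseries a s * dseries b s"
  using divisor_convolution_has_sum(1)[OF summable_norm_dseries[OF a s] dseries_sums[OF a s] _ summable_norm_dseries[OF b s] dseries_sums[OF b s]]
  unfolding dirichlet_prod_term by (simp add: dseries_def sums_iff)

lemma dsummable_dirichlet_prod:
  assumes a: "dsummable a" and b: "dsummable b"
  shows "dsummable (dirichlet_prod a b)"
  unfolding dsummable_def
proof (intro allI impI)
  fix \<sigma> :: real assume "\<sigma> > 1"
  then have s: "Re (of_real \<sigma>) > 1" by simp
  show "summable (\<lambda>n. norm (dirichlet_prod a b n) * real n powr (- \<sigma>))"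
    using divisor_convolution_has_sum(2)[OF summable_norm_dseries[OF a s] dseries_sums[OF a s] _ summable_norm_dseries[OF b s] dseries_sums[OF b s]]
    unfolding dirichlet_prod_term norm_dseries_term by simp
qed

text \<open>
Landau's theorem on Dirichlet series with non-negative coefficients. The derivatives of \<open>H\<close> at 2
alternate in sign, so all terms of the Taylor series at 2 evaluated at \<open>x < 2\<close> are non-negative. The
disc of radius 2 about 2 lies in the domain of \<open>H\<close>, hence the Taylor series converges to \<open>H x\<close>.
Keeping only the coefficients with index below \<open>N\<close> decreases every Taylor term, and turns the
Taylor series into the one of the exponential functions \<open>n powr (- x)\<close>.
\<close>

lemma landau_partial_sum_le:
  fixes a :: "nat \<Rightarrow> real"
  assumes a: "dsummable (\<lambda>n. of_real (a n))" "\<And>n. a n \<ge> 0"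
    and H: "H holomorphic_on {s. Re s > 0}" "\<And>s. Re s > 1 \<Longrightarrow> H s = dseries (\<lambda>n. of_real (a n)) s"
    and x: "0 < x" "x < 2"
  shows "(\<Sum>n<N. a n * real n powr (- x)) \<le> Re (H (of_real x))"
proof -
  let ?t = "\<lambda>k n. a n * real n powr (- 2) * (((2 - x) * ln (real n)) ^ k / fact k)"
  define c where "c k n = (- complex_of_real (ln (real n))) ^ k * of_real (a n)" for k n
  have c: "dsummable (c k)" for k
  proof (induction k)
    case (Suc k)
    from dsummable_ln[OF Suc] show ?case by (simp add: c_def mult_ac)
  qed (use a in \<open>simp add: c_def\<close>)
  have op: "open {s. Re s > 1}" by (simp add: open_halfspace_Re_gt)
  have deriv: "Re s > 1 \<Longrightarrow> (deriv ^^ k) H s = dseries (c k) s" for k s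
  proof (induction k arbitrary: s)
    case 0
    then show ?case using H(2) by (simp add: c_def)
  next
    case (Suc k)
    have "c (Suc k) = (\<lambda>n. - of_real (ln (real n)) * c k n)" by (intro ext) (simp add: c_def mult_ac)
    then have "(dseries (c k) has_field_derivative dseries (c (Suc k)) s) (at s)"
      using has_field_derivative_dseries[OF c Suc.prems] by simp
    then have "((deriv ^^ k) H has_field_derivative dseries (c (Suc k)) s) (at s)"
      by (rule has_field_derivative_transform_within_open[OF _ op]) (use Suc in auto)
    then show ?case by (simp add: DERIV_imp_deriv)
  qed
  have "H holomorphic_on ball 2 2"
  proof (rule holomorphic_on_subset[OF H(1)], safe)
    fix s :: complex assume "s \<in> ball 2 2"
    then have "\<bar>Re (2 - s)\<bar> < 2" using abs_Re_le_cmod[of "2 - s"] by (auto simp: dist_norm)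
    then show "Re s > 0" by auto
  qed
  moreover have "norm (2 - of_real x :: complex) < 2"
  proof -
    have "(2 - of_real x :: complex) = of_real (2 - x)" by simp
    then show ?thesis using x by (simp only: norm_of_real)
  qed
  then have "of_real x \<in> ball (2::complex) 2" by (simp add: dist_norm)
  ultimately have S: "(\<lambda>k. (deriv ^^ k) H 2 / fact k * (of_real x - 2) ^ k) sums H (of_real x)"
    by (rule holomorphic_power_series)
  have tk: "(\<Sum>n<N. ?t k n) \<le> Re ((deriv ^^ k) H 2 / fact k * (of_real x - 2) ^ k)" for k
  proof -
    define r where "r n = (ln (real n)) ^ k * a n * real n powr (- 2)" for n
    have r0: "r n \<ge> 0" for n
      using a(2)[of n] by (cases "n = 0") (auto simp: r_def intro!: mult_nonneg_nonneg)
    have eq: "c k n * of_nat n powr (- 2) = of_real ((- 1) ^ k * r n)" for n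
    proof -
      have "of_nat n powr (- 2 :: complex) = of_real (real n powr (- 2))"
        by (cases "n = 0") (simp_all add: powr_of_real[symmetric])
      then show ?thesis by (simp add: c_def r_def power_minus[of "complex_of_real (ln (real n))"])
    qed
    have "(\<lambda>n. of_real ((- 1) ^ k * r n)) sums dseries (c k) 2"
      using dseries_sums[OF c, of 2 k] unfolding eq by simp
    then have "(\<lambda>n. (- 1) ^ k * ((- 1) ^ k * r n)) sums ((- 1) ^ k * Re (dseries (c k) 2))"
      by (intro sums_mult) (auto dest: sums_Re)
    then have sr: "r sums ((- 1) ^ k * Re (dseries (c k) 2))"
      by (simp add: mult.assoc[symmetric] power_mult_distrib[symmetric])
    have im: "Im (dseries (c k) 2) = 0"
      using sums_Im[OF \<open>(\<lambda>n. of_real ((- 1) ^ k * r n)) sums dseries (c k) 2\<close>] by (simp add: sums_iff)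
    then have d: "dseries (c k) 2 = of_real (Re (dseries (c k) 2))" by (simp add: complex_eq_iff)
    have "(deriv ^^ k) H 2 = of_real (Re (dseries (c k) 2))" using d by (simp add: deriv)
    then have "(deriv ^^ k) H 2 / fact k * (of_real x - 2) ^ k = of_real (Re (dseries (c k) 2) / fact k * (x - 2) ^ k)"
      by simp
    then have "Re ((deriv ^^ k) H 2 / fact k * (of_real x - 2) ^ k) = Re (dseries (c k) 2) / fact k * (x - 2) ^ k"
      by (simp only: Re_complex_of_real)
    also have "\<dots> = Re (dseries (c k) 2) / fact k * ((- 1) ^ k * (2 - x) ^ k)"
      by (simp add: power_mult_distrib[symmetric])
    also have "\<dots> = ((- 1) ^ k * Re (dseries (c k) 2)) * ((2 - x) ^ k / fact k)" by simp
    also have "\<dots> \<ge> (\<Sum>n<N. r n) * ((2 - x) ^ k / fact k)"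
      using x sum_le_suminf[OF sums_summable[OF sr], of "{..<N}"] r0 sr
      by (intro mult_right_mono) (auto simp: sums_iff)
    finally have "(\<Sum>n<N. r n) * ((2 - x) ^ k / fact k) \<le> Re ((deriv ^^ k) H 2 / fact k * (of_real x - 2) ^ k)" .
    moreover have "(\<Sum>n<N. ?t k n) = (\<Sum>n<N. r n) * ((2 - x) ^ k / fact k)"
      unfolding sum_distrib_right by (intro sum.cong refl) (simp add: r_def power_mult_distrib mult_ac)
    ultimately show ?thesis by simp
  qed
  have "(\<lambda>k. \<Sum>n<N. ?t k n) sums
     (\<Sum>n<N. a n * real n powr (- 2) * exp ((2 - x) * ln (real n)))"
  proof (intro sums_sum sums_mult)
    fix n
    show "(\<lambda>k. ((2 - x) * ln (real n)) ^ k / fact k) sums exp ((2 - x) * ln (real n))"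
      using exp_converges[of "(2 - x) * ln (real n)"] by (simp add: divide_inverse mult.commute)
  qed
  from sums_le[OF tk this sums_Re[OF S]]
  have "(\<Sum>n<N. a n * real n powr (- 2) * exp ((2 - x) * ln (real n))) \<le> Re (H (of_real x))" .
  also have "(\<Sum>n<N. a n * real n powr (- 2) * exp ((2 - x) * ln (real n))) = (\<Sum>n<N. a n * real n powr (- x))"
  proof (intro sum.cong refl)
    fix n
    have "real n powr (- 2) * exp ((2 - x) * ln (real n)) = real n powr (- x)"
      by (cases "n = 0") (auto simp: powr_def exp_add[symmetric] algebra_simps)
    then show "a n * real n powr (- 2) * exp ((2 - x) * ln (real n)) = a n * real n powr (- x)" by simp
  qed
  finally show ?thesis .
qed

section \<open>Analytic continuation for periodic coefficients\<close>

text \<open>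
With \<open>u = k * q + a\<close>, this is \<open>s - 1\<close> times the difference between \<open>u powr (- s)\<close> and the mean of
\<open>t powr (- s)\<close> over \<open>[u, u + q]\<close>. The factor \<open>s - 1\<close> removes the denominator of the integral, so that
the term is entire.
\<close>

definition block_term :: "nat \<Rightarrow> nat \<Rightarrow> nat \<Rightarrow> complex \<Rightarrow> complex" where
  "block_term q a k s = (s - 1) * of_nat (k * q + a) powr (- s) +
     (of_nat (Suc k * q + a) powr (1 - s) - of_nat (k * q + a) powr (1 - s)) / of_nat q"

text \<open>
For \<open>q\<close>-periodic \<open>f\<close> this is the continuation of \<open>(s - 1)\<close> times the Dirichlet series of \<open>f\<close>
(\<open>cleared_series_eq\<close>). The factor clears the only possible pole, so that one holomorphic function
treats principal and other characters alike.
\<close>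

definition cleared_series :: "nat \<Rightarrow> (nat \<Rightarrow> complex) \<Rightarrow> complex \<Rightarrow> complex" where
  "cleared_series q f s = (\<Sum>a=1..q. f a * (of_nat a powr (1 - s) / of_nat q + (\<Sum>k. block_term q a k s)))"

text \<open>
The term is the error of the first order Taylor expansion of \<open>z powr (1 - s)\<close> at \<open>u\<close>, divided by
\<open>q\<close>, and is controlled by the second derivative. This gains one power of \<open>u\<close> over the original
summand and gives convergence for \<open>Re s > 0\<close>.
\<close>

lemma norm_block_term_le:
  assumes q: "q > 0" and a: "a > 0" and s: "Re s > 0"
  shows "norm (block_term q a k s) \<le> norm (s - 1) * norm s * real q * real (k * q + a) powr (- Re s - 1)"
proof -
  define u where "u = real (k * q + a)"
  have u: "u > 0" unfolding u_def of_nat_0_less_iff using a by simp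
  define f where "f i z = (if i = 0 then z powr (1 - s) else if i = 1 then (1 - s) * z powr (- s) else (1 - s) * (- s) * z powr (- s - 1))"
    for i :: nat and z :: complex
  let ?S = "closed_segment (complex_of_real u) (of_real (u + real q))"
  define B where "B = norm (s - 1) * norm s * u powr (- Re s - 1)"
  have S: "\<exists>t. z = of_real t \<and> t \<ge> u" if z: "z \<in> ?S" for z
  proof -
    from z have "z \<in> of_real ` closed_segment u (u + real q)" by (simp only: closed_segment_of_real)
    then show ?thesis by (auto simp: closed_segment_eq_real_ivl1)
  qed
  have nonneg: "z \<notin> \<real>\<^sub>\<le>\<^sub>0" if "z \<in> ?S" for z
    using S[OF that] u by (auto simp: complex_nonpos_Reals_iff)
  have "norm (f 0 (of_real (u + real q)) - (\<Sum>i\<le>1. f i (of_real u) * (of_real (u + real q) - of_real u) ^ i / fact i))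
      \<le> B * norm (of_real (u + real q) - complex_of_real u) ^ Suc 1 / fact 1"
  proof (rule complex_Taylor[where S = ?S])
    show "(f i has_field_derivative f (Suc i) x) (at x within ?S)" if "x \<in> ?S" "i \<le> 1" for i x
    proof -
      have "i = 0 \<or> i = 1" using that by auto
      then show ?thesis
      proof
        assume "i = 0"
        have "((\<lambda>z. z powr (1 - s)) has_field_derivative (1 - s) * x powr (1 - s - 1)) (at x)"
          using nonneg[OF that(1)] by (rule has_field_derivative_powr)
        then show ?thesis using \<open>i = 0\<close> unfolding f_def by (simp add: has_field_derivative_at_within)
      next
        assume "i = 1"
        have "((\<lambda>z. (1 - s) * z powr (- s)) has_field_derivative (1 - s) * ((- s) * x powr (- s - 1))) (at x)"
          by (intro DERIV_cmult has_field_derivative_powr nonneg that(1))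
        then show ?thesis using \<open>i = 1\<close> unfolding f_def by (simp add: has_field_derivative_at_within mult.assoc)
      qed
    qed
    show "norm (f (Suc 1) x) \<le> B" if x: "x \<in> ?S" for x
    proof -
      obtain t where t: "x = of_real t" "t \<ge> u" using S[OF x] by blast
      have "norm (f (Suc 1) x) = norm (s - 1) * norm s * t powr (- Re s - 1)"
        using t u by (simp add: f_def norm_mult norm_minus_commute norm_powr_real_powr)
      also have "t powr (- Re s - 1) \<le> u powr (- Re s - 1)"
        using t u s by (intro powr_mono2') auto
      finally show ?thesis by (simp add: B_def mult_left_mono)
    qed
  qed auto
  also have "f 0 (of_real (u + real q)) - (\<Sum>i\<le>1. f i (of_real u) * (of_real (u + real q) - of_real u) ^ i / fact i)
     = of_nat q * block_term q a k s"
    using q by (simp add: f_def block_term_def u_def field_simps)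
  finally have "real q * norm (block_term q a k s) \<le> real q * (B * real q)"
    by (simp add: norm_mult power2_eq_square mult_ac)
  then show ?thesis using q by (simp add: B_def u_def mult_ac)
qed

lemma block_sum_holomorphic:
  assumes q: "q > 0" and a: "a > 0"
  shows "(\<lambda>s. \<Sum>k. block_term q a k s) holomorphic_on {s. Re s > 0}"
    and "\<And>s. Re s > 0 \<Longrightarrow> (\<lambda>k. block_term q a k s) sums (\<Sum>k. block_term q a k s)"
proof -
  let ?S = "{s. Re s > 0}"
  have op: "open ?S" by (simp add: open_halfspace_Re_gt)
  have diff: "block_term q a k field_differentiable at s" for k s
  proof -
    have "block_term q a k holomorphic_on UNIV"
      unfolding block_term_def[abs_def] using a q by (intro holomorphic_intros) auto
    then show ?thesis by (simp add: holomorphic_on_def field_differentiable_at_within)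
  qed
  have "\<exists>g g'. \<forall>x\<in>?S. ((\<lambda>k. block_term q a k x) sums g x) \<and> ((\<lambda>k. deriv (block_term q a k) x) sums g' x) \<and> (g has_field_derivative g' x) (at x)"
  proof (rule series_and_derivative_comparison_local[OF op])
    show "(block_term q a k has_field_derivative deriv (block_term q a k) x) (at x)" for k x
      using diff by (simp add: field_differentiable_derivI)
    fix x assume x: "x \<in> ?S"
    \<comment> \<open>On this disc \<open>Re y > d\<close>, which leaves the exponent \<open>- d - 1\<close>.\<close>
    define d where "d = Re x / 2"
    have d: "d > 0" using x by (simp add: d_def)
    define C where "C = (norm x + d + 1) * (norm x + d) * real q"
    show "\<exists>d h. 0 < d \<and> summable h \<and> (\<forall>\<^sub>F n in sequentially. \<forall>y\<in>ball x d \<inter> ?S. norm (block_term q a n y) \<le> h n)"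
    proof (intro exI conjI)
      show "summable (\<lambda>k. C * real k powr (- d - 1))"
        using d by (intro summable_mult) (simp add: summable_real_powr_iff)
      show "\<forall>\<^sub>F k in sequentially. \<forall>y\<in>ball x d \<inter> ?S. norm (block_term q a k y) \<le> C * real k powr (- d - 1)"
        using eventually_ge_at_top[of 1]
      proof eventually_elim
        case (elim k)
        show ?case
        proof
          fix y assume y: "y \<in> ball x d \<inter> ?S"
          then have xy: "norm (x - y) < d" by (simp add: dist_norm)
          then have ny: "norm y \<le> norm x + d" using norm_triangle_ineq3[of x y] by simp
          have ny1: "norm (y - 1) \<le> norm x + d + 1" using ny norm_triangle_ineq4[of y 1] by simp
          have "\<bar>Re (x - y)\<bar> < d" using xy abs_Re_le_cmod[of "x - y"] by linarith
          moreover have "Re x = d + d" by (simp add: d_def)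
          ultimately have Rey: "Re y > d" by simp
          have "k \<le> k * q + a" using q by (simp add: trans_le_add1)
          then have ku: "real k \<le> real (k * q + a)" by (simp only: of_nat_le_iff)
          have "real (k * q + a) powr (- Re y - 1) \<le> real k powr (- Re y - 1)"
            using ku elim Rey d by (intro powr_mono2') auto
          also have "\<dots> \<le> real k powr (- d - 1)" using elim Rey by (intro powr_mono) auto
          finally have "norm (y - 1) * norm y * real q * real (k * q + a) powr (- Re y - 1) \<le> C * real k powr (- d - 1)"
            unfolding C_def using ny ny1 d by (intro mult_mono) auto
          then show "norm (block_term q a k y) \<le> C * real k powr (- d - 1)"
            using norm_block_term_le[OF q a, of y k] y by simp
        qed
      qed
    qed (use d in auto)
  qed
  then obtain g g' where g: "\<And>x. x \<in> ?S \<Longrightarrow> (\<lambda>k. block_term q a k x) sums g x" "\<And>x. x \<in> ?S \<Longrightarrow> (g has_field_derivative g' x) (at x)"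
    by blast
  show "(\<lambda>k. block_term q a k s) sums (\<Sum>k. block_term q a k s)" if "Re s > 0" for s
    using g(1)[of s] that by (simp add: sums_iff)
  have "g holomorphic_on ?S" using g(2) op by (auto simp: holomorphic_on_open)
  then show "(\<lambda>s. \<Sum>k. block_term q a k s) holomorphic_on ?S"
    by (rule holomorphic_transform) (use g(1) in \<open>simp add: sums_iff\<close>)
qed

lemma cleared_series_holomorphic:
  assumes "q > 0"
  shows "cleared_series q f holomorphic_on {s. Re s > 0}"
  unfolding cleared_series_def[abs_def]
  using assms by (intro holomorphic_intros block_sum_holomorphic) auto

lemma cleared_series_at_1: "cleared_series q f 1 = (\<Sum>a=1..q. f a) / of_nat q"
proof -
  have "block_term q a k 1 = 0" if "a \<ge> 1" for a k
  proof -
    have "of_nat (k * q + a) \<noteq> (0 :: complex)" "of_nat (Suc k * q + a) \<noteq> (0 :: complex)"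
      using that by (simp_all only: of_nat_eq_0_iff)
    then show ?thesis unfolding block_term_def by simp
  qed
  then show ?thesis by (simp add: cleared_series_def sum_divide_distrib)
qed

text \<open>
The integrals telescope.
\<close>

lemma block_term_sum:
  assumes "a > 0" "q > 0"
  shows "of_nat a powr (1 - s) / of_nat q + (\<Sum>k<N. block_term q a k s) =
    (s - 1) * (\<Sum>k<N. of_nat (k * q + a) powr (- s)) + of_nat (N * q + a) powr (1 - s) / of_nat q"
proof (induction N)
  case (Suc N)
  then show ?case using assms by (simp add: block_term_def field_simps)
qed simp

text \<open>
The Dirichlet series is summed over blocks of length \<open>q\<close>; the boundary term \<open>(N * q + a) powr (1 - s)\<close>
left by the telescoping integrals tends to 0 for \<open>Re s > 1\<close>.
\<close>

lemma cleared_series_eq: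
  assumes q: "q > 0" and per: "\<And>n. f (n + q) = f n" and s: "Re s > 1"
  shows "cleared_series q f s = (s - 1) * dseries f s"
proof -
  let ?P = "\<lambda>N. \<Sum>a=1..q. f a * (\<Sum>k<N. of_nat (k * q + a) powr (- s))"
  let ?R = "\<lambda>N. \<Sum>a=1..q. f a * (of_nat (N * q + a) powr (1 - s) / of_nat q)"
  let ?Q = "\<lambda>N. \<Sum>a=1..q. f a * (of_nat a powr (1 - s) / of_nat q + (\<Sum>k<N. block_term q a k s))"
  have perk: "f (k * q + a) = f a" for k a
    using periodic_mult[of f q a k, OF per] by (simp add: add.commute)
  have "norm (f n) \<le> Max ((\<lambda>n. norm (f n)) ` {..<q})" for n
  proof -
    have "f n = f (n mod q)" using perk[of "n div q" "n mod q"] by simp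
    then show ?thesis using q by (intro Max_ge) auto
  qed
  then have dc: "dsummable f" by (rule dsummable_bounded)
  have "(\<lambda>N. \<Sum>n<Suc (N * q). f n * of_nat n powr (- s)) \<longlonglongrightarrow> dseries f s"
  proof -
    have "strict_mono (\<lambda>N. Suc (N * q))" using q by (intro strict_monoI) simp
    from LIMSEQ_subseq_LIMSEQ[OF dseries_sums[OF dc s, unfolded sums_def] this]
    show ?thesis by (simp add: o_def)
  qed
  also have "(\<lambda>N. \<Sum>n<Suc (N * q). f n * of_nat n powr (- s)) = (\<lambda>N. ?P N)"
  proof (rule ext)
    fix N
    let ?g = "\<lambda>n. f (Suc n) * of_nat (Suc n) powr (- s)"
    have "(\<Sum>n<Suc (N * q). f n * of_nat n powr (- s)) = (\<Sum>n<N * q. ?g n)"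
      by (subst sum.lessThan_Suc_shift) simp
    also have "\<dots> = (\<Sum>k<N. \<Sum>n\<in>{k * q..<k * q + q}. ?g n)" by (rule sum.nat_group[symmetric])
    also have "\<dots> = (\<Sum>k<N. \<Sum>a=1..q. f a * of_nat (k * q + a) powr (- s))"
    proof (rule sum.cong[OF refl])
      fix k
      have "(\<Sum>n\<in>{k * q..<k * q + q}. ?g n) = (\<Sum>a=1..q. ?g (k * q + a - 1))"
        by (rule sum.reindex_bij_witness[of _ "\<lambda>a. k * q + a - 1" "\<lambda>n. Suc n - k * q"]) auto
      also have "\<dots> = (\<Sum>a=1..q. f a * of_nat (k * q + a) powr (- s))"
        by (intro sum.cong refl) (use perk in auto)
      finally show "(\<Sum>n\<in>{k * q..<k * q + q}. ?g n) = (\<Sum>a=1..q. f a * of_nat (k * q + a) powr (- s))" .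
    qed
    also have "\<dots> = ?P N"
      by (subst sum.swap) (simp add: sum_distrib_left)
    finally show "(\<Sum>n<Suc (N * q). f n * of_nat n powr (- s)) = ?P N" .
  qed
  finally have lim: "(\<lambda>N. ?P N) \<longlonglongrightarrow> dseries f s" .
  have z: "(\<lambda>N. of_nat (N * q + a) powr (1 - s)) \<longlonglongrightarrow> 0" for a
  proof (rule tendsto_norm_zero_cancel, rule Lim_transform_eventually)
    show "(\<lambda>N. real (N * q + a) powr (1 - Re s)) \<longlonglongrightarrow> 0"
    proof (rule tendsto_neg_powr)
      show "filterlim (\<lambda>N. real (N * q + a)) at_top sequentially"
        using q by real_asymp
    qed (use s in auto)
    show "\<forall>\<^sub>F N in sequentially. real (N * q + a) powr (1 - Re s) = norm (of_nat (N * q + a) powr (1 - s))"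
      using eventually_ge_at_top[of 1]
    proof eventually_elim
      case (elim N)
      then have "norm (complex_of_real (real (N * q + a)) powr (1 - s)) = real (N * q + a) powr (1 - Re s)"
        using q by (subst norm_powr_real_powr) auto
      then show ?case by simp
    qed
  qed
  have "(\<lambda>N. (s - 1) * ?P N + ?R N)
      \<longlonglongrightarrow> (s - 1) * dseries f s + (\<Sum>a=1..q. f a * (0 / of_nat q))"
    by (intro tendsto_intros lim z) (use q in auto)
  also have "(\<lambda>N. (s - 1) * ?P N + ?R N)
     = (\<lambda>N. ?Q N)"
  proof (rule ext)
    fix N
    have "?Q N =
      (\<Sum>a=1..q. (s - 1) * (f a * (\<Sum>k<N. of_nat (k * q + a) powr (- s))) + f a * (of_nat (N * q + a) powr (1 - s) / of_nat q))"
      by (intro sum.cong refl, subst block_term_sum) (use q in \<open>auto simp: distrib_left mult_ac\<close>)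
    then show "(s - 1) * ?P N + ?R N
      = ?Q N"
      by (simp only: sum.distrib sum_distrib_left)
  qed
  finally have "(\<lambda>N. ?Q N) \<longlonglongrightarrow> (s - 1) * dseries f s"
    by simp
  moreover have "(\<lambda>N. ?Q N) \<longlonglongrightarrow> cleared_series q f s"
    unfolding cleared_series_def
  proof (intro tendsto_intros)
    fix a assume "a \<in> {1..q}"
    then have "(\<lambda>k. block_term q a k s) sums (\<Sum>k. block_term q a k s)"
      using q s by (intro block_sum_holomorphic(2)) auto
    then show "(\<lambda>N. \<Sum>k<N. block_term q a k s) \<longlonglongrightarrow> (\<Sum>k. block_term q a k s)" by (simp add: sums_def)
  qed
  ultimately show ?thesis by (rule LIMSEQ_unique[rotated])
qed

section \<open>Non-vanishing on the line Re s = 1\<close>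

text \<open>
Since \<open>\<psi>\<close> is completely multiplicative, twisting the identity \<open>\<mu> * 1 = \<delta>\<close> by it gives the inverse of \<open>L\<close>.
\<close>

lemma dseries_moebius_char:
  assumes \<psi>: "dirichlet_char q \<psi>" and s: "Re s > 1"
  shows "dseries (\<lambda>n. of_int (moebius_mu n) * \<psi> n) s * dseries \<psi> s = 1"
proof -
  let ?m = "\<lambda>n. of_int (moebius_mu n) * \<psi> n"
  have m: "norm (?m n) \<le> 1" for n
    using norm_dirichlet_char_le[OF \<psi>, of n] abs_moebius_mu_le[of n] by (simp add: norm_mult mult_le_one)
  have dm: "dsummable ?m" "dsummable \<psi>"
    using dsummable_bounded[of ?m, OF m] dsummable_bounded[of \<psi>, OF norm_dirichlet_char_le[OF \<psi>]] by auto
  have "dirichlet_prod ?m \<psi> = (\<lambda>n. if n = 1 then 1 else 0)"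
  proof
    fix n
    show "dirichlet_prod ?m \<psi> n = (if n = 1 then 1 else 0)"
    proof (cases "n = 0")
      case False
      have "dirichlet_prod ?m \<psi> n = (\<Sum>d | d dvd n. \<psi> n * of_int (moebius_mu d))"
        unfolding dirichlet_prod_def
      proof (rule sum.cong[OF refl])
        fix d assume "d \<in> {d. d dvd n}"
        then have "\<psi> d * \<psi> (n div d) = \<psi> n" by (simp add: dirichlet_char_mult[OF \<psi>, symmetric])
        then show "?m d * \<psi> (n div d) = \<psi> n * of_int (moebius_mu d)" by (simp add: mult_ac)
      qed
      also have "\<dots> = \<psi> n * of_int (\<Sum>d | d dvd n. moebius_mu d)" by (simp add: sum_distrib_left)
      also have "\<dots> = (if n = 1 then 1 else 0)"
        using False dirichlet_char_1[OF \<psi>] by (simp add: divisor_sum_moebius_mu)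
      finally show ?thesis .
    qed (simp add: dirichlet_prod_def)
  qed
  then have "dseries ?m s * dseries \<psi> s = dseries (\<lambda>n. if n = 1 then 1 else 0) s"
    using dseries_dirichlet_prod[OF dm s] by simp
  also have "\<dots> = (\<Sum>n. if n = 1 then 1 else 0)"
    unfolding dseries_def by (intro suminf_cong) auto
  also have "\<dots> = (1 :: complex)" by (simp add: sums_single[THEN sums_unique, symmetric])
  finally show ?thesis .
qed

lemma dseries_char_nonzero:
  assumes "dirichlet_char q \<psi>" "Re s > 1"
  shows "dseries \<psi> s \<noteq> 0"
  using dseries_moebius_char[OF assms] by auto

lemma cleared_series_char_eq:
  assumes \<psi>: "dirichlet_char q \<psi>" and s: "Re s > 1"
  shows "cleared_series q \<psi> s = (s - 1) * dseries \<psi> s"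
  by (rule cleared_series_eq[OF dirichlet_char_pos[OF \<psi>] _ s]) (rule dirichlet_char_add[OF \<psi>])

lemma cleared_series_char_nonzero:
  assumes \<psi>: "dirichlet_char q \<psi>" and s: "Re s > 1"
  shows "cleared_series q \<psi> s \<noteq> 0"
  using dseries_char_nonzero[OF assms] s by (auto simp: cleared_series_char_eq[OF assms])

lemma dsummable_mangoldt_char:
  assumes \<psi>: "dirichlet_char q \<psi>"
  shows "dsummable (\<lambda>n. mangoldt n * \<psi> n)"
proof (rule dsummable_mono)
  show "dsummable (\<lambda>n. - of_real (ln (real n)) * 1)" by (rule dsummable_ln) (rule dsummable_bounded[of _ 1], simp)
  show "norm (mangoldt n * \<psi> n) \<le> norm (- of_real (ln (real n)) * 1 :: complex)" for n
  proof (cases "n = 0")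
    case False
    have "norm (mangoldt n * \<psi> n) \<le> mangoldt n * 1"
      unfolding norm_mult norm_mangoldt by (intro mult_left_mono norm_dirichlet_char_le[OF \<psi>] mangoldt_nonneg)
    also have "\<dots> \<le> \<bar>ln (real n)\<bar>" using mangoldt_le[of n] False by simp
    finally show ?thesis by simp
  qed simp
qed

text \<open>
Twisting \<open>\<Lambda> * 1 = ln\<close> by \<open>\<psi>\<close> gives \<open>- L' / L\<close> as a Dirichlet series whose coefficients have the
non-negative factor \<open>\<Lambda>\<close>.
\<close>

lemma dseries_mangoldt_char:
  assumes \<psi>: "dirichlet_char q \<psi>" and s: "Re s > 1"
  shows "(dseries \<psi> has_field_derivative - (dseries (\<lambda>n. mangoldt n * \<psi> n) s * dseries \<psi> s)) (at s)"
proof -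
  let ?m = "\<lambda>n. mangoldt n * \<psi> n"
  have d: "dsummable \<psi>" by (rule dsummable_bounded[of _ 1, OF norm_dirichlet_char_le[OF \<psi>]])
  have pn: "dirichlet_prod ?m \<psi> n = of_real (ln (real n)) * \<psi> n" for n
  proof (cases "n = 0")
    case False
    have "dirichlet_prod ?m \<psi> n = (\<Sum>d | d dvd n. \<psi> n * mangoldt d)"
      unfolding dirichlet_prod_def
    proof (rule sum.cong[OF refl])
      fix d assume "d \<in> {d. d dvd n}"
      then have "\<psi> d * \<psi> (n div d) = \<psi> n" by (simp add: dirichlet_char_mult[OF \<psi>, symmetric])
      then show "?m d * \<psi> (n div d) = \<psi> n * mangoldt d" by (simp add: mult_ac)
    qed
    also have "\<dots> = \<psi> n * (\<Sum>d | d dvd n. mangoldt d)" by (simp add: sum_distrib_left)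
    finally show ?thesis using False by (simp add: mangoldt_sum)
  qed (simp add: dirichlet_prod_def)
  then have eq: "dseries ?m s * dseries \<psi> s = dseries (\<lambda>n. of_real (ln (real n)) * \<psi> n) s"
    using dseries_dirichlet_prod[OF dsummable_mangoldt_char[OF \<psi>] d s] unfolding ext[of "dirichlet_prod ?m \<psi>", OF pn] by simp
  have "dseries (\<lambda>n. - of_real (ln (real n)) * \<psi> n) s = - dseries (\<lambda>n. of_real (ln (real n)) * \<psi> n) s"
  proof -
    have "dsummable (\<lambda>n. of_real (ln (real n)) * \<psi> n)"
      by (rule dsummable_mono[OF dsummable_ln[OF d]]) simp
    from dseries_sums[OF this s] have "summable (\<lambda>n. of_real (ln (real n)) * \<psi> n * of_nat n powr (- s))" by (rule sums_summable)
    from suminf_minus[OF this] show ?thesis by (simp add: dseries_def)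
  qed
  then show ?thesis using has_field_derivative_dseries[OF d s] eq by simp
qed

text \<open>
If \<open>n\<close> is the order of the zero of \<open>H\<close> at \<open>z\<close>, then \<open>H\<close> is \<open>(w - z)^n\<close> times a function without
zero near \<open>z\<close>, and the logarithmic derivative of the latter stays bounded.
\<close>

lemma log_deriv_order:
  assumes H: "H holomorphic_on {s. Re s > 0}" and ne: "\<And>s. Re s > 1 \<Longrightarrow> H s \<noteq> 0" and z: "Re z = 1"
  obtains n :: nat where "((\<lambda>x. of_real x * (deriv H (z + of_real x) / H (z + of_real x))) \<longlongrightarrow> of_nat n) (at_right (0::real))"
    "n = 0 \<longleftrightarrow> H z \<noteq> 0" "n = 1 \<Longrightarrow> deriv H z \<noteq> 0"
proof -
  let ?S = "{s. Re s > 0}"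
  have S: "open ?S" "connected ?S" by (auto simp: open_halfspace_Re_gt convex_halfspace_Re_gt intro: convex_connected)
  obtain g r n where r: "0 < r" "ball z r \<subseteq> ?S" and g: "g holomorphic_on ball z r" "\<And>w. w \<in> ball z r \<Longrightarrow> H w = (w - z) ^ n * g w"
      "\<And>w. w \<in> ball z r \<Longrightarrow> g w \<noteq> 0" and n: "n = 0 \<longleftrightarrow> H z \<noteq> 0"
  proof (cases "H z = 0")
    case True
    have "\<not> H constant_on ?S"
    proof
      assume "H constant_on ?S"
      then have "H 2 = H z" using z by (auto simp: constant_on_def)
      then show False using True ne[of 2] by simp
    qed
    with holomorphic_factor_zero_nonconstant[OF H S _ True] z obtain g r n
      where "0 < n"  "0 < r"  "ball z r \<subseteq> ?S" "g holomorphic_on ball z r"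
            "\<And>w. w \<in> ball z r \<Longrightarrow> H w = (w - z)^n * g w" "\<And>w. w \<in> ball z r \<Longrightarrow> g w \<noteq> 0"
      by (metis (no_types, lifting) mem_Collect_eq zero_less_one)
    then show ?thesis using True by (intro that[of r g n]) auto
  next
    case False
    have zS: "z \<in> ?S" using z by simp
    have "continuous_on ?S H" using H by (rule holomorphic_on_imp_continuous_on)
    then obtain r1 where r1: "r1 > 0" "\<And>w. w \<in> ?S \<Longrightarrow> dist w z < r1 \<Longrightarrow> dist (H w) (H z) < norm (H z)"
      unfolding continuous_on_iff using False zS by (metis zero_less_norm_iff)
    obtain r2 where r2: "r2 > 0" "ball z r2 \<subseteq> ?S" using S(1) zS open_contains_ball by blast
    define r where "r = min r1 r2"
    have sub: "ball z r \<subseteq> ?S" using r2 by (auto simp: r_def)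
    have nz: "H w \<noteq> 0" if "w \<in> ball z r" for w
    proof
      assume "H w = 0"
      moreover have "dist (H w) (H z) < norm (H z)"
        using that subsetD[OF sub that] by (intro r1(2)) (auto simp: r_def dist_commute)
      ultimately show False by (simp add: dist_norm)
    qed
    show ?thesis
      by (rule that[of r H 0]) (use r1 r2 sub nz False in \<open>auto simp: r_def intro: holomorphic_on_subset[OF H]\<close>)
  qed
  have dg: "(g has_field_derivative deriv g w) (at w)" if "w \<in> ball z r" for w
    using g(1) that by (intro holomorphic_derivI[of _ "ball z r"]) auto
  have dH: "deriv H w = of_nat n * (w - z) ^ (n - 1) * g w + (w - z) ^ n * deriv g w" if w: "w \<in> ball z r" for w
  proof (rule DERIV_imp_deriv)
    have "((\<lambda>w. (w - z) ^ n * g w) has_field_derivative of_nat n * (w - z) ^ (n - 1) * g w + (w - z) ^ n * deriv g w) (at w)"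
      by (rule derivative_eq_intros dg[OF w] refl)+ (simp add: mult_ac)
    then show "(H has_field_derivative of_nat n * (w - z) ^ (n - 1) * g w + (w - z) ^ n * deriv g w) (at w)"
      by (rule has_field_derivative_transform_within_open[OF _ open_ball w]) (simp add: g(2))
  qed
  have zb: "z \<in> ball z r" using r by simp
  show ?thesis
  proof (rule that[OF _ n])
    have ev: "\<forall>\<^sub>F x in at_right (0::real). of_nat n + of_real x * (deriv g (z + of_real x) / g (z + of_real x)) =
         of_real x * (deriv H (z + of_real x) / H (z + of_real x))"
      using eventually_at_right_real[OF r(1)]
    proof eventually_elim
      case (elim x)
      let ?w = "z + of_real x"
      have w: "?w \<in> ball z r" using elim by (simp add: dist_norm)
      have x: "complex_of_real x \<noteq> 0" using elim by simp
      have "(of_real x :: complex) * (of_nat n * of_real x ^ (n - 1)) = of_nat n * of_real x ^ n" by (cases n) auto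
      then have "of_real x * deriv H ?w = of_real x ^ n * (of_nat n * g ?w + of_real x * deriv g ?w)"
        by (auto simp: dH[OF w] algebra_simps)
      then show ?case using x g(3)[OF w] by (simp add: g(2)[OF w] field_simps)
    qed
    have "isCont (\<lambda>w. deriv g w / g w) z"
    proof -
      have "(\<lambda>w. deriv g w / g w) holomorphic_on ball z r" using g by (intro holomorphic_intros) auto
      then show ?thesis using zb by (metis continuous_on_eq_continuous_at holomorphic_on_imp_continuous_on open_ball)
    qed
    moreover have "((\<lambda>x. z + of_real x) \<longlongrightarrow> z) (at_right (0::real))"
      by (rule tendsto_eq_intros refl | simp)+
    ultimately have "((\<lambda>x. deriv g (z + of_real x) / g (z + of_real x)) \<longlongrightarrow> deriv g z / g z) (at_right (0::real))"
      by (rule isCont_tendsto_compose)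
    then have "((\<lambda>x. of_nat n + of_real x * (deriv g (z + of_real x) / g (z + of_real x))) \<longlongrightarrow> of_nat n + of_real 0 * (deriv g z / g z)) (at_right (0::real))"
      by (intro tendsto_add tendsto_const tendsto_mult tendsto_of_real tendsto_ident_at)
    then show "((\<lambda>x. of_real x * (deriv H (z + of_real x) / H (z + of_real x))) \<longlongrightarrow> of_nat n) (at_right (0::real))"
      using ev by (simp add: tendsto_cong)
    show "deriv H z \<noteq> 0" if "n = 1" using that dH[OF zb] g(3)[OF zb] by simp
  qed
qed

text \<open>
Here \<open>n\<close> is the order of \<open>(s - 1) L(s, \<psi>)\<close> at \<open>1 + it\<close>; the factor \<open>s - 1\<close> accounts for the
correction at \<open>t = 0\<close>.
\<close>

lemma log_deriv_char_limit:
  assumes \<psi>: "dirichlet_char q \<psi>"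
  shows "\<exists>n :: nat. ((\<lambda>x. x * Re (dseries (\<lambda>n. mangoldt n * \<psi> n) (1 + of_real x + \<i> * of_real t))) \<longlongrightarrow> (if t = 0 then 1 else 0) - real n) (at_right 0) \<and>
    (n = 0 \<longleftrightarrow> cleared_series q \<psi> (1 + \<i> * of_real t) \<noteq> 0) \<and> (n = 1 \<longrightarrow> deriv (cleared_series q \<psi>) (1 + \<i> * of_real t) \<noteq> 0)"
proof -
  let ?K = "cleared_series q \<psi>" and ?z = "1 + \<i> * of_real t" and ?D = "dseries (\<lambda>n. mangoldt n * \<psi> n)"
  obtain n :: nat where n: "((\<lambda>x. of_real x * (deriv ?K (?z + of_real x) / ?K (?z + of_real x))) \<longlongrightarrow> of_nat n) (at_right (0::real))"
    "n = 0 \<longleftrightarrow> ?K ?z \<noteq> 0" "n = 1 \<Longrightarrow> deriv ?K ?z \<noteq> 0"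
  proof (rule log_deriv_order[of ?K ?z])
    show "?K holomorphic_on {s. Re s > 0}" by (rule cleared_series_holomorphic[OF dirichlet_char_pos[OF \<psi>]])
    show "Re s > 1 \<Longrightarrow> ?K s \<noteq> 0" for s by (rule cleared_series_char_nonzero[OF \<psi>])
  qed auto
  have ld: "deriv ?K s / ?K s = 1 / (s - 1) - ?D s" if s: "Re s > 1" for s
  proof -
    have "((\<lambda>s. (s - 1) * dseries \<psi> s) has_field_derivative dseries \<psi> s + (s - 1) * - (?D s * dseries \<psi> s)) (at s)"
      by (rule derivative_eq_intros dseries_mangoldt_char[OF \<psi> s] refl)+ simp
    then have "(?K has_field_derivative dseries \<psi> s + (s - 1) * - (?D s * dseries \<psi> s)) (at s)"
      by (rule has_field_derivative_transform_within_open[of _ _ _ "{s. Re s > 1}"])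
         (use s in \<open>auto simp: cleared_series_char_eq[OF \<psi>] open_halfspace_Re_gt\<close>)
    then have "deriv ?K s = dseries \<psi> s + (s - 1) * - (?D s * dseries \<psi> s)" by (rule DERIV_imp_deriv)
    moreover have "s - 1 \<noteq> 0" using s by auto
    ultimately show ?thesis unfolding cleared_series_char_eq[OF \<psi> s] using dseries_char_nonzero[OF \<psi> s]
      by (simp add: divide_simps) (simp add: algebra_simps)
  qed
  have l1: "((\<lambda>x. of_real x * (1 / (of_real x + \<i> * of_real t))) \<longlongrightarrow> of_real (if t = 0 then 1 else 0)) (at_right (0::real))"
  proof (cases "t = 0")
    case True
    have "\<forall>\<^sub>F x in at_right (0::real). 1 = of_real x * (1 / (of_real x + \<i> * of_real t))"
      using eventually_at_right_less[of 0] by eventually_elim (use True in auto)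
    then have "((\<lambda>x. of_real x * (1 / (of_real x + \<i> * of_real t))) \<longlongrightarrow> 1) (at_right (0::real))"
      by (rule Lim_transform_eventually[OF tendsto_const])
    then show ?thesis using True by simp
  next
    case False
    have "((\<lambda>x. of_real x * (1 / (of_real x + \<i> * of_real t))) \<longlongrightarrow> of_real 0 * (1 / (of_real 0 + \<i> * of_real t))) (at_right (0::real))"
      using False by (intro tendsto_intros) auto
    then show ?thesis using False by simp
  qed
  have "((\<lambda>x. of_real x * (1 / (of_real x + \<i> * of_real t)) - of_real x * (deriv ?K (?z + of_real x) / ?K (?z + of_real x)))
      \<longlongrightarrow> of_real (if t = 0 then 1 else 0) - of_nat n) (at_right (0::real))"
    by (intro tendsto_diff l1 n(1))
  moreover have "\<forall>\<^sub>F x in at_right (0::real). of_real x * (1 / (of_real x + \<i> * of_real t)) - of_real x * (deriv ?K (?z + of_real x) / ?K (?z + of_real x))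
       = of_real x * ?D (1 + of_real x + \<i> * of_real t)"
    using eventually_at_right_less[of 0]
  proof eventually_elim
    case (elim x)
    have w: "?z + of_real x = 1 + of_real x + \<i> * of_real t" "1 + of_real x + \<i> * of_real t - 1 = of_real x + \<i> * of_real t"
      by simp_all
    have "deriv ?K (?z + of_real x) / ?K (?z + of_real x) = 1 / (?z + of_real x - 1) - ?D (?z + of_real x)"
      by (rule ld) (use elim in simp)
    then have "deriv ?K (?z + of_real x) / ?K (?z + of_real x) = 1 / (of_real x + \<i> * of_real t) - ?D (1 + of_real x + \<i> * of_real t)"
      by (simp only: w)
    then show ?case by (simp only: right_diff_distrib diff_diff_eq2) simp
  qed
  ultimately have "((\<lambda>x. of_real x * ?D (1 + of_real x + \<i> * of_real t)) \<longlongrightarrow> of_real (if t = 0 then 1 else 0) - of_nat n) (at_right (0::real))"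
    by (rule Lim_transform_eventually)
  from tendsto_Re[OF this] show ?thesis using n by (intro exI[of _ n]) auto
qed

text \<open>
For \<open>w = \<psi>(n) n\<^sup>-\<^sup>i\<^sup>t\<close> of modulus 1, \<open>3 + 4 Re w + Re w\<^sup>2 = 2 (1 + Re w)\<^sup>2 \<ge> 0\<close>. The function
\<open>\<lambda>n. norm (\<psi> n)\<close> is the principal character modulo \<open>q\<close>.
\<close>

lemma three_four_one:
  assumes \<psi>: "dirichlet_char q \<psi>" and x: "x > 0"
  shows "0 \<le> 3 * Re (dseries (\<lambda>n. mangoldt n * of_real (norm (\<psi> n))) (1 + of_real x + \<i> * of_real 0))
    + 4 * Re (dseries (\<lambda>n. mangoldt n * \<psi> n) (1 + of_real x + \<i> * of_real t))
    + Re (dseries (\<lambda>n. mangoldt n * (\<psi> n)\<^sup>2) (1 + of_real x + \<i> * of_real (2 * t)))"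
proof -
  have D: "(\<lambda>n. Re (mangoldt n * \<phi> n * of_nat n powr (- (1 + of_real x + \<i> * of_real u)))) sums
       Re (dseries (\<lambda>n. mangoldt n * \<phi> n) (1 + of_real x + \<i> * of_real u))" if "dirichlet_char q \<phi>" for \<phi> u
    by (intro sums_Re dseries_sums dsummable_mangoldt_char[OF that]) (use x in auto)
  let ?t = "\<lambda>\<phi> u n. Re (mangoldt n * \<phi> n * of_nat n powr (- (1 + of_real x + \<i> * complex_of_real u)))"
  have nonneg: "0 \<le> 3 * ?t (\<lambda>n. of_real (norm (\<psi> n))) 0 n + 4 * ?t \<psi> t n + ?t (\<lambda>n. (\<psi> n)\<^sup>2) (2 * t) n" for n
  proof (cases "n = 0")
    case False
    define e where "e = complex_of_nat n powr (- (\<i> * of_real t))"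
    define w where "w = \<psi> n * e"
    have ne: "norm e = 1"
    proof -
      have "norm (complex_of_real (real n) powr (- (\<i> * of_real t))) = real n powr Re (- (\<i> * of_real t))"
        using False by (subst norm_powr_real_powr) auto
      then show ?thesis using False by (simp add: e_def)
    qed
    have nw: "norm w = norm (\<psi> n)" "norm w = 0 \<or> norm w = 1"
      using ne norm_dirichlet_char[OF \<psi>, of n] by (auto simp: w_def norm_mult)
    define m where "m = mangoldt n * real n powr (- (1 + x))"
    have m: "m \<ge> 0" by (simp add: m_def mangoldt_nonneg)
    have p: "of_nat n powr (- (1 + of_real x + \<i> * of_real u)) = of_real (real n powr (- (1 + x))) * of_nat n powr (- (\<i> * complex_of_real u))" for u
    proof -
      have "- (1 + of_real x + \<i> * of_real u) = of_real (- (1 + x)) + - (\<i> * complex_of_real u)" by simp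
      then have "of_nat n powr (- (1 + of_real x + \<i> * of_real u)) = of_nat n powr (of_real (- (1 + x))) * of_nat n powr (- (\<i> * complex_of_real u))"
        by (simp only: powr_add)
      also have "complex_of_nat n powr (of_real (- (1 + x))) = of_real (real n powr (- (1 + x)))"
        by (metis of_nat_0_le_iff of_real_of_nat_eq powr_of_real)
      finally show ?thesis .
    qed
    have mm: "(mangoldt n :: complex) * c * (of_real (real n powr (- (1 + x))) * d) = of_real m * (c * d)" for c d
      by (simp add: m_def mult_ac)
    have e2: "complex_of_nat n powr (- (\<i> * of_real (2 * t))) = e\<^sup>2"
      using False by (simp add: e_def powr_def exp_double[symmetric] mult_ac)
    have "?t (\<lambda>n. of_real (norm (\<psi> n))) 0 n = m * norm w" "?t \<psi> t n = m * Re w" "?t (\<lambda>n. (\<psi> n)\<^sup>2) (2 * t) n = m * Re (w\<^sup>2)"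
      unfolding p mm nw(1) e_def[symmetric] e2 using False by (simp_all add: w_def power_mult_distrib)
    moreover have "3 * norm w + 4 * Re w + Re (w\<^sup>2) \<ge> 0"
      using nw(2)
    proof
      assume "norm w = 1"
      then have "(Re w)\<^sup>2 + (Im w)\<^sup>2 = 1" by (metis cmod_power2 one_power2)
      then have "3 * norm w + 4 * Re w + Re (w\<^sup>2) = 2 * (1 + Re w)\<^sup>2"
        using \<open>norm w = 1\<close> by (simp add: power2_eq_square algebra_simps)
      then show ?thesis by simp
    qed auto
    ultimately have "3 * ?t (\<lambda>n. of_real (norm (\<psi> n))) 0 n + 4 * ?t \<psi> t n + ?t (\<lambda>n. (\<psi> n)\<^sup>2) (2 * t) n = m * (3 * norm w + 4 * Re w + Re (w\<^sup>2))"
      by (simp only: distrib_left mult_ac)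
    then show ?thesis using m \<open>3 * norm w + 4 * Re w + Re (w\<^sup>2) \<ge> 0\<close> by simp
  qed simp
  have "(\<lambda>n. 3 * ?t (\<lambda>n. of_real (norm (\<psi> n))) 0 n + 4 * ?t \<psi> t n + ?t (\<lambda>n. (\<psi> n)\<^sup>2) (2 * t) n) sums
     (3 * Re (dseries (\<lambda>n. mangoldt n * of_real (norm (\<psi> n))) (1 + of_real x + \<i> * of_real 0))
    + 4 * Re (dseries (\<lambda>n. mangoldt n * \<psi> n) (1 + of_real x + \<i> * of_real t))
    + Re (dseries (\<lambda>n. mangoldt n * (\<psi> n)\<^sup>2) (1 + of_real x + \<i> * of_real (2 * t))))"
    by (intro sums_add sums_mult D \<psi> dirichlet_char_norm dirichlet_char_square)
  then show ?thesis using nonneg by (rule sums_le[OF _ sums_zero, rotated])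
qed

text \<open>
A double zero of \<open>(s - 1) L(s, \<psi>)\<close> at 1 would cancel both factors \<open>s - 1\<close> in the denominator of
\<open>\<zeta>(s) L(s, \<psi>)\<close>. Then Landau's argument bounds the partial sums of the series at \<open>1/2\<close>, although
the squares alone contribute the harmonic series.
\<close>

lemma real_char_deriv_nonzero:
  assumes \<psi>: "dirichlet_char q \<psi>" and sq: "\<And>b. coprime b q \<Longrightarrow> (\<psi> b)\<^sup>2 = 1"
    and K: "cleared_series q \<psi> 1 = 0"
  shows "deriv (cleared_series q \<psi>) 1 \<noteq> 0"
proof
  assume K': "deriv (cleared_series q \<psi>) 1 = 0"
  let ?S = "{s. Re s > 0}" and ?K = "cleared_series q \<psi>" and ?Z = "cleared_series 1 (\<lambda>_. 1)"
  have op: "open ?S" by (simp add: open_halfspace_Re_gt)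
  have holK: "?K holomorphic_on ?S" by (rule cleared_series_holomorphic[OF dirichlet_char_pos[OF \<psi>]])
  define P where "P s = (if s = 1 then 0 else ?K s / (s - 1))" for s
  have P: "P holomorphic_on ?S"
    by (rule pole_theorem_open_0[OF holK op, of 1]) (auto simp: P_def K K')
  define J where "J s = (if s = 1 then deriv P 1 else P s / (s - 1))" for s
  have J: "J holomorphic_on ?S"
    by (rule pole_theorem_open_0[OF P op, of 1]) (auto simp: J_def P_def)
  \<comment> \<open>For \<open>Re s > 1\<close> this is \<open>\<zeta>(s) L(s, \<psi>)\<close>, where \<open>?Z s = (s - 1) \<zeta>(s)\<close>.\<close>
  define H where "H s = ?Z s * J s" for s
  have H: "H holomorphic_on ?S"
    unfolding H_def[abs_def] by (intro holomorphic_intros J cleared_series_holomorphic) simp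
  define r where "r n = (\<Sum>d | d dvd n. Re (\<psi> d))" for n
  have cases: "\<psi> n \<in> {-1, 0, 1}" for n
  proof (cases "coprime n q")
    case True
    then have "\<psi> n = 1 \<or> \<psi> n = - 1" using sq[OF True] by (simp add: power2_eq_1_iff)
    then show ?thesis by auto
  qed (use dirichlet_char_eq_0_iff[OF \<psi>, of n] in auto)
  have real: "\<psi> n = of_real (Re (\<psi> n))" for n
    using cases[of n] by auto
  have rr: "of_real (r n) = dirichlet_prod \<psi> (\<lambda>_. 1) n" for n
    using real by (simp add: r_def dirichlet_prod_def)
  have mult: "Re (\<psi> (a * b)) = Re (\<psi> a) * Re (\<psi> b)" for a b
    using cases[of a] cases[of b] by (auto simp: dirichlet_char_mult[OF \<psi>])
  have re: "Re (\<psi> n) \<in> {-1, 0, 1}" for n using cases[of n] by auto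
  have r0: "r n \<ge> 0" for n
  proof (cases "n = 0")
    case False
    then show ?thesis unfolding r_def
      by (intro divisor_sum_pm1_nonneg(1) mult re) (auto simp: dirichlet_char_1[OF \<psi>, unfolded One_nat_def])
  qed (simp add: r_def)
  have r1: "r (n\<^sup>2) \<ge> 1" if "n > 0" for n
    unfolding r_def using that
    by (intro divisor_sum_pm1_nonneg(2) mult re) (auto simp: dirichlet_char_1[OF \<psi>, unfolded One_nat_def])
  have d1: "dsummable \<psi>" "dsummable (\<lambda>_. 1)"
    by (rule dsummable_bounded[of _ 1], simp add: norm_dirichlet_char_le[OF \<psi>])+
  have dr: "dsummable (\<lambda>n. of_real (r n))"
    unfolding rr by (rule dsummable_dirichlet_prod[OF d1])
  have Hs: "H s = dseries (\<lambda>n. of_real (r n)) s" if s: "Re s > 1" for s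
  proof -
    have s1: "s \<noteq> 1" using s by auto
    have "dseries (\<lambda>n. of_real (r n)) s = dseries \<psi> s * dseries (\<lambda>_. 1) s"
      unfolding rr by (rule dseries_dirichlet_prod[OF d1 s])
    also have "dseries \<psi> s = ?K s / (s - 1)" using cleared_series_char_eq[OF \<psi> s] s1 by simp
    also have "dseries (\<lambda>_. 1) s = ?Z s / (s - 1)" using cleared_series_char_eq[OF dirichlet_char_trivial s] s1 by simp
    finally show ?thesis using s1 by (simp add: H_def J_def P_def)
  qed
  have bound: "(\<Sum>n<N. r n * real n powr (- (1/2))) \<le> Re (H (of_real (1/2)))" for N
    by (rule landau_partial_sum_le[OF dr r0 H Hs]) auto
  have "summable (\<lambda>n. inverse (real n))"
  proof (rule summableI_nonneg_bounded)
    fix N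
    have "(\<Sum>n<N. inverse (real n)) = (\<Sum>n\<in>{1..<N}. inverse (real n))"
      by (rule sum.mono_neutral_right) auto
    also have "\<dots> \<le> (\<Sum>n\<in>{1..<N}. r (n\<^sup>2) * real (n\<^sup>2) powr (- (1/2)))"
    proof (rule sum_mono)
      fix n assume n: "n \<in> {1..<N}"
      have "real (n\<^sup>2) powr (- (1/2)) = inverse (real n)"
        using n by (simp add: powr_minus powr_half_sqrt)
      then show "inverse (real n) \<le> r (n\<^sup>2) * real (n\<^sup>2) powr (- (1/2))"
        using r1[of n] n mult_right_mono[of 1 "r (n\<^sup>2)" "inverse (real n)"] by simp
    qed
    also have "\<dots> = (\<Sum>n\<in>(\<lambda>n. n\<^sup>2) ` {1..<N}. r n * real n powr (- (1/2)))"
      by (subst sum.reindex) (auto simp: inj_on_def)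
    also have "\<dots> \<le> (\<Sum>n<N\<^sup>2. r n * real n powr (- (1/2)))"
      using r0 by (intro sum_mono2) (auto intro!: power_strict_mono)
    also have "\<dots> \<le> Re (H (of_real (1/2)))" by (rule bound)
    finally show "(\<Sum>n<N. inverse (real n)) \<le> Re (H (of_real (1/2)))" .
  qed simp
  then show False using not_summable_harmonic[where 'a = real] by simp
qed

lemma sum_residues_1: "(\<Sum>a=1..q. f a) = (\<Sum>a<q. f a)" if "\<And>n. f (n + q) = f n" for f :: "nat \<Rightarrow> complex"
proof (cases "q = 0")
  case False
  have "{1..q} = insert q {1..<q}" "{..<q} = insert 0 {1..<q}" using False by auto
  then show ?thesis using that[of 0] by simp
qed simp

lemma cleared_series_char_at_1_eq_0:
  assumes \<psi>: "dirichlet_char q \<psi>" and b: "coprime b q" "\<psi> b \<noteq> 1"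
  shows "cleared_series q \<psi> 1 = 0"
  unfolding cleared_series_at_1 sum_residues_1[of \<psi> q, OF dirichlet_char_add[OF \<psi>]] dirichlet_char_sum_eq_0[OF assms] by simp

text \<open>
Let \<open>n1\<close> and \<open>n2\<close> be the orders of \<open>(s - 1) L(s, \<psi>)\<close> at \<open>1 + it\<close> and of \<open>(s - 1) L(s, \<psi>\<^sup>2)\<close> at
\<open>1 + 2it\<close>. The limit of the inequality \<open>three_four_one\<close> gives \<open>4 n1 + n2 \<le> 3\<close> for \<open>t \<noteq> 0\<close>, so
\<open>n1 = 0\<close>. For \<open>t = 0\<close> it gives \<open>4 n1 + n2 \<le> 8\<close>; if \<open>\<psi>\<^sup>2\<close> is not principal, then \<open>n2 \<ge> 1\<close> and so
\<open>n1 \<le> 1\<close>, and otherwise \<open>\<psi>\<close> is real.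
\<close>

lemma cleared_series_char_line:
  assumes \<psi>: "dirichlet_char q \<psi>"
  shows "t \<noteq> 0 \<Longrightarrow> cleared_series q \<psi> (1 + \<i> * of_real t) \<noteq> 0"
    and "cleared_series q \<psi> 1 = 0 \<Longrightarrow> deriv (cleared_series q \<psi>) 1 \<noteq> 0"
proof -
  have ineq: "\<exists>n1 n2 :: nat. 0 \<le> 3 + 4 * ((if t = 0 then 1 else 0) - real n1) + ((if t = 0 then 1 else 0) - real n2) \<and>
     (n1 = 0 \<longleftrightarrow> cleared_series q \<psi> (1 + \<i> * of_real t) \<noteq> 0) \<and> (n1 = 1 \<longrightarrow> deriv (cleared_series q \<psi>) (1 + \<i> * of_real t) \<noteq> 0) \<and>
     (n2 = 0 \<longleftrightarrow> cleared_series q (\<lambda>n. (\<psi> n)\<^sup>2) (1 + \<i> * of_real (2 * t)) \<noteq> 0)" for t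
  proof -
    let ?D0 = "\<lambda>x. Re (dseries (\<lambda>n. mangoldt n * of_real (norm (\<psi> n))) (1 + of_real x + \<i> * of_real 0))"
    let ?D1 = "\<lambda>x. Re (dseries (\<lambda>n. mangoldt n * \<psi> n) (1 + of_real x + \<i> * of_real t))"
    let ?D2 = "\<lambda>x. Re (dseries (\<lambda>n. mangoldt n * (\<psi> n)\<^sup>2) (1 + of_real x + \<i> * of_real (2 * t)))"
    let ?pole = "\<lambda>u :: real. if u = 0 then 1 else (0 :: real)"
    obtain n0 :: nat where n0: "((\<lambda>x. x * ?D0 x) \<longlongrightarrow> ?pole 0 - real n0) (at_right 0)"
      using log_deriv_char_limit[OF dirichlet_char_norm[OF \<psi>], of 0] by blast
    obtain n1 :: nat where n1: "((\<lambda>x. x * ?D1 x) \<longlongrightarrow> ?pole t - real n1) (at_right 0)"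
      "n1 = 0 \<longleftrightarrow> cleared_series q \<psi> (1 + \<i> * of_real t) \<noteq> 0" "n1 = 1 \<longrightarrow> deriv (cleared_series q \<psi>) (1 + \<i> * of_real t) \<noteq> 0"
      using log_deriv_char_limit[OF \<psi>, of t] by blast
    obtain n2 :: nat where n2: "((\<lambda>x. x * ?D2 x) \<longlongrightarrow> ?pole (2 * t) - real n2) (at_right 0)"
      "n2 = 0 \<longleftrightarrow> cleared_series q (\<lambda>n. (\<psi> n)\<^sup>2) (1 + \<i> * of_real (2 * t)) \<noteq> 0"
      using log_deriv_char_limit[OF dirichlet_char_square[OF \<psi>], of "2 * t"] by blast
    have "0 \<le> 3 * (?pole 0 - real n0) + 4 * (?pole t - real n1) + (?pole (2 * t) - real n2)"
    proof (rule tendsto_lowerbound)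
      show "((\<lambda>x. 3 * (x * ?D0 x)
         + 4 * (x * ?D1 x)
         + x * ?D2 x) \<longlongrightarrow>
         3 * (?pole 0 - real n0) + 4 * (?pole t - real n1) + (?pole (2 * t) - real n2)) (at_right 0)"
        by (intro tendsto_add tendsto_mult tendsto_const n0 n1(1) n2(1))
      show "\<forall>\<^sub>F x in at_right 0. 0 \<le> 3 * (x * ?D0 x)
         + 4 * (x * ?D1 x)
         + x * ?D2 x"
        using eventually_at_right_less[of 0]
      proof eventually_elim
        case (elim x)
        from mult_nonneg_nonneg[OF less_imp_le[OF elim] three_four_one[OF \<psi> elim, of t]]
        show ?case by (simp only: distrib_left mult_ac)
      qed
    qed simp
    then have "0 \<le> 3 + 4 * (?pole t - real n1) + (?pole t - real n2)" by auto
    then show ?thesis using n1 n2 by blast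
  qed
  show "cleared_series q \<psi> (1 + \<i> * of_real t) \<noteq> 0" if t: "t \<noteq> 0"
  proof -
    obtain n1 n2 :: nat where n: "0 \<le> 3 + 4 * (0 - real n1) + (0 - real n2)" "n1 = 0 \<longleftrightarrow> cleared_series q \<psi> (1 + \<i> * of_real t) \<noteq> 0"
      using ineq[of t] t by auto
    then have "4 * real n1 \<le> 3" by simp
    then have "n1 = 0" by simp
    then show ?thesis using n by simp
  qed
  show "deriv (cleared_series q \<psi>) 1 \<noteq> 0" if K: "cleared_series q \<psi> 1 = 0"
  proof (cases "\<forall>b. coprime b q \<longrightarrow> (\<psi> b)\<^sup>2 = 1")
    case True
    then show ?thesis using real_char_deriv_nonzero[OF \<psi> _ K] by blast
  next
    case False
    then have "cleared_series q (\<lambda>n. (\<psi> n)\<^sup>2) 1 = 0"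
      using cleared_series_char_at_1_eq_0[OF dirichlet_char_square[OF \<psi>]] by blast
    then obtain n1 n2 :: nat where n: "0 \<le> 3 + 4 * (1 - real n1) + (1 - real n2)" "n1 \<noteq> 0" "n2 \<noteq> 0"
      "n1 = 1 \<longrightarrow> deriv (cleared_series q \<psi>) 1 \<noteq> 0"
      using ineq[of 0] K by auto
    have "4 * real n1 + real n2 \<le> 8" using n(1) by (simp add: algebra_simps)
    then have "real (4 * n1 + n2) \<le> real 8" by simp
    then have "4 * n1 + n2 \<le> 8" by (simp only: of_nat_le_iff)
    then have "n1 = 1" using n(2,3) by linarith
    then show ?thesis using n by simp
  qed
qed

lemma moebius_char_continuation:
  assumes \<psi>: "dirichlet_char q \<psi>"
  obtains G where "continuous_on {s. Re s \<ge> 1} G"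
    "\<And>s. Re s > 1 \<Longrightarrow> G s = dseries (\<lambda>n. of_int (moebius_mu n) * \<psi> n) s"
proof -
  let ?S = "{s. Re s > 0}" and ?K = "cleared_series q \<psi>"
  have op: "open ?S" by (simp add: open_halfspace_Re_gt)
  have holK: "?K holomorphic_on ?S" by (rule cleared_series_holomorphic[OF dirichlet_char_pos[OF \<psi>]])
  have M: "dseries (\<lambda>n. of_int (moebius_mu n) * \<psi> n) s = (s - 1) / ?K s" if "Re s > 1" for s
  proof -
    have "s - 1 \<noteq> 0" using that by auto
    then show ?thesis unfolding cleared_series_char_eq[OF \<psi> that]
      using dseries_moebius_char[OF \<psi> that] dseries_char_nonzero[OF \<psi> that] by (simp add: eq_divide_eq)
  qed
  have nz: "?K s \<noteq> 0" if s: "Re s \<ge> 1" "s \<noteq> 1" for s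
  proof (cases "Re s = 1")
    case True
    then have "s = 1 + \<i> * of_real (Im s)" by (simp add: complex_eq_iff)
    moreover have "Im s \<noteq> 0" using True s by (auto simp: complex_eq_iff)
    ultimately show ?thesis using cleared_series_char_line(1)[OF \<psi>, of "Im s"] by metis
  qed (use cleared_series_char_nonzero[OF \<psi>] s in auto)
  show ?thesis
  proof (cases "?K 1 = 0")
    case False
    have "continuous_on {s. Re s \<ge> 1} (\<lambda>s. (s - 1) / ?K s)"
    proof (intro continuous_intros)
      show "continuous_on {s. Re s \<ge> 1} ?K"
        by (rule continuous_on_subset[OF holomorphic_on_imp_continuous_on[OF holK]]) auto
      show "\<forall>s\<in>{s. Re s \<ge> 1}. ?K s \<noteq> 0" using nz False by auto
    qed
    then show ?thesis using M by (intro that) auto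
  next
    case True
    define P where "P s = (if s = 1 then deriv ?K 1 else ?K s / (s - 1))" for s
    have P: "P holomorphic_on ?S"
      by (rule pole_theorem_open_0[OF holK op, of 1]) (auto simp: P_def True)
    have "continuous_on {s. Re s \<ge> 1} (\<lambda>s. 1 / P s)"
    proof (intro continuous_intros)
      show "continuous_on {s. Re s \<ge> 1} P"
        by (rule continuous_on_subset[OF holomorphic_on_imp_continuous_on[OF P]]) auto
      show "\<forall>s\<in>{s. Re s \<ge> 1}. P s \<noteq> 0" using nz cleared_series_char_line(2)[OF \<psi> True] by (auto simp: P_def)
    qed
    then show ?thesis using M by (intro that[of "\<lambda>s. 1 / P s"]) (auto simp: P_def)
  qed
qed

section \<open>The Fejer kernel and the Riemann-Lebesgue lemma\<close>

text \<open>
The weight whose Fourier transform is the Fejer kernel.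
\<close>

definition triangle :: "real \<Rightarrow> real \<Rightarrow> real" where
  "triangle T t = max 0 (1 - \<bar>t\<bar> / T)"

text \<open>
The value at 0 is the continuous extension.
\<close>

definition fejer :: "real \<Rightarrow> real \<Rightarrow> real" where
  "fejer T v = (if v = 0 then T else 2 * (1 - cos (T * v)) / (T * v\<^sup>2))"

lemma continuous_triangle [continuous_intros]: "T > 0 \<Longrightarrow> continuous_on A (triangle T)"
  unfolding triangle_def[abs_def] by (intro continuous_intros) auto

lemma triangle_measurable [measurable]: "triangle T \<in> borel_measurable borel"
  unfolding triangle_def[abs_def] by measurable

lemma triangle_eq_0: "T > 0 \<Longrightarrow> t \<notin> {-T..T} \<Longrightarrow> triangle T t = 0"
  by (auto simp: triangle_def max_def field_simps abs_if split: if_splits)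

lemma triangle_bounds: "0 \<le> triangle T t" "T > 0 \<Longrightarrow> triangle T t \<le> 1"
  by (auto simp: triangle_def max_def field_simps)

lemma fejer_nonneg: "T > 0 \<Longrightarrow> fejer T v \<ge> 0"
  by (auto simp: fejer_def)

lemma fejer_measurable [measurable]: "fejer T \<in> borel_measurable borel"
  unfolding fejer_def[abs_def] by measurable

text \<open>
An integrable majorant that combines the bound \<open>T\<close> near 0 with the decay \<open>4 / (T * v\<^sup>2)\<close>.
\<close>

lemma fejer_le:
  assumes T: "T > 0"
  shows "fejer T v \<le> (T + 4 / T) * inverse (1 + v\<^sup>2)"
proof (cases "v = 0")
  case False
  have "\<bar>sin (T * v / 2)\<bar> \<le> \<bar>T * v / 2\<bar>" by (rule abs_sin_x_le_abs_x)
  then have "(sin (T * v / 2))\<^sup>2 \<le> (T * v / 2)\<^sup>2" by (simp only: abs_le_square_iff)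
  moreover have "cos (T * v) = 1 - 2 * (sin (T * v / 2))\<^sup>2"
    using cos_double_sin[of "T * v / 2"] by simp
  ultimately have 1: "2 * (1 - cos (T * v)) \<le> T\<^sup>2 * v\<^sup>2" by (simp add: power_mult_distrib power_divide)
  have "2 * (1 - c) \<le> 4" if "-1 \<le> c" for c :: real using that by simp
  then have 2: "2 * (1 - cos (T * v)) \<le> 4" using cos_ge_minus_one by blast
  have "fejer T v * (1 + v\<^sup>2) = 2 * (1 - cos (T * v)) / (T * v\<^sup>2) + 2 * (1 - cos (T * v)) / T"
    using False T by (simp add: fejer_def field_simps)
  also have "\<dots> \<le> (T\<^sup>2 * v\<^sup>2) / (T * v\<^sup>2) + 4 / T"
    using T False by (intro add_mono divide_right_mono 1 2) auto
  also have "\<dots> = T + 4 / T" using T False by (simp add: power2_eq_square)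
  finally have "fejer T v * (1 + v\<^sup>2) \<le> T + 4 / T" .
  moreover have "1 + v\<^sup>2 > 0" by (simp add: add_pos_nonneg)
  ultimately show ?thesis by (simp add: field_simps)
qed (use T in \<open>auto simp: fejer_def\<close>)

lemma integrable_fejer:
  assumes T: "T > 0"
  shows "integrable lborel (fejer T)"
proof (rule Bochner_Integration.integrable_bound)
  have "integrable lborel (\<lambda>x::real. inverse (1 + x\<^sup>2))"
    using integrable_inverse_1_plus_square by (simp add: set_integrable_def einterval_def)
  then show "integrable lborel (\<lambda>v. (T + 4 / T) * inverse (1 + v\<^sup>2))" by simp
  show "AE v in lborel. norm (fejer T v) \<le> norm ((T + 4 / T) * inverse (1 + v\<^sup>2))"
    using fejer_le[OF T] fejer_nonneg[OF T] by (intro AE_I2) (auto intro: order_trans[OF _ abs_ge_self])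
qed simp

lemma fejer_integral_pos: "(LBINT v. fejer 1 v) > 0"
proof -
  have "fejer 1 v \<ge> indicator {1..2} v * (1 - cos 1) / 2" for v :: real
  proof (cases "v \<in> {1..2}")
    case True
    have "cos v \<le> cos 1" using True pi_gt3 by (intro cos_monotone_0_pi_le) auto
    moreover have "v\<^sup>2 \<le> 4" using True power_mono[of v 2 2] by auto
    moreover have "cos 1 \<le> (1::real)" by simp
    ultimately have "(1 - cos 1) * v\<^sup>2 \<le> (1 - cos v) * 4"
      by (intro mult_mono) auto
    then show ?thesis using True by (auto simp: fejer_def field_simps)
  qed (use fejer_nonneg[of 1 v] in auto)
  then have "(LBINT v. indicator {1..2::real} v * (1 - cos 1) / 2) \<le> (LBINT v. fejer 1 v)"
    by (intro integral_mono integrable_fejer) auto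
  moreover have "cos (1::real) < 1" using cos_monotone_0_pi[of 0 1] pi_gt3 by auto
  ultimately show ?thesis by simp
qed

lemma fejer_fourier:
  assumes T: "T > 0"
  shows "(LBINT t. complex_of_real (triangle T t) * exp (\<i> * of_real v * of_real t)) = of_real (fejer T v)"
proof -
  let ?f = "\<lambda>t. complex_of_real (triangle T t) * exp (\<i> * of_real v * of_real t)"
  have cont: "continuous_on UNIV ?f" by (intro continuous_intros T)
  have hi: "(?f has_integral of_real (fejer T v)) {-T..T}"
  proof (cases "v = 0")
    case True
    have d: "((\<lambda>t. complex_of_real (t - t\<^sup>2 / (2 * T))) has_vector_derivative complex_of_real (1 - t / T)) (at t within S)"
      and d': "((\<lambda>t. complex_of_real (t + t\<^sup>2 / (2 * T))) has_vector_derivative complex_of_real (1 + t / T)) (at t within S)" for t S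
    proof -
      have "((\<lambda>t. t - t\<^sup>2 / (2 * T)) has_real_derivative 1 - t / T) (at t within S)"
           "((\<lambda>t. t + t\<^sup>2 / (2 * T)) has_real_derivative 1 + t / T) (at t within S)"
        using T by (auto intro!: derivative_eq_intros simp: field_simps)
      note d = this[THEN has_vector_derivative_of_real]
      show "((\<lambda>t. complex_of_real (t - t\<^sup>2 / (2 * T))) has_vector_derivative complex_of_real (1 - t / T)) (at t within S)"
        by (fact d(1))
      show "((\<lambda>t. complex_of_real (t + t\<^sup>2 / (2 * T))) has_vector_derivative complex_of_real (1 + t / T)) (at t within S)"
        by (fact d(2))
    qed
    have 1: "((\<lambda>t. complex_of_real (1 - t / T)) has_integral (of_real (T - T\<^sup>2 / (2 * T)) - of_real (0 - 0\<^sup>2 / (2 * T)))) {0..T}"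
      by (rule fundamental_theorem_of_calculus) (use T d in auto)
    have 2: "((\<lambda>t. complex_of_real (1 + t / T)) has_integral (of_real (0 + 0\<^sup>2 / (2 * T)) - of_real (-T + (-T)\<^sup>2 / (2 * T)))) {-T..0}"
      by (rule fundamental_theorem_of_calculus) (use T d' in auto)
    have 1: "(?f has_integral (of_real (T - T\<^sup>2 / (2 * T)) - of_real (0 - 0\<^sup>2 / (2 * T)))) {0..T}"
      by (rule has_integral_eq[OF _ 1]) (use T True in \<open>auto simp: triangle_def max_def field_simps\<close>)
    have 2: "(?f has_integral (of_real (0 + 0\<^sup>2 / (2 * T)) - of_real (-T + (-T)\<^sup>2 / (2 * T)))) {-T..0}"
      by (rule has_integral_eq[OF _ 2]) (use T True in \<open>auto simp: triangle_def max_def field_simps\<close>)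
    show ?thesis using has_integral_combine[OF _ _ 2 1] T True
      by (simp add: fejer_def power2_eq_square)
  next
    case False
    define c where "c = \<i> * complex_of_real v"
    have c: "c \<noteq> 0" using False by (simp add: c_def)
    let ?T = "complex_of_real T"
    let ?F1 = "\<lambda>t::real. (1 - of_real t / ?T) * exp (c * of_real t) / c + exp (c * of_real t) / (?T * c\<^sup>2)"
    let ?F2 = "\<lambda>t::real. (1 + of_real t / ?T) * exp (c * of_real t) / c - exp (c * of_real t) / (?T * c\<^sup>2)"
    have 1: "((\<lambda>t. (1 - of_real t / ?T) * exp (c * of_real t)) has_integral (?F1 T - ?F1 0)) {0..T}"
    proof (rule fundamental_theorem_of_calculus)
      fix x
      have "((\<lambda>t. (1 - t / ?T) * exp (c * t) / c + exp (c * t) / (?T * c\<^sup>2)) has_field_derivative (1 - of_real x / ?T) * exp (c * of_real x)) (at (of_real x))"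
        by (rule derivative_eq_intros refl | use T c in \<open>simp; fail\<close>)+ (use T c in \<open>auto simp: field_simps power2_eq_square\<close>)
      then show "(?F1 has_vector_derivative (1 - of_real x / ?T) * exp (c * of_real x)) (at x within {0..T})"
        by (rule has_vector_derivative_real_field)
    qed (use T in auto)
    have 2: "((\<lambda>t. (1 + of_real t / ?T) * exp (c * of_real t)) has_integral (?F2 0 - ?F2 (-T))) {-T..0}"
    proof (rule fundamental_theorem_of_calculus)
      fix x
      have "((\<lambda>t. (1 + t / ?T) * exp (c * t) / c - exp (c * t) / (?T * c\<^sup>2)) has_field_derivative (1 + of_real x / ?T) * exp (c * of_real x)) (at (of_real x))"
        by (rule derivative_eq_intros refl | use T c in \<open>simp; fail\<close>)+ (use T c in \<open>auto simp: field_simps power2_eq_square\<close>)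
      then show "(?F2 has_vector_derivative (1 + of_real x / ?T) * exp (c * of_real x)) (at x within {-T..0})"
        by (rule has_vector_derivative_real_field)
    qed (use T in auto)
    have 1: "(?f has_integral (?F1 T - ?F1 0)) {0..T}"
      by (rule has_integral_eq[OF _ 1]) (use T in \<open>auto simp: triangle_def max_def field_simps c_def\<close>)
    have 2: "(?f has_integral (?F2 0 - ?F2 (-T))) {-T..0}"
      by (rule has_integral_eq[OF _ 2]) (use T in \<open>auto simp: triangle_def max_def field_simps c_def\<close>)
    have "(?f has_integral (?F2 0 - ?F2 (-T) + (?F1 T - ?F1 0))) {-T..T}"
      by (rule has_integral_combine[OF _ _ 2 1]) (use T in auto)
    also have "?F2 0 - ?F2 (-T) + (?F1 T - ?F1 0) = (exp (c * ?T) + exp (- (c * ?T)) - 2) / (?T * c\<^sup>2)"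
      using T c by (simp add: field_simps)
    also have "exp (c * ?T) + exp (- (c * ?T)) = of_real (2 * cos (T * v))"
      by (simp add: c_def exp_eq_polar complex_eq_iff Re_exp Im_exp mult.commute)
    also have "c\<^sup>2 = - of_real (v\<^sup>2)" by (simp add: c_def power_mult_distrib)
    also have "(of_real (2 * cos (T * v)) - 2) / (?T * - of_real (v\<^sup>2)) = of_real (fejer T v)"
      using False T by (simp add: fejer_def field_simps)
    finally show ?thesis .
  qed
  have "?f absolutely_integrable_on {-T..T}"
    by (intro absolutely_integrable_continuous_real continuous_on_subset[OF cont]) auto
  then have si: "set_integrable lborel {-T..T} ?f"
    by (simp add: set_integrable_def integrable_completion)
  have "(LBINT t:{-T..T}. ?f t) = integral {-T..T} ?f"
    by (rule set_borel_integral_eq_integral(2)[OF si])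
  also have "\<dots> = of_real (fejer T v)" using hi by (rule integral_unique)
  also have "(LBINT t:{-T..T}. ?f t) = (LBINT t. ?f t)"
    unfolding set_lebesgue_integral_def
    by (rule Bochner_Integration.integral_cong) (use triangle_eq_0[OF T] in \<open>auto simp: indicator_def\<close>)
  finally show ?thesis .
qed

text \<open>
Translating the variable by \<open>pi / y\<close> changes the sign of the exponential. So twice the integral equals
the integral against \<open>g t - g (t + pi / y)\<close>, which tends to 0 by dominated convergence.
\<close>

lemma riemann_lebesgue_compact_support:
  fixes g :: "real \<Rightarrow> complex"
  assumes cont: "continuous_on UNIV g" and T: "T > 0" and supp: "\<And>t. t \<notin> {-T..T} \<Longrightarrow> g t = 0"
  shows "((\<lambda>y. LBINT t. g t * exp (\<i> * of_real y * of_real t)) \<longlongrightarrow> 0) at_top"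
proof -
  let ?e = "\<lambda>y t. exp (\<i> * complex_of_real y * of_real t)"
  have [measurable]: "g \<in> borel_measurable borel" using cont by (rule borel_measurable_continuous_onI)
  obtain M where M: "\<And>t. norm (g t) \<le> M"
  proof -
    have "compact (g ` {-T..T})"
      by (intro compact_continuous_image continuous_on_subset[OF cont]) auto
    then obtain B where B: "\<forall>x\<in>g ` {-T..T}. norm x \<le> B" using compact_imp_bounded bounded_iff by blast
    have "norm (g t) \<le> max B 0" for t
      using B supp[of t] by (cases "t \<in> {-T..T}") (auto simp: le_max_iff_disj)
    then show ?thesis using that by blast
  qed
  have M0: "M \<ge> 0" using M[of 0] norm_ge_zero order_trans by blast
  have int: "integrable lborel (\<lambda>t. g (t + d) * ?e y t)" for y d
  proof (rule Bochner_Integration.integrable_bound)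
    show "integrable lborel (\<lambda>t. indicator {-T - d..T - d} t * M)"
      by (intro integrable_mult_left integrable_real_indicator) (auto simp: emeasure_lborel_Icc_eq)
    show "AE t in lborel. norm (g (t + d) * ?e y t) \<le> norm (indicator {-T - d..T - d} t * M)"
      using M M0 supp by (intro AE_I2) (auto simp: norm_mult indicator_def)
  qed simp
  let ?I = "\<lambda>y. LBINT t. g t * ?e y t"
  have "((\<lambda>y. LBINT t. (g t - g (t + pi / y)) * ?e y t) \<longlongrightarrow> (LBINT (t::real). 0)) at_top"
  proof (rule integral_dominated_convergence_at_top)
    show "integrable lborel (\<lambda>t. indicator {-T-1..T+1} t * (2 * M))"
      by (intro integrable_mult_left integrable_real_indicator) (auto simp: emeasure_lborel_Icc_eq)
    show "\<forall>\<^sub>F y in at_top. AE t in lborel. norm ((g t - g (t + pi / y)) * ?e y t) \<le> indicator {-T-1..T+1} t * (2 * M)"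
    proof (rule eventually_mono[OF eventually_ge_at_top[of pi]], rule AE_I2)
      fix y t :: real assume y: "pi \<le> y"
      have y0: "y > 0" using y pi_gt_zero by linarith
      have p: "0 \<le> pi / y" "pi / y \<le> 1" using y y0 by auto
      show "norm ((g t - g (t + pi / y)) * ?e y t) \<le> indicator {-T-1..T+1} t * (2 * M)"
      proof (cases "t \<in> {-T-1..T+1}")
        case True
        have "norm (g t - g (t + pi / y)) \<le> norm (g t) + norm (g (t + pi / y))" by (rule norm_triangle_ineq4)
        also have "\<dots> \<le> 2 * M" using M[of t] M[of "t + pi / y"] by linarith
        finally show ?thesis using True by (simp add: norm_mult)
      next
        case False
        then have "t \<notin> {-T..T}" "t + pi / y \<notin> {-T..T}" using p by auto
        then show ?thesis using supp False by simp
      qed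
    qed
    show "AE t in lborel. ((\<lambda>y. (g t - g (t + pi / y)) * ?e y t) \<longlongrightarrow> 0) at_top"
    proof (rule AE_I2)
      fix t :: real
      have "((\<lambda>y. t + pi / y) \<longlongrightarrow> t) at_top" by real_asymp
      moreover have "isCont g t" using cont by (simp add: continuous_on_eq_continuous_at)
      ultimately have "((\<lambda>y. g (t + pi / y)) \<longlongrightarrow> g t) at_top" by (rule isCont_tendsto_compose[rotated])
      then have "((\<lambda>y. norm (g t - g (t + pi / y))) \<longlongrightarrow> norm (g t - g t)) at_top"
        by (intro tendsto_intros)
      then show "((\<lambda>y. (g t - g (t + pi / y)) * ?e y t) \<longlongrightarrow> 0) at_top"
        by (intro tendsto_norm_zero_cancel[where f = "\<lambda>y. _ y * _ y"]) (simp add: norm_mult)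
    qed
  qed auto
  moreover have "\<forall>\<^sub>F y in at_top. (LBINT t. (g t - g (t + pi / y)) * ?e y t) = 2 * ?I y"
  proof (rule eventually_mono[OF eventually_gt_at_top[of 0]])
    fix y :: real assume y: "y > 0"
    have "?I y = (LBINT t. g (pi / y + 1 * t) * exp (\<i> * of_real y * of_real (pi / y + 1 * t)))"
      using lborel_integral_real_affine[of 1 "\<lambda>t. g t * ?e y t" "pi / y"] by simp
    also have "\<dots> = (LBINT t. - (g (t + pi / y) * ?e y t))"
    proof (rule Bochner_Integration.integral_cong)
      fix t
      have "y * (pi / y + 1 * t) = pi + y * t" using y by (simp add: field_simps)
      then have "of_real y * complex_of_real (pi / y + 1 * t) = of_real pi + of_real y * of_real t"
        by (metis of_real_add of_real_mult)
      then have "exp (\<i> * of_real y * of_real (pi / y + 1 * t)) = exp (\<i> * of_real pi + \<i> * of_real y * of_real t)"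
        by (simp only: mult.assoc distrib_left)
      also have "\<dots> = - ?e y t" by (simp add: exp_add)
      finally show "g (pi / y + 1 * t) * exp (\<i> * of_real y * of_real (pi / y + 1 * t)) = - (g (t + pi / y) * ?e y t)"
        by (simp add: add.commute)
    qed simp
    also have "\<dots> = - (LBINT t. g (t + pi / y) * ?e y t)" by simp
    finally have *: "(LBINT t. g (t + pi / y) * ?e y t) = - ?I y" by simp
    have "(LBINT t. (g t - g (t + pi / y)) * ?e y t) =
       (LBINT t. g t * ?e y t) - (LBINT t. g (t + pi / y) * ?e y t)"
      unfolding left_diff_distrib using int[of 0 y] by (intro Bochner_Integration.integral_diff int) simp
    then show "(LBINT t. (g t - g (t + pi / y)) * ?e y t) = 2 * ?I y"
      unfolding * by simp
  qed
  ultimately have "((\<lambda>y. 2 * ?I y) \<longlongrightarrow> 0) at_top" by (simp add: tendsto_cong)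
  then have "((\<lambda>y. (1/2) * (2 * ?I y)) \<longlongrightarrow> (1/2) * 0) at_top" by (rule tendsto_mult_left)
  then show ?thesis by simp
qed

section \<open>A Tauberian theorem\<close>

lemma has_bochner_integral_exp_Ici:
  fixes s :: complex and c :: real
  assumes s: "Re s > 0"
  shows "has_bochner_integral lborel (\<lambda>u. indicator {c..} u *\<^sub>R exp (- s * of_real u)) (exp (- s * of_real c) / s)"
proof -
  have r: "integrable lborel (\<lambda>u. indicator {c..} u *\<^sub>R exp (- Re s * u))"
  proof -
    have "(\<lambda>u. exp (- Re s * u)) absolutely_integrable_on {c..}"
      using has_integral_exp_minus_to_infinity[OF s, of c]
      by (intro nonnegative_absolutely_integrable_1) (auto simp: integrable_on_def)
    then show ?thesis
      by (simp add: set_integrable_def integrable_completion)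
  qed
  have i: "integrable lborel (\<lambda>u. indicator {c..} u *\<^sub>R exp (- s * of_real u))"
    by (rule Bochner_Integration.integrable_bound[OF r]) (auto simp: indicator_def)
  have si: "set_integrable lborel (einterval (ereal c) \<infinity>) (\<lambda>u. exp (- s * of_real u))"
    by (rule set_integrable_subset[of _ "{c..}"]) (use i in \<open>auto simp: set_integrable_def\<close>)
  have s0: "s \<noteq> 0" using s by auto
  have d: "((\<lambda>u. - exp (- s * of_real u) / s) has_vector_derivative exp (- s * of_real x)) (at x)" for x :: real
    by (rule derivative_eq_intros has_vector_derivative_real_field | use s0 in simp)+
  have "(LBINT u=ereal c..\<infinity>. exp (- s * of_real u)) = 0 - (- exp (- s * of_real c) / s)"
  proof (rule interval_integral_FTC_integrable[where F = "\<lambda>u. - exp (- s * of_real u) / s"])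
    show "set_integrable lborel (einterval (ereal c) \<infinity>) (\<lambda>u. exp (- s * of_real u))" by fact
    show "isCont (\<lambda>u. exp (- s * complex_of_real u)) x" for x by (intro continuous_intros)
    have "((\<lambda>u. - exp (- s * of_real u) / s) \<longlongrightarrow> - exp (- s * of_real c) / s) (at_right c)"
      by (rule tendsto_intros)+ (use s0 in auto)
    then show "(((\<lambda>u. - exp (- s * complex_of_real u) / s) \<circ> real_of_ereal) \<longlongrightarrow> - exp (- s * complex_of_real c) / s) (at_right (ereal c))"
      by (simp add: at_right_ereal filterlim_filtermap o_def)
    have "((\<lambda>u. - exp (- s * complex_of_real u) / s) \<longlongrightarrow> 0) at_top"
    proof (rule Lim_null_comparison)
      show "\<forall>\<^sub>F x in at_top. norm (- exp (- s * complex_of_real x) / s) \<le> exp (- Re s * x) / norm s"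
        by (auto simp: norm_divide)
      show "((\<lambda>x. exp (- Re s * x) / cmod s) \<longlongrightarrow> 0) at_top"
        using s s0 by real_asymp
    qed
    then show "(((\<lambda>u. - exp (- s * complex_of_real u) / s) \<circ> real_of_ereal) \<longlongrightarrow> 0) (at_left \<infinity>)"
      by (simp add: at_left_PInf filterlim_filtermap o_def)
  qed (use d in auto)
  also have "(LBINT u=ereal c..\<infinity>. exp (- s * of_real u)) = (LBINT u:{c<..}. exp (- s * of_real u))"
    by (simp add: interval_integral_to_infinity_eq)
  also have "\<dots> = (LBINT u. indicator {c..} u *\<^sub>R exp (- s * of_real u))"
    unfolding set_lebesgue_integral_def
    by (rule integral_cong_AE)
       (use AE_lborel_singleton[of c] in \<open>auto simp: indicator_def elim!: eventually_mono\<close>)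
  finally show ?thesis using i by (simp add: has_bochner_integral_iff)
qed

definition partial_sum :: "(nat \<Rightarrow> complex) \<Rightarrow> real \<Rightarrow> complex" where
  "partial_sum a x = (\<Sum>n = 1..nat \<lfloor>x\<rfloor>. a n)"

text \<open>
The means \<open>A(X) / X\<close> of the coefficients on a logarithmic scale, \<open>X = exp u\<close>. On this scale the
Dirichlet series becomes a Laplace transform and the Fejer kernel acts by convolution.
\<close>

definition log_mean :: "(nat \<Rightarrow> complex) \<Rightarrow> real \<Rightarrow> complex" where
  "log_mean a u = (if u < 0 then 0 else partial_sum a (exp u) * of_real (exp (- u)))"

lemma norm_partial_sum_le:
  assumes "\<And>n. norm (a n) \<le> 1" "x \<ge> 0"
  shows "norm (partial_sum a x) \<le> x"
proof -
  have "norm (partial_sum a x) \<le> (\<Sum>n = 1..nat \<lfloor>x\<rfloor>. 1)"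
    unfolding partial_sum_def by (rule sum_norm_le) (use assms in auto)
  also have "\<dots> \<le> x" using assms(2) by simp
  finally show ?thesis .
qed

lemma norm_partial_sum_diff_le:
  assumes a: "\<And>n. norm (a n) \<le> 1" and "0 \<le> x'" "x' \<le> x"
  shows "norm (partial_sum a x - partial_sum a x') \<le> x - x' + 1"
proof -
  have le: "nat \<lfloor>x'\<rfloor> \<le> nat \<lfloor>x\<rfloor>" using assms by (simp add: floor_mono nat_mono)
  have "partial_sum a x - partial_sum a x' = (\<Sum>n\<in>{1..nat \<lfloor>x\<rfloor>} - {1..nat \<lfloor>x'\<rfloor>}. a n)"
    unfolding partial_sum_def using le by (subst sum_diff) auto
  also have "norm \<dots> \<le> (\<Sum>n\<in>{1..nat \<lfloor>x\<rfloor>} - {1..nat \<lfloor>x'\<rfloor>}. 1)"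
    by (rule sum_norm_le) (use a in auto)
  also have "\<dots> = real (nat \<lfloor>x\<rfloor>) - real (nat \<lfloor>x'\<rfloor>)"
    using le by (simp add: card_Diff_subset of_nat_diff)
  also have "\<dots> \<le> x - x' + 1" using assms by linarith
  finally show ?thesis .
qed

lemma norm_log_mean_le:
  assumes "\<And>n. norm (a n) \<le> 1"
  shows "norm (log_mean a u) \<le> 1"
  using norm_partial_sum_le[of a "exp u", OF assms]
  by (auto simp: log_mean_def norm_mult norm_divide exp_minus field_simps)

lemma log_mean_measurable [measurable]: "log_mean a \<in> borel_measurable borel"
proof -
  have [measurable]: "(\<lambda>k::int. \<Sum>n = 1..nat k. a n) \<in> measurable (count_space UNIV) borel" by simp
  have "(\<lambda>u::real. \<Sum>n = 1..nat \<lfloor>exp u\<rfloor>. a n) \<in> borel_measurable borel" by measurable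
  then show ?thesis unfolding log_mean_def[abs_def] partial_sum_def by measurable
qed

text \<open>
Partial summation in integral form: \<open>log_mean\<close> is expanded as a sum of step functions starting at
the points \<open>ln n\<close>, and these are integrated term by term.
\<close>

lemma log_mean_laplace:
  assumes a: "\<And>n. norm (a n) \<le> 1" and s: "Re s > 1"
  shows "has_bochner_integral lborel (\<lambda>u. log_mean a u * exp (- (s - 1) * of_real u)) (dseries a s / s)"
proof -
  define f where "f i u = a (Suc i) * (indicator {ln (real (Suc i))..} u *\<^sub>R exp (- s * of_real u))" for i u
  have s0: "s \<noteq> 0" and s1: "Re s > 0" using s by auto
  have pw: "exp (- s * of_real (ln (real (Suc i)))) = of_nat (Suc i) powr (- s)" for i
    by (simp add: powr_def Ln_of_nat del: of_nat_Suc)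
  have hb: "has_bochner_integral lborel (f i) (a (Suc i) * (of_nat (Suc i) powr (- s) / s))" for i
    unfolding f_def
    using has_bochner_integral_mult_right[OF has_bochner_integral_exp_Ici[OF s1, of "ln (real (Suc i))"], of "a (Suc i)"]
    by (simp only: pw)
  have nf: "norm (f i u) \<le> norm (indicator {ln (real (Suc i))..} u *\<^sub>R exp (- of_real (Re s) * complex_of_real u))" for i u
    using a[of "Suc i"] by (auto simp: f_def norm_mult indicator_def)
  have hb2: "has_bochner_integral lborel (\<lambda>u. norm (indicator {ln (real (Suc i))..} u *\<^sub>R exp (- of_real (Re s) * complex_of_real u)))
     (real (Suc i) powr (- Re s) / Re s)" for i
  proof -
    have "has_bochner_integral lborel (\<lambda>u. indicator {ln (real (Suc i))..} u *\<^sub>R exp (- of_real (Re s) * complex_of_real u))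
       (exp (- of_real (Re s) * complex_of_real (ln (real (Suc i)))) / of_real (Re s))"
      by (rule has_bochner_integral_exp_Ici) (use s in auto)
    from has_bochner_integral_bounded_linear[OF bounded_linear_Re this]
    show ?thesis
      by (simp add: Re_exp powr_def indicator_def if_distrib cong: if_cong)
  qed
  have sum_f: "(\<lambda>i. f i u) sums (log_mean a u * exp (- (s - 1) * of_real u))" for u
  proof -
    have fin: "f i u = 0" if "i \<notin> {..<(if u < 0 then 0 else nat \<lfloor>exp u\<rfloor>)}" for i
    proof -
      have "u < ln (real (Suc i))"
      proof (cases "u < 0")
        case False
        with that have "nat \<lfloor>exp u\<rfloor> < Suc i" by auto
        then have "exp u < real (Suc i)" by linarith
        then have "ln (exp u) < ln (real (Suc i))" by (subst ln_less_cancel_iff) auto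
        then show ?thesis by simp
      qed (auto intro: less_le_trans)
      then show ?thesis by (simp add: f_def)
    qed
    have "(\<lambda>i. f i u) sums (\<Sum>i\<in>{..<(if u < 0 then 0 else nat \<lfloor>exp u\<rfloor>)}. f i u)"
      by (rule sums_finite) (use fin in auto)
    also have "(\<Sum>i\<in>{..<(if u < 0 then 0 else nat \<lfloor>exp u\<rfloor>)}. f i u) = log_mean a u * exp (- (s - 1) * of_real u)"
    proof (cases "u < 0")
      case False
      have "(\<Sum>i<nat \<lfloor>exp u\<rfloor>. f i u) = (\<Sum>i<nat \<lfloor>exp u\<rfloor>. a (Suc i) * exp (- s * of_real u))"
      proof (rule sum.cong[OF refl])
        fix i assume "i \<in> {..<nat \<lfloor>exp u\<rfloor>}"
        then have "real (Suc i) \<le> exp u" by (simp) linarith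
        then have "ln (real (Suc i)) \<le> ln (exp u)" by (subst ln_le_cancel_iff) auto
        then show "f i u = a (Suc i) * exp (- s * of_real u)" by (simp add: f_def)
      qed
      also have "\<dots> = (\<Sum>i<nat \<lfloor>exp u\<rfloor>. a (Suc i)) * exp (- s * of_real u)"
        by (simp add: sum_distrib_right)
      also have "(\<Sum>i<nat \<lfloor>exp u\<rfloor>. a (Suc i)) = partial_sum a (exp u)"
        unfolding partial_sum_def by (rule sum.reindex_bij_witness[of _ "\<lambda>n. n - 1" Suc]) auto
      also have "partial_sum a (exp u) * exp (- s * of_real u) = log_mean a u * exp (- (s - 1) * of_real u)"
        using False by (simp add: log_mean_def exp_of_real[symmetric] mult_exp_exp algebra_simps del: exp_of_real)
      finally show ?thesis using False by simp
    qed (simp add: log_mean_def)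
    finally show ?thesis .
  qed
  have summ: "summable (\<lambda>i. real (Suc i) powr (- Re s) / Re s)"
    using s by (intro summable_divide) (subst summable_Suc_iff, simp add: summable_real_powr_iff)
  have bnd: "(LBINT u. norm (f i u)) \<le> real (Suc i) powr (- Re s) / Re s" for i
    unfolding has_bochner_integral_integral_eq[OF hb2[of i], symmetric]
  proof (rule integral_mono)
    show "integrable lborel (\<lambda>u. norm (f i u))"
      using hb[of i] by (auto simp: has_bochner_integral_iff)
  qed (use hb2[of i] nf in \<open>auto simp: has_bochner_integral_iff simp del: of_nat_Suc\<close>)
  have S1: "summable (\<lambda>i. LBINT u. norm (f i u))"
    by (rule summable_comparison_test'[OF summ, of 0]) (use bnd in auto)
  have S2: "AE u in lborel. summable (\<lambda>i. norm (f i u))"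
  proof (rule AE_I2)
    fix u
    show "summable (\<lambda>i. norm (f i u))"
    proof (rule summable_finite[of "{..<nat \<lceil>exp u\<rceil>}"])
      fix i assume "i \<notin> {..<nat \<lceil>exp u\<rceil>}"
      then have "exp u < real (Suc i)" by simp linarith
      then have "ln (exp u) < ln (real (Suc i))" by (subst ln_less_cancel_iff) auto
      then show "norm (f i u) = 0" by (simp add: f_def)
    qed simp
  qed
  have int: "integrable lborel (f i)" for i using hb by (simp add: has_bochner_integral_iff)
  have "(\<lambda>i. integral\<^sup>L lborel (f i)) sums (\<integral>u. (\<Sum>i. f i u) \<partial>lborel)"
    by (rule sums_integral[OF int S2 S1])
  then have 1: "(\<lambda>i. a (Suc i) * (of_nat (Suc i) powr (- s) / s)) sums (\<integral>u. (\<Sum>i. f i u) \<partial>lborel)"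
    using hb by (simp add: has_bochner_integral_iff)
  have sd: "summable (\<lambda>n. a n * of_nat n powr (- s))"
  proof (rule summable_comparison_test')
    show "summable (\<lambda>n. real n powr (- Re s))" using s by (simp add: summable_real_powr_iff)
    show "norm (a n * of_nat n powr (- s)) \<le> real n powr (- Re s)" if "n \<ge> 0" for n
      using a[of n] by (cases "n = 0") (auto simp: norm_mult norm_powr_real_powr mult_left_le_one_le)
  qed
  have "(\<lambda>i. a (Suc i) * of_nat (Suc i) powr (- s)) sums dseries a s"
    using summable_sums[OF sd] unfolding dseries_def by (subst sums_Suc_iff) simp
  then have "(\<lambda>i. a (Suc i) * of_nat (Suc i) powr (- s) / s) sums (dseries a s / s)"
    by (rule sums_divide)
  with 1 have "(\<integral>u. (\<Sum>i. f i u) \<partial>lborel) = dseries a s / s"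
    by (auto intro: sums_unique2)
  moreover have "integrable lborel (\<lambda>u. \<Sum>i. f i u)"
    by (rule integrable_suminf[OF int S2 S1])
  moreover have "(\<lambda>u. \<Sum>i. f i u) = (\<lambda>u. log_mean a u * exp (- (s - 1) * of_real u))"
    using sum_f by (simp add: sums_iff fun_eq_iff)
  ultimately show ?thesis by (simp add: has_bochner_integral_iff)
qed

text \<open>
The means of bounded coefficients are slowly oscillating. This is the Tauberian condition that allows
the value at a point to be recovered from averages around it.
\<close>

lemma log_mean_diff_le:
  assumes a: "\<And>n. norm (a n) \<le> 1"
  shows "norm (log_mean a u - log_mean a u') \<le> 2 * \<bar>u - u'\<bar> + exp (- min u u')"
proof -
  have *: "norm (log_mean a u - log_mean a u') \<le> 2 * (u - u') + exp (- u')" if le: "u' \<le> u" for u u'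
  proof (cases "u' < 0")
    case True
    show ?thesis
    proof (cases "u < 0")
      case False
      have "norm (log_mean a u - log_mean a u') \<le> 1" using True norm_log_mean_le[where a = a, OF a] by (simp add: log_mean_def[of a u'])
      also have "\<dots> \<le> exp (- u')" using True by simp
      finally show ?thesis using le by (simp add: add_increasing)
    qed (use True le in \<open>auto simp: log_mean_def intro!: add_nonneg_nonneg\<close>)
  next
    case False
    let ?A = "partial_sum a"
    have e: "exp (- u) \<le> exp (- u')" "exp (-u) > 0" using le by auto
    have d: "1 - exp (u' - u) \<le> u - u'" using exp_ge_add_one_self[of "u' - u"] by linarith
    have "log_mean a u - log_mean a u' = (?A (exp u) - ?A (exp u')) * of_real (exp (- u)) - ?A (exp u') * of_real (exp (- u') - exp (- u))"
      using False le by (simp add: log_mean_def algebra_simps)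
    also have "norm \<dots> \<le> norm (?A (exp u) - ?A (exp u')) * exp (- u) + norm (?A (exp u')) * (exp (- u') - exp (- u))"
      by (rule order_trans[OF norm_triangle_ineq4]) (use e in \<open>simp add: norm_mult flip: of_real_diff\<close>)
    also have "\<dots> \<le> (exp u - exp u' + 1) * exp (- u) + exp u' * (exp (- u') - exp (- u))"
      using e le by (intro add_mono mult_right_mono norm_partial_sum_diff_le[where a = a] norm_partial_sum_le[where a = a] a) auto
    also have "\<dots> = 2 * (1 - exp (u' - u)) + exp (- u)"
      by (simp add: algebra_simps exp_add[symmetric] flip: exp_minus exp_diff)
    also have "\<dots> \<le> 2 * (u - u') + exp (- u')" using d e by (intro add_mono mult_left_mono) auto
    finally show ?thesis .
  qed
  show ?thesis
  proof (cases "u' \<le> u")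
    case True then show ?thesis using *[OF True] by simp
  next
    case False then show ?thesis using *[of u u'] by (simp add: norm_minus_commute min_def)
  qed
qed

lemma fejer_scale: "T > 0 \<Longrightarrow> fejer T (w / T) = T * fejer 1 w"
  by (auto simp: fejer_def power_divide power2_eq_square)

text \<open>
By Fubini, integrating the Laplace transform along a segment of a vertical line against the triangular
weight is the same as convolving with the Fejer kernel.
\<close>

lemma log_mean_fejer_identity:
  assumes a: "\<And>n. norm (a n) \<le> 1" and T: "T > 0" and e: "e > 0"
  shows "(LBINT t. of_real (triangle T t) * exp (\<i> * of_real y * of_real t) * (dseries a (1 + of_real e + \<i> * of_real t) / (1 + of_real e + \<i> * of_real t))) =
         (LBINT u. log_mean a u * of_real (exp (- e * u) * fejer T (y - u)))"
proof -
  define F where "F t u = of_real (triangle T t) * exp (\<i> * of_real y * of_real t) * (log_mean a u * exp (- (of_real e + \<i> * of_real t) * of_real u))" for t u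
  have neg: "log_mean a u = 0" if "u < 0" for u using that by (simp add: log_mean_def)
  have nF: "norm (F t u) \<le> triangle T t * (indicator {0..} u * exp (- e * u))" for t u
    using norm_log_mean_le[where a = a, OF a, of u] triangle_bounds(1)[of T t] neg[of u]
    by (auto simp: F_def norm_mult indicator_def mult_left_mono mult_left_le_one_le mult_right_le_one_le)
  have ie: "integrable lborel (\<lambda>u. indicator {0..} u * exp (- e * u))"
  proof -
    have "integrable lborel (\<lambda>u. Re (indicator {0..} u *\<^sub>R exp (- of_real e * complex_of_real u)))"
      using has_bochner_integral_exp_Ici[of "of_real e" 0] e by (intro integrable_Re) (auto simp: has_bochner_integral_iff)
    then show ?thesis by (simp add: Re_exp)
  qed
  have it: "integrable lborel (triangle T)"
  proof (rule Bochner_Integration.integrable_bound)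
    show "integrable lborel (indicator {-T..T} :: real \<Rightarrow> real)"
      by (intro integrable_real_indicator) (auto simp: emeasure_lborel_Icc_eq)
    show "AE t in lborel. norm (triangle T t) \<le> norm (indicator {-T..T} t :: real)"
      using triangle_bounds T triangle_eq_0[OF T] by (intro AE_I2) (auto simp: indicator_def)
  qed simp
  have meas: "case_prod F \<in> borel_measurable (lborel \<Otimes>\<^sub>M lborel)"
    unfolding F_def[abs_def] by measurable
  have int: "integrable (lborel \<Otimes>\<^sub>M lborel) (case_prod F)"
  proof (rule Bochner_Integration.integrable_bound)
    show "integrable (lborel \<Otimes>\<^sub>M lborel) (\<lambda>(t, u). triangle T t * (indicator {0..} u * exp (- e * u)))"
    proof (rule lborel_pair.Fubini_integrable)
      have "integrable lborel (\<lambda>t. norm (triangle T t) * (LBINT u. norm (indicator {0..} u * exp (- e * u))))"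
        using it by simp
      then show "integrable lborel (\<lambda>t. LBINT u. norm (case (t, u) of (t, u) \<Rightarrow> triangle T t * (indicator {0..} u * exp (- e * u))))"
        by (simp add: abs_mult)
      show "AE t in lborel. integrable lborel (\<lambda>u. case (t, u) of (t, u) \<Rightarrow> triangle T t * (indicator {0..} u * exp (- e * u)))"
        using ie by (intro AE_I2) simp
    qed simp
    show "AE x in lborel \<Otimes>\<^sub>M lborel. norm (case_prod F x) \<le> norm (case x of (t, u) \<Rightarrow> triangle T t * (indicator {0..} u * exp (- e * u)))"
      using nF by (intro AE_I2) (auto intro: order_trans[OF _ abs_ge_self])
  qed (use meas in auto)
  have L: "(LBINT u. F t u) = of_real (triangle T t) * exp (\<i> * of_real y * of_real t) * (dseries a (1 + of_real e + \<i> * of_real t) / (1 + of_real e + \<i> * of_real t))" for t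
  proof -
    have "Re (1 + of_real e + \<i> * of_real t) > 1" using e by simp
    from log_mean_laplace[where a = a, OF a this]
    show ?thesis by (simp add: F_def has_bochner_integral_iff)
  qed
  have R: "(LBINT t. F t u) = log_mean a u * of_real (exp (- e * u) * fejer T (y - u))" for u
  proof -
    have "F t u = (log_mean a u * of_real (exp (- e * u))) * (of_real (triangle T t) * exp (\<i> * of_real (y - u) * of_real t))" for t
    proof -
      have "exp (\<i> * of_real y * of_real t) * exp (- (of_real e + \<i> * of_real t) * of_real u) = of_real (exp (- e * u)) * exp (\<i> * of_real (y - u) * complex_of_real t)"
        by (simp add: exp_of_real[symmetric] mult_exp_exp del: exp_of_real) (simp add: algebra_simps)
      then show ?thesis unfolding F_def by (simp add: mult_ac)
    qed
    then have "(LBINT t. F t u) = (log_mean a u * of_real (exp (- e * u))) * (LBINT t. of_real (triangle T t) * exp (\<i> * of_real (y - u) * of_real t))"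
      by simp
    also have "\<dots> = (log_mean a u * of_real (exp (- e * u))) * of_real (fejer T (y - u))"
      by (simp only: fejer_fourier[OF T])
    finally show ?thesis by simp
  qed
  show ?thesis using lborel_pair.Fubini_integral[OF int] unfolding L R by simp
qed

text \<open>
The limit \<open>e \<rightarrow> 0\<close> of \<open>log_mean_fejer_identity\<close>: on the left, \<open>G\<close> is bounded on a compact rectangle;
on the right, the kernel itself is an integrable majorant. The substitution \<open>w = T * (y - u)\<close>
normalises the kernel to parameter 1, so that \<open>T\<close> only governs how far the argument is displaced.
\<close>

lemma log_mean_fejer_boundary:
  assumes a: "\<And>n. norm (a n) \<le> 1" and T: "T > 0"
    and G: "continuous_on {s. Re s \<ge> 1} G" "\<And>s. Re s > 1 \<Longrightarrow> G s = dseries a s"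
  shows "(LBINT t. of_real (triangle T t) * (G (1 + \<i> * of_real t) / (1 + \<i> * of_real t)) * exp (\<i> * of_real y * of_real t)) =
         (LBINT w. log_mean a (y - w / T) * of_real (fejer 1 w))"
proof -
  let ?k = "\<lambda>t. of_real (triangle T t) * exp (\<i> * of_real y * of_real t)"
  define H where "H s = G s / s" for s
  have contH: "continuous_on {s. Re s \<ge> 1} H"
    unfolding H_def[abs_def] by (intro continuous_intros G(1)) auto
  define e where "e k = inverse (real (Suc k))" for k
  have e: "0 < e k" "e k \<le> 1" for k by (auto simp: e_def field_simps)
  have e_lim: "e \<longlonglongrightarrow> 0" unfolding e_def[abs_def] by (rule LIMSEQ_inverse_real_of_nat)
  define p where "p x t = 1 + complex_of_real x + \<i> * of_real t" for x t
  have contp: "continuous_on UNIV (p x)" for x unfolding p_def[abs_def] by (intro continuous_intros)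
  have contHp: "continuous_on UNIV (\<lambda>t. H (p x t))" if "x \<ge> 0" for x
    by (rule continuous_on_compose2[OF contH contp]) (use that in \<open>auto simp: p_def\<close>)
  have measHp [measurable]: "(\<lambda>t. H (p x t)) \<in> borel_measurable borel" if "x \<ge> 0" for x
    by (rule borel_measurable_continuous_onI[OF contHp[OF that]])
  obtain C where C: "\<And>x t. 0 \<le> x \<Longrightarrow> x \<le> 1 \<Longrightarrow> \<bar>t\<bar> \<le> T \<Longrightarrow> norm (H (p x t)) \<le> C"
  proof -
    have "compact ((\<lambda>(x, t). p x t) ` ({0..1} \<times> {-T..T}))"
      unfolding p_def case_prod_unfold by (rule compact_continuous_image) (auto intro!: continuous_intros compact_Times)
    then have "compact (H ` ((\<lambda>(x, t). p x t) ` ({0..1} \<times> {-T..T})))"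
      by (rule compact_continuous_image[rotated]) (rule continuous_on_subset[OF contH], auto simp: p_def)
    then obtain C where "\<forall>z \<in> H ` ((\<lambda>(x, t). p x t) ` ({0..1} \<times> {-T..T})). norm z \<le> C"
      using compact_imp_bounded bounded_iff by blast
    then show ?thesis by (intro that[of C]) (auto simp: abs_le_iff)
  qed
  have C0: "C \<ge> 0" using C[of 0 0] T norm_ge_zero order_trans by (metis abs_zero less_imp_le order_refl zero_le_one)
  let ?L = "\<lambda>x. LBINT t. ?k t * H (p x t)"
  have "(\<lambda>k. ?L (e k)) \<longlonglongrightarrow> ?L 0"
  proof (rule integral_dominated_convergence)
    show "integrable lborel (\<lambda>t. indicator {-T..T} t * C)"
      by (intro integrable_mult_left integrable_real_indicator) (auto simp: emeasure_lborel_Icc_eq)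
    show "AE t in lborel. (\<lambda>k. ?k t * H (p (e k) t)) \<longlonglongrightarrow> ?k t * H (p 0 t)"
    proof (intro AE_I2 tendsto_mult tendsto_const)
      fix t
      have "(\<lambda>k. p (e k) t) \<longlonglongrightarrow> p 0 t" unfolding p_def by (intro tendsto_intros e_lim)
      then show "(\<lambda>k. H (p (e k) t)) \<longlonglongrightarrow> H (p 0 t)"
        by (intro continuous_on_tendsto_compose[OF contH]) (use e(1) in \<open>auto simp: p_def less_imp_le\<close>)
    qed
    show "AE t in lborel. norm (?k t * H (p (e k) t)) \<le> indicator {-T..T} t * C" for k
    proof (rule AE_I2)
      fix t
      show "norm (?k t * H (p (e k) t)) \<le> indicator {-T..T} t * C"
      proof (cases "t \<in> {-T..T}")
        case True
        have "norm (?k t * H (p (e k) t)) = triangle T t * norm (H (p (e k) t))"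
          using triangle_bounds(1) by (simp add: norm_mult)
        also have "\<dots> \<le> 1 * C" using True e[of k] triangle_bounds[of T t] T C0 by (intro mult_mono C) auto
        finally show ?thesis using True by simp
      qed (use triangle_eq_0[OF T] in auto)
    qed
    show "(\<lambda>t. ?k t * H (p (e k) t)) \<in> borel_measurable lborel" for k
      using measHp[of "e k"] e(1)[of k] by simp
    show "(\<lambda>t. ?k t * H (p 0 t)) \<in> borel_measurable lborel"
      using measHp[of 0] by simp
  qed
  moreover have "?L (e k) = (LBINT u. log_mean a u * of_real (exp (- e k * u) * fejer T (y - u)))" for k
  proof -
    have "H (p (e k) t) = dseries a (1 + of_real (e k) + \<i> * of_real t) / (1 + of_real (e k) + \<i> * of_real t)" for t
      unfolding H_def p_def by (subst G(2)) (use e(1)[of k] in auto)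
    then show ?thesis using log_mean_fejer_identity[where a = a, OF a T e(1), of y k] by simp
  qed
  moreover have "(\<lambda>k. LBINT u. log_mean a u * of_real (exp (- e k * u) * fejer T (y - u))) \<longlonglongrightarrow> (LBINT u. log_mean a u * of_real (exp (- 0 * u) * fejer T (y - u)))"
  proof (rule integral_dominated_convergence)
    have "integrable lborel (\<lambda>x. fejer T (y + (- 1) * x))"
      by (rule lborel_integrable_real_affine[OF integrable_fejer[OF T]]) simp
    then show "integrable lborel (\<lambda>u. fejer T (y - u))" by simp
    show "AE u in lborel. (\<lambda>k. log_mean a u * of_real (exp (- e k * u) * fejer T (y - u))) \<longlonglongrightarrow> log_mean a u * of_real (exp (- 0 * u) * fejer T (y - u))"
      by (intro AE_I2 tendsto_intros e_lim)
    show "AE u in lborel. norm (log_mean a u * of_real (exp (- e k * u) * fejer T (y - u))) \<le> fejer T (y - u)" for k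
    proof (rule AE_I2)
      fix u
      show "norm (log_mean a u * of_real (exp (- e k * u) * fejer T (y - u))) \<le> fejer T (y - u)"
      proof (cases "u < 0")
        case False
        have "norm (log_mean a u * of_real (exp (- e k * u) * fejer T (y - u))) = norm (log_mean a u) * (exp (- e k * u) * fejer T (y - u))"
          using fejer_nonneg[OF T] by (simp add: norm_mult)
        also have "\<dots> \<le> 1 * (1 * fejer T (y - u))"
          using False e(1)[of k] fejer_nonneg[OF T] by (intro mult_mono norm_log_mean_le[where a = a] a) auto
        finally show ?thesis by simp
      qed (use fejer_nonneg[OF T] in \<open>auto simp: log_mean_def\<close>)
    qed
  qed simp_all
  ultimately have "?L 0 = (LBINT u. log_mean a u * of_real (fejer T (y - u)))"
    using LIMSEQ_unique by fastforce
  also have "\<dots> = \<bar>- (1 / T)\<bar> *\<^sub>R (LBINT w. log_mean a (y + - (1 / T) * w) * of_real (fejer T (y - (y + - (1 / T) * w))))"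
    by (rule lborel_integral_real_affine) (use T in auto)
  also have "\<dots> = (LBINT w. \<bar>- (1 / T)\<bar> *\<^sub>R (log_mean a (y + - (1 / T) * w) * of_real (fejer T (y - (y + - (1 / T) * w)))))"
    by simp
  also have "\<dots> = (LBINT w. log_mean a (y - w / T) * of_real (fejer 1 w))"
    using T by (intro Bochner_Integration.integral_cong) (auto simp: fejer_scale scaleR_conv_of_real)
  finally show ?thesis by (simp add: p_def H_def mult_ac)
qed

text \<open>
Let \<open>c\<close> be the integral of the kernel. The quantity \<open>c * log_mean a y\<close> differs from the average \<open>Q T y\<close>
by at most \<open>B T y\<close>, because of slow oscillation. For fixed \<open>T\<close> the average tends to 0 as \<open>y\<close> grows, by
the Riemann-Lebesgue lemma, while \<open>B T y\<close> tends to \<open>b T\<close>, which is small for large \<open>T\<close>.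
\<close>

lemma log_mean_tendsto_0:
  assumes a: "\<And>n. norm (a n) \<le> 1"
    and G: "continuous_on {s. Re s \<ge> 1} G" "\<And>s. Re s > 1 \<Longrightarrow> G s = dseries a s"
  shows "(log_mean a \<longlongrightarrow> 0) at_top"
proof -
  let ?m = "\<lambda>T y w :: real. min 2 (2 * \<bar>w\<bar> / T + exp (- y + \<bar>w\<bar> / T))"
  define Q where "Q T y = (LBINT w. log_mean a (y - w / T) * of_real (fejer 1 w))" for T y
  define B where "B T y = (LBINT w. ?m T y w * fejer 1 w)" for T y
  define b where "b T = (LBINT w. min 2 (2 * \<bar>w\<bar> / T) * fejer 1 w)" for T
  define c where "c = (LBINT w. fejer 1 w)"
  have c: "c > 0" unfolding c_def by (rule fejer_integral_pos)
  have f1: "integrable lborel (fejer 1)" "fejer 1 w \<ge> 0" for w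
    using integrable_fejer[of 1] fejer_nonneg[of 1] by auto
  have Q: "(Q T \<longlongrightarrow> 0) at_top" if T: "T > 0" for T
  proof -
    have "continuous_on UNIV (\<lambda>t. G (1 + \<i> * complex_of_real t))"
      by (rule continuous_on_compose2[OF G(1)]) (auto intro!: continuous_intros)
    then have cont: "continuous_on UNIV (\<lambda>t. of_real (triangle T t) * (G (1 + \<i> * of_real t) / (1 + \<i> * of_real t)))"
      by (intro continuous_intros T) (auto simp: complex_eq_iff)
    have "Q T = (\<lambda>y. LBINT t. of_real (triangle T t) * (G (1 + \<i> * of_real t) / (1 + \<i> * of_real t)) * exp (\<i> * of_real y * of_real t))"
      unfolding Q_def by (intro ext sym[OF log_mean_fejer_boundary] a T G)
    moreover have "((\<lambda>y. LBINT t. of_real (triangle T t) * (G (1 + \<i> * of_real t) / (1 + \<i> * of_real t)) * exp (\<i> * of_real y * of_real t)) \<longlongrightarrow> 0) at_top"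
      by (rule riemann_lebesgue_compact_support[OF cont T]) (simp add: triangle_eq_0[OF T])
    ultimately show ?thesis by simp
  qed
  have B: "(B T \<longlongrightarrow> b T) at_top" if T: "T > 0" for T
    unfolding B_def b_def
  proof (rule integral_dominated_convergence_at_top)
    show "integrable lborel (\<lambda>w. 2 * fejer 1 w)" using f1 by simp
    show "\<forall>\<^sub>F y in at_top. AE w in lborel. norm (?m T y w * fejer 1 w) \<le> 2 * fejer 1 w"
      using T f1(2) by (intro always_eventually allI AE_I2) (auto simp: abs_mult intro!: mult_right_mono)
    show "AE w in lborel. ((\<lambda>y. ?m T y w * fejer 1 w) \<longlongrightarrow> min 2 (2 * \<bar>w\<bar> / T) * fejer 1 w) at_top"
    proof (intro AE_I2 tendsto_mult tendsto_const tendsto_min)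
      fix w :: real
      show "((\<lambda>y. 2 * \<bar>w\<bar> / T + exp (- y + \<bar>w\<bar> / T)) \<longlongrightarrow> 2 * \<bar>w\<bar> / T) at_top" by real_asymp
    qed
  qed simp_all
  have b: "(b \<longlongrightarrow> 0) at_top"
  proof -
    have "(b \<longlongrightarrow> (LBINT w. 0 * fejer 1 w)) at_top"
      unfolding b_def
    proof (rule integral_dominated_convergence_at_top)
      show "integrable lborel (\<lambda>w. 2 * fejer 1 w)" using f1 by simp
      show "\<forall>\<^sub>F T in at_top. AE w in lborel. norm (min 2 (2 * \<bar>w\<bar> / T) * fejer 1 w) \<le> 2 * fejer 1 w"
        using f1(2) by (intro eventually_mono[OF eventually_gt_at_top[of 0]] AE_I2) (auto simp: abs_mult intro!: mult_right_mono)
      show "AE w in lborel. ((\<lambda>T. min 2 (2 * \<bar>w\<bar> / T) * fejer 1 w) \<longlongrightarrow> 0 * fejer 1 w) at_top"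
      proof (intro AE_I2 tendsto_mult tendsto_const)
        fix w :: real
        have "((\<lambda>T. 2 * \<bar>w\<bar> / T) \<longlongrightarrow> 0) at_top" by real_asymp
        then have "((\<lambda>T. min 2 (2 * \<bar>w\<bar> / T)) \<longlongrightarrow> min 2 0) at_top" by (intro tendsto_min tendsto_const)
        then show "((\<lambda>T. min 2 (2 * \<bar>w\<bar> / T)) \<longlongrightarrow> 0) at_top" by simp
      qed
    qed simp_all
    then show ?thesis by simp
  qed
  have main: "norm (log_mean a y) * c \<le> norm (Q T y) + B T y" if T: "T > 0" for T y
  proof -
    let ?d = "\<lambda>w. (log_mean a y - log_mean a (y - w / T)) * of_real (fejer 1 w)"
    have i2: "integrable lborel (\<lambda>w. log_mean a (y - w / T) * of_real (fejer 1 w))"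
    proof (rule Bochner_Integration.integrable_bound[OF f1(1)])
      show "AE w in lborel. norm (log_mean a (y - w / T) * of_real (fejer 1 w)) \<le> norm (fejer 1 w)"
        using norm_log_mean_le[where a = a, OF a] by (intro AE_I2) (auto simp: norm_mult mult_left_le_one_le)
    qed simp
    have i1: "integrable lborel (\<lambda>w. log_mean a y * of_real (fejer 1 w))" using f1 by simp
    have i3: "integrable lborel ?d" unfolding left_diff_distrib using i1 i2 by (rule Bochner_Integration.integrable_diff)
    have "log_mean a y * of_real c = (LBINT w. log_mean a y * of_real (fejer 1 w))"
      by (simp add: c_def)
    also have "\<dots> = Q T y + (LBINT w. ?d w)"
      unfolding Q_def left_diff_distrib using i1 i2 by (subst Bochner_Integration.integral_diff) auto
    finally have "norm (log_mean a y) * c = norm (Q T y + (LBINT w. ?d w))" using c by (metis abs_of_pos norm_mult norm_of_real)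
    also have "\<dots> \<le> norm (Q T y) + (LBINT w. norm (?d w))"
      by (rule order_trans[OF norm_triangle_ineq]) (simp add: integral_norm_bound)
    also have "(LBINT w. norm (?d w)) \<le> B T y"
      unfolding B_def
    proof (rule integral_mono)
      show "integrable lborel (\<lambda>w. norm (?d w))" using i3 by simp
      show "integrable lborel (\<lambda>w. ?m T y w * fejer 1 w)"
      proof (rule Bochner_Integration.integrable_bound)
        show "integrable lborel (\<lambda>w. 2 * fejer 1 w)" using f1 by simp
        show "AE w in lborel. norm (?m T y w * fejer 1 w) \<le> norm (2 * fejer 1 w)"
          using T f1(2) by (intro AE_I2) (auto simp: abs_mult intro!: mult_right_mono)
      qed simp
      fix w
      have "norm (log_mean a y - log_mean a (y - w / T)) \<le> norm (log_mean a y) + norm (log_mean a (y - w / T))"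
        by (rule norm_triangle_ineq4)
      also have "\<dots> \<le> 2" using norm_log_mean_le[where a = a, OF a, of y] norm_log_mean_le[where a = a, OF a, of "y - w / T"] by simp
      finally have 1: "norm (log_mean a y - log_mean a (y - w / T)) \<le> 2" .
      have "norm (log_mean a y - log_mean a (y - w / T)) \<le> 2 * \<bar>y - (y - w / T)\<bar> + exp (- min y (y - w / T))"
        by (rule log_mean_diff_le[where a = a, OF a])
      also have "\<dots> \<le> 2 * \<bar>w\<bar> / T + exp (- y + \<bar>w\<bar> / T)"
        using T by (auto simp: min_def abs_if field_simps)
      finally show "norm (?d w) \<le> ?m T y w * fejer 1 w"
        using 1 f1(2)[of w] by (auto simp: norm_mult intro!: mult_right_mono)
    qed
    finally show ?thesis by simp
  qed
  show ?thesis
  proof (rule tendstoI)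
    fix r :: real assume r: "r > 0"
    have rc: "r * c / 3 > 0" using r c by simp
    obtain T where T: "T > 0" "\<bar>b T\<bar> < r * c / 3"
      using eventually_conj[OF eventually_gt_at_top[of "0::real"] tendstoD[OF b rc]]
      unfolding eventually_at_top_linorder by auto
    show "\<forall>\<^sub>F y in at_top. dist (log_mean a y) 0 < r"
      using tendstoD[OF Q[OF T(1)] rc] tendstoD[OF B[OF T(1)] rc]
    proof eventually_elim
      case (elim y)
      define k where "k = r * c / 3"
      have "norm (Q T y) < k" "\<bar>B T y - b T\<bar> < k" "\<bar>b T\<bar> < k"
        using elim T(2) by (auto simp: dist_real_def k_def)
      then have "norm (Q T y) + B T y < k + (k + k)" by linarith
      also have "k + (k + k) = r * c" by (simp add: k_def)
      finally have "norm (Q T y) + B T y < r * c" .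
      with main[OF T(1), of y] have "norm (log_mean a y) * c < r * c" by simp
      then show ?case using c by simp
    qed
  qed
qed

text \<open>
The Wiener-Ikehara theorem for bounded coefficients: boundedness takes the role of monotonicity as
the Tauberian condition.
\<close>

lemma tauberian_mean:
  fixes a :: "nat \<Rightarrow> complex"
  assumes a: "\<And>n. norm (a n) \<le> 1"
    and G: "continuous_on {s. Re s \<ge> 1} G" "\<And>s. Re s > 1 \<Longrightarrow> G s = dseries a s"
  shows "(\<lambda>N. (\<Sum>n = 1..N. a n) / of_nat N) \<longlonglongrightarrow> 0"
proof -
  have "filterlim (\<lambda>N::nat. ln (real N)) at_top sequentially" by real_asymp
  from filterlim_compose[OF log_mean_tendsto_0[where a = a, OF a G] this]
  have "(\<lambda>N. log_mean a (ln (real N))) \<longlonglongrightarrow> 0" .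
  moreover have "\<forall>\<^sub>F N in sequentially. log_mean a (ln (real N)) = (\<Sum>n = 1..N. a n) / of_nat N"
    using eventually_ge_at_top[of 1]
    by eventually_elim (auto simp: log_mean_def partial_sum_def exp_minus divide_inverse)
  ultimately show ?thesis by (rule Lim_transform_eventually)
qed

section \<open>Moebius averages along periodic sequences\<close>

lemma moebius_char_mean:
  assumes \<psi>: "dirichlet_char q \<psi>"
  shows "(\<lambda>N. (\<Sum>n = 1..N. of_int (moebius_mu n) * \<psi> n) / of_nat N) \<longlonglongrightarrow> 0"
proof -
  obtain G where G: "continuous_on {s. Re s \<ge> 1} G"
    "\<And>s. Re s > 1 \<Longrightarrow> G s = dseries (\<lambda>n. of_int (moebius_mu n) * \<psi> n) s"
    using moebius_char_continuation[OF \<psi>] by blast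
  have "norm (of_int (moebius_mu n) * \<psi> n) \<le> 1" for n
    using norm_dirichlet_char_le[OF \<psi>, of n] abs_moebius_mu_le[of n] by (simp add: norm_mult mult_le_one)
  from tauberian_mean[of "\<lambda>n. of_int (moebius_mu n) * \<psi> n", OF this G] show ?thesis .
qed

lemma moebius_coprime_periodic_mean:
  fixes c :: "nat \<Rightarrow> complex"
  assumes q: "q > 0" and per: "\<And>n. c (n + q) = c n" and supp: "\<And>n. \<not> coprime n q \<Longrightarrow> c n = 0"
  shows "(\<lambda>N. (\<Sum>n = 1..N. of_int (moebius_mu n) * c n) / of_nat N) \<longlonglongrightarrow> 0"
  using q per supp
proof (rule coprime_periodic_induct)
  show "(\<lambda>N. (\<Sum>n = 1..N. of_int (moebius_mu n) * (b * \<psi> n)) / of_nat N) \<longlonglongrightarrow> 0" if "dirichlet_char q \<psi>" for \<psi> b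
  proof -
    have "(\<lambda>N. b * ((\<Sum>n = 1..N. of_int (moebius_mu n) * \<psi> n) / of_nat N)) \<longlonglongrightarrow> b * 0"
      by (intro tendsto_mult tendsto_const moebius_char_mean[OF that])
    then show ?thesis by (simp add: sum_distrib_left mult_ac)
  qed
  show "(\<lambda>N. (\<Sum>n = 1..N. of_int (moebius_mu n) * (f n + g n)) / of_nat N) \<longlonglongrightarrow> 0"
    if "(\<lambda>N. (\<Sum>n = 1..N. of_int (moebius_mu n) * f n) / of_nat N) \<longlonglongrightarrow> 0"
       "(\<lambda>N. (\<Sum>n = 1..N. of_int (moebius_mu n) * g n) / of_nat N) \<longlonglongrightarrow> 0" for f g :: "nat \<Rightarrow> complex"
    using tendsto_add[OF that] by (simp add: distrib_left sum.distrib add_divide_distrib)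
  show "(\<lambda>N. (\<Sum>n = 1..N. of_int (moebius_mu n) * 0) / of_nat N) \<longlonglongrightarrow> (0 :: complex)"
    by (simp only: mult_zero_right sum.neutral_const div_0 tendsto_const)
qed

lemma moebius_mu_mult_not_coprime:
  assumes "\<not> coprime d m"
  shows "moebius_mu (d * m) = 0"
proof (cases "d = 0 \<or> m = 0")
  case False
  have "gcd d m \<noteq> 1" using assms gcd_eq_1_imp_coprime by blast
  then obtain p where "prime p" "p dvd d" "p dvd m" using prime_factor_nat[of "gcd d m"] by auto
  then have "p\<^sup>2 dvd d * m" "\<not> is_unit p" by (auto simp: power2_eq_square intro: mult_dvd_mono)
  then have "\<not> squarefree (d * m)" unfolding squarefree_def by blast
  then show ?thesis by (simp add: moebius_mu_def)
qed (auto simp: moebius_mu_def)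

text \<open>
Writing \<open>n = d * m\<close>, the function \<open>\<mu>(d * m)\<close> vanishes unless \<open>m\<close> is coprime to \<open>d\<close>, and
\<open>gcd n q = d\<close> means that \<open>m\<close> is coprime to \<open>q div d\<close>. Together this says that \<open>m\<close> is coprime to \<open>q\<close>,
so the periodic factor becomes one that is supported on the reduced residues.
\<close>

lemma moebius_gcd_class_sum:
  fixes c :: "nat \<Rightarrow> complex"
  assumes q: "q > 0" and d: "d dvd q"
  shows "(\<Sum>n | n \<in> {1..N} \<and> gcd n q = d. of_int (moebius_mu n) * c n) =
    of_int (moebius_mu d) * (\<Sum>m = 1..N div d. of_int (moebius_mu m) * (if coprime m q then c (d * m) else 0))"
proof -
  obtain e where e: "q = d * e" using d by auto
  have d0: "d > 0" using q e by auto
  have "(\<Sum>n | n \<in> {1..N} \<and> gcd n q = d. of_int (moebius_mu n) * c n) =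
        (\<Sum>m | m \<in> {1..N div d} \<and> coprime m e. of_int (moebius_mu (d * m)) * c (d * m))"
  proof (rule sum.reindex_bij_witness[of _ "\<lambda>m. d * m" "\<lambda>n. n div d"])
    fix n assume n: "n \<in> {n. n \<in> {1..N} \<and> gcd n q = d}"
    then have "d dvd n" by auto
    then obtain m where m: "n = d * m" by auto
    have "d * gcd m e = d" using n unfolding m e gcd_mult_distrib_nat by simp
    then have "gcd m e = 1" using d0 by simp
    then have "coprime m e" by (rule gcd_eq_1_imp_coprime)
    moreover have "m \<le> N div d" using n d0 by (auto simp: m less_eq_div_iff_mult_less_eq mult.commute)
    moreover have "m \<ge> 1" using n by (cases m) (auto simp: m)
    ultimately show "n div d \<in> {m. m \<in> {1..N div d} \<and> coprime m e}" "d * (n div d) = n"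
      "of_int (moebius_mu (d * (n div d))) * c (d * (n div d)) = of_int (moebius_mu n) * c n"
      using d0 by (auto simp: m)
  next
    fix m assume m: "m \<in> {m. m \<in> {1..N div d} \<and> coprime m e}"
    then have "d * m \<le> N" using d0 by (auto simp: less_eq_div_iff_mult_less_eq mult.commute)
    moreover have "gcd (d * m) q = d" using m unfolding e gcd_mult_distrib_nat[symmetric] by simp
    ultimately show "d * m \<in> {n. n \<in> {1..N} \<and> gcd n q = d}" "d * m div d = m"
      using m d0 by auto
  qed
  also have "\<dots> = (\<Sum>m = 1..N div d. if coprime m e then of_int (moebius_mu (d * m)) * c (d * m) else 0)"
    by (simp add: sum.If_cases Int_def)
  also have "\<dots> = (\<Sum>m = 1..N div d. of_int (moebius_mu d) * (of_int (moebius_mu m) * (if coprime m q then c (d * m) else 0)))"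
  proof (rule sum.cong[OF refl])
    fix m
    show "(if coprime m e then of_int (moebius_mu (d * m)) * c (d * m) else 0) =
        of_int (moebius_mu d) * (of_int (moebius_mu m) * (if coprime m q then c (d * m) else 0))"
    proof (cases "coprime m d")
      case True
      then show ?thesis by (simp add: e moebius_mu_coprime_mult coprime_commute)
    next
      case False
      then show ?thesis using moebius_mu_mult_not_coprime[of d m] by (simp add: e coprime_commute)
    qed
  qed
  finally show ?thesis by (simp add: sum_distrib_left)
qed

text \<open>
Each class of numbers with a fixed greatest common divisor \<open>d\<close> with \<open>q\<close> contributes an average of
length \<open>N div d\<close> over reduced residues.
\<close>

lemma moebius_periodic_mean:
  fixes c :: "nat \<Rightarrow> complex"
  assumes q: "q > 0" and per: "\<And>n. c (n + q) = c n"
  shows "(\<lambda>N. (\<Sum>n = 1..N. of_int (moebius_mu n) * c n) / of_nat N) \<longlonglongrightarrow> 0"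
proof -
  define S where "S d N = (\<Sum>m = 1..N. of_int (moebius_mu m) * (if coprime m q then c (d * m) else 0))" for d N
  let ?D = "{d. d dvd q}"
  have finD: "finite ?D" using q by simp
  have S: "(\<lambda>N. S d N / of_nat N) \<longlonglongrightarrow> 0" for d
    unfolding S_def
  proof (rule moebius_coprime_periodic_mean[OF q])
    fix n
    have "c (d * n + d * q) = c (d * n)" by (rule periodic_mult[of c q, OF per])
    moreover have "coprime (n + q) q \<longleftrightarrow> coprime n q" unfolding coprime_iff_gcd_eq_1 by (metis gcd_add1)
    ultimately show "(if coprime (n + q) q then c (d * (n + q)) else 0) = (if coprime n q then c (d * n) else 0)"
      by (simp add: distrib_left)
  qed simp
  have lim: "(\<lambda>N. S d (N div d) / of_nat N) \<longlonglongrightarrow> 0" if d: "d \<in> ?D" for d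
  proof (rule Lim_null_comparison)
    have d0: "d > 0" using d q dvd_pos_nat by auto
    have "filterlim (\<lambda>N. N div d) at_top sequentially"
      unfolding filterlim_at_top
    proof
      fix Z
      show "\<forall>\<^sub>F N in sequentially. Z \<le> N div d"
        using eventually_ge_at_top[of "Z * d"]
        by eventually_elim (use d0 in \<open>simp add: less_eq_div_iff_mult_less_eq\<close>)
    qed
    from filterlim_compose[OF S this] show "(\<lambda>N. norm (S d (N div d) / of_nat (N div d))) \<longlonglongrightarrow> 0"
      by (simp add: tendsto_norm_zero)
    show "\<forall>\<^sub>F N in sequentially. norm (S d (N div d) / of_nat N) \<le> norm (S d (N div d) / of_nat (N div d))"
      using eventually_ge_at_top[of d]
    proof eventually_elim
      case (elim N)
      then have "N div d > 0" using d0 by (simp add: div_greater_zero_iff)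
      then show ?case by (simp add: norm_divide frac_le)
    qed
  qed
  have "(\<Sum>n = 1..N. of_int (moebius_mu n) * c n) = (\<Sum>d\<in>?D. of_int (moebius_mu d) * S d (N div d))" for N
  proof -
    have "(\<Sum>n = 1..N. of_int (moebius_mu n) * c n) = (\<Sum>d\<in>?D. \<Sum>n | n \<in> {1..N} \<and> gcd n q = d. of_int (moebius_mu n) * c n)"
      by (rule sum.group[symmetric]) (use finD in auto)
    also have "\<dots> = (\<Sum>d\<in>?D. of_int (moebius_mu d) * S d (N div d))"
      unfolding S_def by (intro sum.cong refl moebius_gcd_class_sum[OF q]) simp
    finally show ?thesis .
  qed
  then have "(\<lambda>N. (\<Sum>n = 1..N. of_int (moebius_mu n) * c n) / of_nat N) = (\<lambda>N. \<Sum>d\<in>?D. of_int (moebius_mu d) * (S d (N div d) / of_nat N))"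
    by (simp add: sum_divide_distrib)
  moreover have "(\<lambda>N. \<Sum>d\<in>?D. of_int (moebius_mu d) * (S d (N div d) / of_nat N)) \<longlonglongrightarrow> (\<Sum>d\<in>?D. of_int (moebius_mu d) * 0)"
    by (intro tendsto_sum tendsto_mult tendsto_const lim)
  ultimately show ?thesis by simp
qed

section \<open>Subshifts and Weyl approximation\<close>

lemma shift_power: "(shift ^^ n) z = (\<lambda>k. z (k + int n))"
  by (induction n) (auto simp: shift_def algebra_simps)

lemma map_upto_shift: "map (\<lambda>k. z (k + c)) [a..b] = map z [a + c..b + c]"
  by (rule nth_equalityI) (auto simp: algebra_simps)

lemma subshift_shift:
  assumes "z \<in> subshift A x"
  shows "(shift ^^ n) z \<in> subshift A x"
proof -
  have "two_sided_words ((shift ^^ n) z) \<subseteq> two_sided_words z"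
    unfolding two_sided_words_def shift_power map_upto_shift by force
  moreover have "(shift ^^ n) z \<in> two_sided A"
    using assms by (auto simp: subshift_def two_sided_def shift_power)
  ultimately show ?thesis using assms by (auto simp: subshift_def)
qed

lemma topspace_two_sided: "topspace (two_sided_topology A) = two_sided A"
  by (simp add: two_sided_topology_def two_sided_def PiE_UNIV_domain)

lemma openin_cylinder:
  assumes "finite J" "y \<in> two_sided A"
  shows "openin (two_sided_topology A) {w \<in> two_sided A. \<forall>i\<in>J. w i = y i}"
proof -
  have eq: "{w \<in> two_sided A. \<forall>i\<in>J. w i = y i} = (\<Pi>\<^sub>E i\<in>UNIV. if i \<in> J then {y i} else A)"
  proof (rule Set.set_eqI)
    fix w
    have yA: "y i \<in> A" for i using assms(2) by (auto simp: two_sided_def)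
    have P: "w \<in> (\<Pi>\<^sub>E i\<in>UNIV. if i \<in> J then {y i} else A) \<longleftrightarrow> (\<forall>i. if i \<in> J then w i = y i else w i \<in> A)"
      unfolding PiE_UNIV_domain Pi_iff by (rule iffI; metis UNIV_I singleton_iff)
    have L: "w \<in> {w \<in> two_sided A. \<forall>i\<in>J. w i = y i} \<longleftrightarrow> (\<forall>i. w i \<in> A) \<and> (\<forall>i\<in>J. w i = y i)"
      by (auto simp: two_sided_def)
    show "w \<in> {w \<in> two_sided A. \<forall>i\<in>J. w i = y i} \<longleftrightarrow> w \<in> (\<Pi>\<^sub>E i\<in>UNIV. if i \<in> J then {y i} else A)"
      unfolding L P using yA by metis
  qed
  have "openin (product_topology (\<lambda>_. discrete_topology A) UNIV) (\<Pi>\<^sub>E i\<in>UNIV. if i \<in> J then {y i} else A)"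
  proof (rule product_topology_basis)
    show "openin (discrete_topology A) (if i \<in> J then {y i} else A)" for i
      using assms(2) by (auto simp: two_sided_def)
    show "finite {i. (if i \<in> J then {y i} else A) \<noteq> topspace (discrete_topology A)}"
      by (rule finite_subset[OF _ assms(1)]) (auto split: if_splits)
  qed
  then show ?thesis unfolding eq two_sided_topology_def .
qed

text \<open>
A point outside the subshift has a forbidden word, and so has every point of the corresponding
cylinder.
\<close>

lemma closedin_subshift: "closedin (two_sided_topology A) (subshift A x)"
  unfolding closedin_def topspace_two_sided
proof
  show "subshift A x \<subseteq> two_sided A" by (auto simp: subshift_def)
  show "openin (two_sided_topology A) (two_sided A - subshift A x)"
  proof (subst openin_subopen, rule ballI)
    fix y assume y: "y \<in> two_sided A - subshift A x"
    then obtain n m where nm: "n \<le> m" "map y [n..m] \<notin> one_sided_words x"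
      by (auto simp: subshift_def two_sided_words_def)
    let ?U = "{w \<in> two_sided A. \<forall>i\<in>{n..m}. w i = y i}"
    have "?U \<subseteq> two_sided A - subshift A x"
    proof
      fix w assume w: "w \<in> ?U"
      then have eq: "map w [n..m] = map y [n..m]" by simp
      have "map w [n..m] \<notin> one_sided_words x" unfolding eq by (rule nm(2))
      moreover have "map w [n..m] \<in> two_sided_words w" using nm by (auto simp: two_sided_words_def)
      ultimately show "w \<in> two_sided A - subshift A x" using w by (auto simp: subshift_def)
    qed
    moreover have "openin (two_sided_topology A) ?U" using y by (intro openin_cylinder) auto
    ultimately show "\<exists>T. openin (two_sided_topology A) T \<and> y \<in> T \<and> T \<subseteq> two_sided A - subshift A x"
      using y by (intro exI[of _ ?U]) auto
  qed
qed

lemma compactin_subshift: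
  assumes "finite A"
  shows "compactin (two_sided_topology A) (subshift A x)"
proof (rule closedin_compact_space[OF _ closedin_subshift])
  show "compact_space (two_sided_topology A)"
    unfolding two_sided_topology_def using assms
    by (auto simp: compact_space_product_topology compact_space_discrete_topology)
qed

lemma open_contains_cylinder:
  assumes U: "openin (two_sided_topology A) U" and y: "y \<in> U"
  obtains m :: nat where "\<And>w. w \<in> two_sided A \<Longrightarrow> (\<And>k. \<bar>k\<bar> \<le> int m \<Longrightarrow> w k = y k) \<Longrightarrow> w \<in> U"
proof -
  obtain V where V: "finite {i. V i \<noteq> A}" "y \<in> Pi\<^sub>E UNIV V" "Pi\<^sub>E UNIV V \<subseteq> U"
    using U y unfolding two_sided_topology_def openin_product_topology_alt by fastforce
  define m where "m = nat (Max (insert 0 (abs ` {i. V i \<noteq> A})))"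
  have m: "\<bar>i\<bar> \<le> int m" if "V i \<noteq> A" for i
  proof -
    have "\<bar>i\<bar> \<le> Max (insert 0 (abs ` {i. V i \<noteq> A}))" using V(1) that by (intro Max_ge) auto
    moreover have "0 \<le> Max (insert 0 (abs ` {i. V i \<noteq> A}))" using V(1) by (intro Max_ge) auto
    ultimately show ?thesis by (simp add: m_def)
  qed
  show ?thesis
  proof (rule that[of m])
    fix w assume w: "w \<in> two_sided A" "\<And>k. \<bar>k\<bar> \<le> int m \<Longrightarrow> w k = y k"
    have "w i \<in> V i" for i
    proof (cases "V i = A")
      case True
      then show ?thesis using w(1) by (auto simp: two_sided_def)
    next
      case False
      then show ?thesis using w(2)[OF m[OF False]] V(2) by (auto simp: PiE_UNIV_domain)
    qed
    then have "w \<in> Pi\<^sub>E UNIV V" by (auto simp: PiE_UNIV_domain)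
    then show "w \<in> U" using V(3) by blast
  qed
qed

lemma continuous_on_subshift_bounded:
  fixes f :: "(int \<Rightarrow> 'a) \<Rightarrow> complex"
  assumes "finite A" and f: "continuous_map (subtopology (two_sided_topology A) (subshift A x)) euclidean f"
  obtains B where "B > 0" "\<And>y. y \<in> subshift A x \<Longrightarrow> norm (f y) \<le> B"
proof -
  have "compactin (subtopology (two_sided_topology A) (subshift A x)) (subshift A x)"
    using compactin_subshift[OF assms(1)] by (simp add: compactin_subtopology)
  then have "compactin euclidean (f ` subshift A x)" by (rule image_compactin[OF _ f])
  then have "bounded (f ` subshift A x)" by (simp add: compact_imp_bounded)
  then show ?thesis using that by (auto simp: bounded_pos)
qed

text \<open>
Uniform continuity with respect to the product uniformity: finitely many cylinders on which \<open>f\<close> varies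
by less than \<open>e / 2\<close> around their centres cover the compact subshift, and the longest of them
determines \<open>m\<close>.
\<close>

lemma continuous_on_subshift_local:
  fixes f :: "(int \<Rightarrow> 'a) \<Rightarrow> complex"
  assumes "finite A" and f: "continuous_map (subtopology (two_sided_topology A) (subshift A x)) euclidean f"
    and e: "e > 0"
  obtains m :: nat where "\<And>y w. y \<in> subshift A x \<Longrightarrow> w \<in> subshift A x \<Longrightarrow> (\<And>k. \<bar>k\<bar> \<le> int m \<Longrightarrow> y k = w k) \<Longrightarrow> norm (f y - f w) < e"
proof -
  let ?X = "subshift A x" and ?T = "two_sided_topology A"
  have XT: "?X \<subseteq> two_sided A" by (auto simp: subshift_def)
  have "\<exists>m :: nat. \<forall>w \<in> ?X. (\<forall>k. \<bar>k\<bar> \<le> int m \<longrightarrow> w k = y k) \<longrightarrow> norm (f w - f y) < e / 2" if y: "y \<in> ?X" for y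
  proof -
    have "openin (subtopology ?T ?X) {w \<in> topspace (subtopology ?T ?X). f w \<in> ball (f y) (e / 2)}"
      by (rule openin_continuous_map_preimage[OF f]) simp
    then obtain U where U: "openin ?T U" "{w \<in> topspace (subtopology ?T ?X). f w \<in> ball (f y) (e / 2)} = U \<inter> ?X"
      unfolding openin_subtopology by blast
    have "y \<in> {w \<in> topspace (subtopology ?T ?X). f w \<in> ball (f y) (e / 2)}"
      using y XT e by (auto simp: topspace_two_sided)
    then have "y \<in> U" using U(2) by blast
    from open_contains_cylinder[OF U(1) this] obtain m :: nat
      where m: "\<And>w. w \<in> two_sided A \<Longrightarrow> (\<And>k. \<bar>k\<bar> \<le> int m \<Longrightarrow> w k = y k) \<Longrightarrow> w \<in> U" by blast
    have "norm (f w - f y) < e / 2" if w: "w \<in> ?X" "\<forall>k. \<bar>k\<bar> \<le> int m \<longrightarrow> w k = y k" for w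
    proof -
      have "w \<in> U \<inter> ?X" using m[of w] w XT by auto
      then have "f w \<in> ball (f y) (e / 2)" using U(2) by blast
      then show ?thesis by (simp add: dist_norm norm_minus_commute)
    qed
    then show ?thesis by blast
  qed
  then obtain M :: "(int \<Rightarrow> 'a) \<Rightarrow> nat" where M: "\<And>y w. y \<in> ?X \<Longrightarrow> w \<in> ?X \<Longrightarrow> (\<And>k. \<bar>k\<bar> \<le> int (M y) \<Longrightarrow> w k = y k) \<Longrightarrow> norm (f w - f y) < e / 2"
    by metis
  define C where "C y = {w \<in> two_sided A. \<forall>i\<in>{- int (M y)..int (M y)}. w i = y i}" for y
  have "\<exists>\<F>. finite \<F> \<and> \<F> \<subseteq> C ` ?X \<and> ?X \<subseteq> \<Union>\<F>"
  proof -
    have "openin ?T U" if "U \<in> C ` ?X" for U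
      using that XT unfolding C_def by (auto intro!: openin_cylinder)
    moreover have "?X \<subseteq> \<Union> (C ` ?X)" using XT by (auto simp: C_def)
    ultimately show ?thesis using compactin_subshift[OF assms(1), of x] unfolding compactin_def by blast
  qed
  then obtain F where F: "finite F" "F \<subseteq> ?X" "?X \<subseteq> \<Union> (C ` F)"
    by (metis finite_subset_image)
  define m where "m = Max (insert 0 (M ` F))"
  have m: "M v \<le> m" if "v \<in> F" for v unfolding m_def using F(1) that by (intro Max_ge) auto
  show ?thesis
  proof (rule that[of m])
    fix y w assume yw: "y \<in> ?X" "w \<in> ?X" "\<And>k. \<bar>k\<bar> \<le> int m \<Longrightarrow> y k = w k"
    obtain v where v: "v \<in> F" "y \<in> C v" using F(3) yw(1) by blast
    have yv: "y k = v k" "w k = v k" if "\<bar>k\<bar> \<le> int (M v)" for k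
    proof -
      have "k \<in> {- int (M v)..int (M v)}" using that by auto
      then show *: "y k = v k" using v(2) unfolding C_def by blast
      have "\<bar>k\<bar> \<le> int m" using that m[OF v(1)] by linarith
      then show "w k = v k" using yw(3) * by metis
    qed
    have "v \<in> ?X" using v(1) F(2) by blast
    then have "norm (f y - f v) < e / 2" "norm (f w - f v) < e / 2"
      using M[of v y] M[of v w] yw(1,2) yv by blast+
    then have "norm (f y - f v) + norm (f w - f v) < e" by linarith
    moreover have "norm (f y - f w) \<le> norm (f y - f v) + norm (f w - f v)"
      using norm_triangle_ineq4[of "f y - f v" "f w - f v"] by simp
    ultimately show "norm (f y - f w) < e" by linarith
  qed
qed

text \<open>
The bound is uniform in the starting point \<open>l\<close>; this is what the supremum inside the Weyl distance
provides and what allows the passage from \<open>x\<close> to arbitrary points of its subshift.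
\<close>

lemma weyl_dist_less_window:
  assumes "weyl_dist x y < ereal e"
  obtains N0 where "\<And>N l. N \<ge> N0 \<Longrightarrow> l \<ge> 1 \<Longrightarrow> N \<ge> 1 \<Longrightarrow> real (card {n \<in> {l..l + N}. x n \<noteq> y n}) \<le> e * real N"
proof -
  have "\<forall>\<^sub>F N in sequentially. (SUP l\<in>{1..}. ereal (1 / real N * real (card {n \<in> {l..l + N}. x n \<noteq> y n}))) < ereal e"
    using assms unfolding weyl_dist_def by (rule Limsup_lessD)
  then obtain N0 where N0: "\<And>N. N \<ge> N0 \<Longrightarrow> (SUP l\<in>{1..}. ereal (1 / real N * real (card {n \<in> {l..l + N}. x n \<noteq> y n}))) < ereal e"
    unfolding eventually_sequentially by blast
  show ?thesis
  proof (rule that[of N0])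
    fix N l :: nat assume "N \<ge> N0" "l \<ge> 1" "N \<ge> 1"
    have "ereal (1 / real N * real (card {n \<in> {l..l + N}. x n \<noteq> y n})) \<le> (SUP l\<in>{1..}. ereal (1 / real N * real (card {n \<in> {l..l + N}. x n \<noteq> y n})))"
      using \<open>l \<ge> 1\<close> by (intro SUP_upper) auto
    also have "\<dots> < ereal e" using N0[OF \<open>N \<ge> N0\<close>] .
    finally have "1 / real N * real (card {n \<in> {l..l + N}. x n \<noteq> y n}) < e" by simp
    then show "real (card {n \<in> {l..l + N}. x n \<noteq> y n}) \<le> e * real N"
      using \<open>N \<ge> 1\<close> by (simp add: field_simps)
  qed
qed

text \<open>
A bi-infinite extension makes all windows around a position meaningful, including those that reach
to the left of 1.
\<close>

lemma periodic_seq_extend: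
  assumes "periodic_seq y"
  obtains p :: nat and Y :: "int \<Rightarrow> 'a" where "p \<ge> 1" "\<And>k. Y (k + int p) = Y k" "\<And>n. n \<ge> 1 \<Longrightarrow> Y (int n) = y n"
proof -
  obtain p where p: "p \<ge> 1" "\<And>n. n \<ge> 1 \<Longrightarrow> y (n + p) = y n" using assms by (auto simp: periodic_seq_def)
  define Y where "Y k = y (nat (k mod int p) + p)" for k
  have yk: "y (n + k * p) = y n" if "n \<ge> 1" for n k
  proof (induction k)
    case (Suc k)
    have "y (n + Suc k * p) = y ((n + k * p) + p)" by (simp add: algebra_simps)
    also have "\<dots> = y (n + k * p)" using that by (intro p(2)) simp
    finally show ?case using Suc by simp
  qed simp
  have "Y (int n) = y n" if n: "n \<ge> 1" for n
  proof -
    have "nat (int n mod int p) = n mod p" by (simp add: zmod_int[symmetric])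
    then have "Y (int n) = y (n mod p + p)" by (simp add: Y_def)
    also have "\<dots> = y ((n mod p + p) + (n div p) * p)" using p(1) by (intro yk[symmetric]) simp
    also have "(n mod p + p) + (n div p) * p = n + 1 * p" by simp
    also have "y (n + 1 * p) = y n" by (rule yk[OF n])
    finally show ?thesis .
  qed
  then show ?thesis using p(1) by (intro that[of p Y]) (auto simp: Y_def)
qed

text \<open>
The positions in \<open>1..N\<close> around which the window of radius \<open>m\<close> distinguishes \<open>z\<close> from \<open>Y\<close> translated by \<open>r\<close>.
\<close>

definition mismatches :: "nat \<Rightarrow> nat \<Rightarrow> (int \<Rightarrow> 'a) \<Rightarrow> (int \<Rightarrow> 'a) \<Rightarrow> nat \<Rightarrow> nat set" where
  "mismatches m N z Y r = {n \<in> {1..N}. \<exists>j\<in>{- int m..int m}. z (int n + j) \<noteq> Y (int n + j + int r)}"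

text \<open>
The block of \<open>z\<close> on \<open>1 - m..N + m\<close> is a block of \<open>x\<close>, starting at some position \<open>k\<close>. There \<open>x\<close> is close
to \<open>y\<close>, hence \<open>z\<close> is close to \<open>y\<close> translated by \<open>k + m - 1\<close>, which only matters modulo \<open>p\<close>. One
disagreement spoils at most \<open>2 * m + 1\<close> of the windows of radius \<open>m\<close>.
\<close>

lemma subshift_window_close:
  assumes z: "z \<in> subshift A x" and y: "weyl_dist x y < ereal e"
    and Y: "p \<ge> 1" "\<And>k. Y (k + int p) = Y k" "\<And>n. n \<ge> 1 \<Longrightarrow> Y (int n) = y n"
  obtains N0 where "\<And>N. N \<ge> N0 \<Longrightarrow> \<exists>r<p. real (card (mismatches m N z Y r)) \<le> real (2 * m + 1) * (e * real (N + 2 * m))"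
proof -
  obtain N0 where N0: "\<And>N l. N \<ge> N0 \<Longrightarrow> l \<ge> 1 \<Longrightarrow> N \<ge> 1 \<Longrightarrow> real (card {n \<in> {l..l + N}. x n \<noteq> y n}) \<le> e * real N"
    using weyl_dist_less_window[OF y] by blast
  have YY: "Y (k + int c * int p) = Y k" for k c
  proof (induction c)
    case (Suc c)
    have "Y (k + int (Suc c) * int p) = Y ((k + int c * int p) + int p)" by (simp add: algebra_simps)
    then show ?case using Suc by (simp add: Y(2))
  qed simp
  show ?thesis
  proof (rule that[of "max 1 N0"])
    fix N assume N: "N \<ge> max 1 N0"
    define L where "L = N + 2 * m"
    have L: "L \<ge> 1" "L \<ge> N0" using N by (auto simp: L_def)
    have le: "1 - int m \<le> int N + int m" using N by simp
    have "map z [1 - int m..int N + int m] \<in> one_sided_words x"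
      using z le unfolding subshift_def two_sided_words_def by blast
    then obtain k l where kl: "1 \<le> k" "k \<le> l" "map z [1 - int m..int N + int m] = map x [k..<Suc l]"
      unfolding one_sided_words_def by auto
    have zx: "z (1 - int m + int i) = x (k + i)" if i: "i < L" for i
    proof -
      have len: "length (map z [1 - int m..int N + int m]) = L" by (simp add: L_def)
      then have len2: "Suc l - k = L" unfolding kl(3) length_map length_upt .
      have "map z [1 - int m..int N + int m] ! i = z (1 - int m + int i)" using i len by simp
      moreover have "map x [k..<Suc l] ! i = x (k + i)" using i len2 by (simp del: upt_Suc)
      ultimately show ?thesis using kl(3) by simp
    qed
    define a where "a = k + m - 1"
    define r where "r = a mod p"
    have Yr: "Y (i + int r) = Y (i + int a)" for i
    proof -
      have "int a = int r + int (a div p) * int p" unfolding r_def by (metis mod_div_mult_eq of_nat_add of_nat_mult)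
      then have "Y (i + int a) = Y ((i + int r) + int (a div p) * int p)" by (simp add: add.assoc)
      then show ?thesis by (simp only: YY)
    qed
    let ?D = "{n \<in> {k..k + L}. x n \<noteq> y n}"
    let ?E = "\<lambda>j. {n \<in> {1..N}. z (int n + j) \<noteq> Y (int n + j + int r)}"
    have card_E: "card (?E j) \<le> card ?D" if j: "j \<in> {- int m..int m}" for j
    proof (rule card_inj_on_le[where f = "\<lambda>n. nat (int n + j + int a)"])
      have pos: "int n + j + int a \<ge> 1" if "n \<ge> 1" for n using j that kl(1) by (auto simp: a_def)
      show "inj_on (\<lambda>n. nat (int n + j + int a)) (?E j)"
      proof (rule inj_onI)
        fix n n' assume "n \<in> ?E j" "n' \<in> ?E j" "nat (int n + j + int a) = nat (int n' + j + int a)"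
        then show "n = n'" using pos[of n] pos[of n'] by auto
      qed
      show "(\<lambda>n. nat (int n + j + int a)) ` ?E j \<subseteq> ?D"
      proof
        fix v assume "v \<in> (\<lambda>n. nat (int n + j + int a)) ` ?E j"
        then obtain n where n: "n \<in> {1..N}" "z (int n + j) \<noteq> Y (int n + j + int r)" and v: "v = nat (int n + j + int a)" by auto
        define i where "i = nat (int n + j + int m - 1)"
        have i: "int i = int n + j + int m - 1" "i < L" using n j by (auto simp: i_def L_def)
        have v': "v = k + i" "v \<ge> 1" "int v = int n + j + int a" using i kl(1) pos[of n] n by (auto simp: v a_def)
        have "z (int n + j) = x v" using zx[OF i(2)] i(1) v'(1) by simp
        moreover have "Y (int n + j + int r) = y v" using Yr[of "int n + j"] Y(3)[OF v'(2)] v'(3) by simp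
        ultimately show "v \<in> ?D" using n(2) v'(1) i(2) by auto
      qed
    qed simp
    have "card (\<Union>j\<in>{- int m..int m}. ?E j) \<le> (\<Sum>j\<in>{- int m..int m}. card (?E j))"
      by (rule card_UN_le) simp
    also have "\<dots> \<le> (\<Sum>j\<in>{- int m..int m}. card ?D)" by (rule sum_mono) (rule card_E)
    also have "\<dots> = (2 * m + 1) * card ?D"
    proof -
      have "card {- int m..int m} = 2 * m + 1" unfolding card_atLeastAtMost_int by linarith
      then show ?thesis by (simp only: sum_constant of_nat_id)
    qed
    finally have "real (card (\<Union>j\<in>{- int m..int m}. ?E j)) \<le> real ((2 * m + 1) * card ?D)" by (simp only: of_nat_le_iff)
    also have "\<dots> = real (2 * m + 1) * real (card ?D)" by (rule of_nat_mult)
    also have "\<dots> \<le> real (2 * m + 1) * (e * real L)"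
      by (intro mult_left_mono N0 L kl(1)) simp
    also have "(\<Union>j\<in>{- int m..int m}. ?E j) = mismatches m N z Y r"
      by (auto simp: mismatches_def)
    finally show "\<exists>r<p. real (card (mismatches m N z Y r)) \<le> real (2 * m + 1) * (e * real (N + 2 * m))"
      using Y(1) by (intro exI[of _ r]) (auto simp: r_def L_def)
  qed
qed

lemma periodic_window_mean:
  fixes \<phi> :: "(int \<Rightarrow> 'a) \<Rightarrow> complex" and Y :: "int \<Rightarrow> 'a"
  assumes "p \<ge> 1" "\<And>k. Y (k + int p) = Y k"
  shows "(\<lambda>N. (\<Sum>n = 1..N. of_int (moebius_mu n) * \<phi> (\<lambda>j. Y (int n + j + int r))) / of_nat N) \<longlonglongrightarrow> 0"
proof (rule moebius_periodic_mean[of p])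
  fix n
  have "Y (int (n + p) + j + int r) = Y (int n + j + int r)" for j
    using assms(2)[of "int n + j + int r"] by (simp add: algebra_simps)
  then show "\<phi> (\<lambda>j. Y (int (n + p) + j + int r)) = \<phi> (\<lambda>j. Y (int n + j + int r))" by simp
qed (use assms in simp)

theorem theorem5p1:
  fixes A :: "'a set" and x :: "nat \<Rightarrow> 'a"
    and f :: "(int \<Rightarrow> 'a) \<Rightarrow> complex" and z :: "int \<Rightarrow> 'a"
  assumes "finite A"
    and "x \<in> one_sided A"
    and "WRAP A x"
    and "continuous_map (subtopology (two_sided_topology A) (subshift A x)) euclidean f"
    and "z \<in> subshift A x"
  shows "(\<lambda>N. 1 / of_nat N * (\<Sum>n = 1..N. f ((shift ^^ n) z) * of_int (moebius_mu n)))
           \<longlonglongrightarrow> 0"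
proof (rule tendstoI)
  fix e :: real assume e: "e > 0"
  let ?X = "subshift A x"
  define S where "S n = (shift ^^ n) z" for n
  have SX: "S n \<in> ?X" for n unfolding S_def by (rule subshift_shift[OF assms(5)])
  obtain B where B: "B > 0" "\<And>y. y \<in> ?X \<Longrightarrow> norm (f y) \<le> B"
    using continuous_on_subshift_bounded[OF assms(1,4)] by blast
  obtain m :: nat where m: "\<And>y w. y \<in> ?X \<Longrightarrow> w \<in> ?X \<Longrightarrow> (\<And>k. \<bar>k\<bar> \<le> int m \<Longrightarrow> y k = w k) \<Longrightarrow> norm (f y - f w) < e / 4"
    using continuous_on_subshift_local[OF assms(1,4), of "e / 4"] e by auto
  define agree where "agree u w \<longleftrightarrow> (\<forall>k. \<bar>k\<bar> \<le> int m \<longrightarrow> u k = w k)" for u w :: "int \<Rightarrow> 'a"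
  \<comment> \<open>A function of the coordinates \<open>-m..m\<close> that approximates \<open>f\<close> on the subshift; it is also defined on windows that occur in no point of the subshift, as those of the periodic sequence may.\<close>
  define \<phi> where "\<phi> u = (if \<exists>w\<in>?X. agree u w then f (SOME w. w \<in> ?X \<and> agree u w) else 0)" for u
  have \<phi>_some: "(SOME w. w \<in> ?X \<and> agree u w) \<in> ?X \<and> agree u (SOME w. w \<in> ?X \<and> agree u w)" if "\<exists>w\<in>?X. agree u w" for u
    using someI_ex[of "\<lambda>w. w \<in> ?X \<and> agree u w"] that by blast
  have \<phi>_bound: "norm (\<phi> u) \<le> B" for u
    using B \<phi>_some[of u] by (auto simp: \<phi>_def)
  have \<phi>_close: "norm (f u - \<phi> u) \<le> e / 4" if u: "u \<in> ?X" for u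
  proof -
    have ex: "\<exists>w\<in>?X. agree u w" using u by (auto simp: agree_def)
    define w where "w = (SOME w. w \<in> ?X \<and> agree u w)"
    have "w \<in> ?X" "agree u w" using \<phi>_some[OF ex] unfolding w_def by blast+
    then have "norm (f u - f w) < e / 4" unfolding agree_def using m[OF u] by blast
    moreover have "\<phi> u = f w" unfolding \<phi>_def w_def if_P[OF ex] ..
    ultimately show ?thesis by simp
  qed
  have \<phi>_cong: "\<phi> u = \<phi> v" if "agree u v" for u v
  proof -
    have "agree u w \<longleftrightarrow> agree v w" for w using that by (auto simp: agree_def)
    then show ?thesis by (simp add: \<phi>_def)
  qed
  \<comment> \<open>Up to \<open>(2 * m + 1) * \<delta> * (N + 2 * m)\<close> windows disagree, each at a cost of at most \<open>2 * B\<close>; with \<open>N + 2 * m \<le> 2 * N\<close> this gives \<open>N * e / 4\<close>.\<close>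
  define \<delta> where "\<delta> = e / (16 * B * real (2 * m + 1))"
  have \<delta>: "\<delta> > 0" using e B by (simp add: \<delta>_def)
  obtain y where y: "periodic_seq y" "weyl_dist x y < ereal \<delta>" using assms(3) \<delta> by (auto simp: WRAP_def)
  obtain p Y where Y: "p \<ge> 1" "\<And>k. Y (k + int p) = Y k" "\<And>n. n \<ge> 1 \<Longrightarrow> Y (int n) = y n"
    using periodic_seq_extend[OF y(1)] by blast
  obtain N0 where N0: "\<And>N. N \<ge> N0 \<Longrightarrow> \<exists>r<p. real (card (mismatches m N z Y r)) \<le> real (2 * m + 1) * (\<delta> * real (N + 2 * m))"
    using subshift_window_close[OF assms(5) y(2) Y] by blast
  define c where "c r n = \<phi> (\<lambda>j. Y (int n + j + int r))" for r n
  have "\<forall>\<^sub>F N in sequentially. \<forall>r\<in>{..<p}. norm ((\<Sum>n = 1..N. of_int (moebius_mu n) * c r n) / of_nat N) < e / 4"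
  proof (rule eventually_ball_finite)
    show "\<forall>r\<in>{..<p}. \<forall>\<^sub>F N in sequentially. norm ((\<Sum>n = 1..N. of_int (moebius_mu n) * c r n) / of_nat N) < e / 4"
      using tendstoD[OF periodic_window_mean[of p Y \<phi>, OF Y(1,2)], of "e / 4"] e by (auto simp: c_def)
  qed simp
  then show "\<forall>\<^sub>F N in sequentially. dist (1 / of_nat N * (\<Sum>n = 1..N. f ((shift ^^ n) z) * of_int (moebius_mu n))) 0 < e"
    using eventually_ge_at_top[of "max 1 (max N0 (2 * m))"]
  proof eventually_elim
    case (elim N)
    have N: "N \<ge> 1" "N \<ge> N0" "N \<ge> 2 * m" using elim(2) by auto
    obtain r where r: "r < p" and cardE: "real (card (mismatches m N z Y r)) \<le> real (2 * m + 1) * (\<delta> * real (N + 2 * m))"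
      using N0[OF N(2)] by blast
    let ?E = "mismatches m N z Y r"
    let ?mu = "\<lambda>n. of_int (moebius_mu n) :: complex"
    have mu: "norm (?mu n * w) \<le> norm w" for n w
      using abs_moebius_mu_le[of n] by (simp add: norm_mult mult_left_le_one_le)
    have d1: "norm (\<Sum>n = 1..N. ?mu n * (f (S n) - \<phi> (S n))) \<le> real N * (e / 4)"
    proof -
      have "norm (\<Sum>n = 1..N. ?mu n * (f (S n) - \<phi> (S n))) \<le> (\<Sum>n = 1..N. e / 4)"
        by (intro sum_norm_le order_trans[OF mu] \<phi>_close SX)
      then show ?thesis by simp
    qed
    have d2: "norm (\<Sum>n = 1..N. ?mu n * (\<phi> (S n) - c r n)) \<le> real N * (e / 4)"
    proof -
      have summand_le: "norm (?mu n * (\<phi> (S n) - c r n)) \<le> (if n \<in> ?E then 2 * B else 0)" if "n \<in> {1..N}" for n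
      proof (cases "n \<in> ?E")
        case True
        have "norm (\<phi> (S n) - c r n) \<le> B + B"
          unfolding c_def by (intro order_trans[OF norm_triangle_ineq4] add_mono \<phi>_bound)
        then show ?thesis using True order_trans[OF mu] by simp
      next
        case False
        have "agree (S n) (\<lambda>j. Y (int n + j + int r))"
          unfolding agree_def
        proof (intro allI impI)
          fix k assume "\<bar>k\<bar> \<le> int m"
          then have "k \<in> {- int m..int m}" by auto
          then have "z (int n + k) = Y (int n + k + int r)"
            using False that unfolding mismatches_def by blast
          then show "S n k = Y (int n + k + int r)" by (simp add: S_def shift_power add.commute)
        qed
        then have "\<phi> (S n) = c r n" unfolding c_def by (rule \<phi>_cong)
        then show ?thesis using B(1) by simp
      qed
      have "norm (\<Sum>n = 1..N. ?mu n * (\<phi> (S n) - c r n)) \<le> (\<Sum>n = 1..N. if n \<in> ?E then 2 * B else 0)"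
        by (rule sum_norm_le) (rule summand_le)
      also have "\<dots> = (\<Sum>n\<in>{1..N} \<inter> ?E. 2 * B)" by (rule sum.inter_restrict[symmetric]) simp
      also have "{1..N} \<inter> ?E = ?E" by (auto simp: mismatches_def)
      also have "(\<Sum>n\<in>?E. 2 * B) = real (card ?E) * (2 * B)" by (rule sum_constant)
      also have "\<dots> \<le> (real (2 * m + 1) * (\<delta> * real (N + 2 * m))) * (2 * B)"
        using cardE B(1) by (intro mult_right_mono) auto
      also have "\<dots> \<le> (real (2 * m + 1) * (\<delta> * (2 * real N))) * (2 * B)"
        using N(3) B(1) \<delta> by (intro mult_right_mono mult_left_mono) auto
      also have "\<dots> = real N * (e / 4)"
        using B(1) by (simp add: \<delta>_def field_simps del: of_nat_add of_nat_mult of_nat_Suc)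
      finally show ?thesis .
    qed
    have d3: "norm (\<Sum>n = 1..N. ?mu n * c r n) \<le> real N * (e / 4)"
    proof -
      have "norm ((\<Sum>n = 1..N. ?mu n * c r n) / of_nat N) < e / 4" using elim(1) r by blast
      then show ?thesis using N(1) by (simp add: norm_divide field_simps)
    qed
    have "(\<Sum>n = 1..N. f (S n) * ?mu n) = (\<Sum>n = 1..N. ?mu n * (f (S n) - \<phi> (S n))) + (\<Sum>n = 1..N. ?mu n * (\<phi> (S n) - c r n)) + (\<Sum>n = 1..N. ?mu n * c r n)"
      by (simp add: sum.distrib[symmetric] algebra_simps)
    also have "norm \<dots> \<le> real N * (e / 4) + real N * (e / 4) + real N * (e / 4)"
      by (intro order_trans[OF norm_triangle_ineq] add_mono d1 d2 d3)
    also have "\<dots> = real N * (3 * e / 4)" by (simp add: field_simps)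
    also have "\<dots> < real N * e" using N(1) e by simp
    finally have "norm (\<Sum>n = 1..N. f (S n) * ?mu n) < real N * e" .
    then show ?case using N(1) by (simp add: S_def norm_mult norm_divide field_simps)
  qed
qed

end
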